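(* Let $(Q_i,Y_i)$, $i=1,2,\dots$, be i.i.d. query–judgment pairs, let $\mathcal{F}_n$ be a nondecreasing sequence of classes of scoring functions, let $k_n\in\mathbb{N}$ be aggregation orders, and let $\widehat R_{\varphi,n}$ be the $U$-statistic empirical surrogate risk with $k=k_n$ and $R_\varphi$ the asymptotic surrogate risk, as defined in the context. Assume the following. (D) There exist constants $\beta>0$ and $K_1>0$ such that $p_q\le K_1q^{-\beta-1}$ for all $q$. (E) For each $n$ there are constants $B_n,L_n<\infty$ such that for all $s\in\mathcal{S}$, all $f,f_1,f_2\in\mathcal{F}_n$ and all $q\in\mathcal{Q}$: $0\le\varphi(f(q),s)\le B_n$ and $|\varphi(f_1(q),s)-\varphi(f_2(q),s)|\le L_n\|f_1-f_2\|$. (F) For all $\varepsilon>0$, $\mathcal{F}_n$ has $\varepsilon$-covering number $N(\varepsilon,n)<\infty$. Assume also that at least one of the following two conditions holds: (I) There exist $\rho>0$ and a constant $C$ such that for all $q\in\mathcal{Q}$, $n\in\mathbb{N}$, $k\in\mathbb{N}$ and $f\in\mathcal{F}_n$, $$\Bigl|\mathbb{E}_q[\varphi(f(q),s(Y_1,\dots,Y_k))]-\lim_{k'}\mathbb{E}_q[\varphi(f(q),s(Y_1,\dots,Y_{k'}))]\Bigr|\le C B_n k^{-\rho},$$ and $B_n=o(k_n^\rho)$. (I$'$) Sequences $\{\varepsilon_n\}\subset\mathbb{R}_+$ and $\{k_n\}\subset\mathbb{N}$ and an $\varepsilon_n$-cover $\mathcal{F}_n^1,\dots,\mathcal{F}_n^{N(\varepsilon_n,n)}$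 of $\mathcal{F}_n$ can be chosen such that $$\max_{i\in\{1,\dots,N(\varepsilon_n,n)\}}\ \inf_{f\in\mathcal{F}_n^i}\Bigl|R_\varphi(f)-\sum_q p_q\,\mathbb{E}_q[\varphi(f(q),s(Y_1,\dots,Y_{k_n}))]\Bigr|+2L_n\varepsilon_n\to 0.$$ Finally assume: (II) $k_nB_n^{(1+\beta)/\beta}=o(n)$, and for any fixed $\varepsilon>0$, $k_nB_n\bigl[\log N\bigl(\tfrac{\varepsilon}{4L_n},n\bigr)\bigr]^{1/2}=o(\sqrt n)$. Then $$\sup_{f\in\mathcal{F}_n}\bigl|\widehat R_{\varphi,n}(f)-R_\varphi(f)\bigr|\to 0\quad\text{in probability as } n\to\infty.$$
   Context: Data. $\mathcal{Q}$ is a countable set of queries identified with (a subset of) $\mathbb{N}$, $\mathcal{Y}$ is the space of preference judgments, $(Q_i,Y_i)\in\mathcal{Q}\times\mathcal{Y}$ are i.i.d., and $p_q$ is the probability of $Q=q$; without loss of generality $p_q$ is nonincreasing in the index $q$. $\mathbb{E}_q$ denotes expectation when $Y_1,Y_2,\dots$ are drawn i.i.d. from the conditional law of $Y$ given $Q=q$. Structures. $\mathcal{S}$ is a topological space, and structure functions $s=s_k:\mathcal{Y}^k\to\mathcal{S}$, $k\ge1$, are given (the subscript is suppressed). Standing assumption: for each $q$, if $Y_1,Y_2,\dots$ are i.i.d. conditional on $Q=q$, the law $\mu_q^k$ of $s(Y_1,\dots,Y_k)$ converges in distribution, as $k\to\infty$, to a limiting law $\mu_q$ on $\mathcal{S}$.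 Surrogate. $\varphi:\mathbb{R}^m\times\mathcal{S}\to\mathbb{R}_+$ with $s\mapsto\varphi(\alpha,s)$ continuous for each $\alpha$. The asymptotic surrogate risk of $f:\mathcal{Q}\to\mathbb{R}^m$ is $R_\varphi(f)=\sum_q p_q\int_{\mathcal{S}}\varphi(f(q),s)\,d\mu_q(s)$. Function classes. $\mathcal{F}_1\subseteq\mathcal{F}_2\subseteq\cdots$ are classes of functions $f:\mathcal{Q}\to\mathbb{R}^m$, contained in a normed space with norm $\|\cdot\|$. The $\varepsilon$-covering number $N(\varepsilon,n)$ of $\mathcal{F}_n$ is the smallest $N$ for which there are $f^1,\dots,f^N$ with $\min_i\|f^i-f\|\le\varepsilon$ for every $f\in\mathcal{F}_n$; the corresponding $\varepsilon$-cover sets $\mathcal{F}_n^i$ are the subsets of $\mathcal{F}_n$ of elements within $\varepsilon$ of $f^i$. Empirical risk. With $\mathcal{B}(q)=\{i\in\{1,\dots,n\}: Q_i=q\}$ and $\widehat n_q=|\mathcal{B}(q)|$, and $k=k_n$, $$\widehat R_{\varphi,n}(f)=\frac1n\sum_q\widehat n_q\binom{\widehat n_q}{k}^{-1}\sum_{i_1<\cdots<i_k,\ i_j\in\mathcal{B}(q)}\varphi\bigl(f(q),s(Y_{i_1},\dots,Y_{i_k})\bigr),$$ where if $\widehat n_q<k$ one sets $\binom{\widehat n_q}{k}=1$ and the inner sum is replaced by the single term $\varphi(f(q),s(\{Y_i: i\in\mathcal{B}(q)\}))$ (queries with $\widehat n_q=0$ contribute $0$). *)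

theory Defs
  imports "HOL-Probability.Probability" "HOL-Library.Landau_Symbols"
    "HOL-Library.Extended_Nat"
begin

text \<open>
  Queries form a set \<open>\<Q>\<close> of positive naturals and judgments live in a measurable space \<open>MY\<close>.
  The kernel \<open>\<kappa> q\<close> is (a version of) the conditional law of the judgment given query \<open>q\<close>, and
  \<open>p q\<close> is the probability of \<open>q\<close> (take \<open>A = space MY\<close> in the last clause).  Measurability of the
  pairs is part of \<open>indep_vars\<close>; equality of their laws follows from the last clause.
\<close>

definition iid_query_judgments ::
  "'w measure \<Rightarrow> nat set \<Rightarrow> 'y measure \<Rightarrow> (nat \<Rightarrow> real) \<Rightarrow> (nat \<Rightarrow> 'y measure) \<Rightarrow>
   (nat \<Rightarrow> 'w \<Rightarrow> nat) \<Rightarrow> (nat \<Rightarrow> 'w \<Rightarrow> 'y) \<Rightarrow> bool" where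
  "iid_query_judgments M \<Q> MY p \<kappa> Q Y \<longleftrightarrow>
     prob_space M \<and>
     prob_space.indep_vars M (\<lambda>_. count_space \<Q> \<Otimes>\<^sub>M MY) (\<lambda>i \<omega>. (Q i \<omega>, Y i \<omega>)) {1..} \<and>
     (\<forall>q\<in>\<Q>. prob_space (\<kappa> q) \<and> sets (\<kappa> q) = sets MY) \<and>
     (\<forall>i\<ge>1. \<forall>q\<in>\<Q>. \<forall>A\<in>sets MY.
        measure M {\<omega> \<in> space M. Q i \<omega> = q \<and> Y i \<omega> \<in> A} = p q * measure (\<kappa> q) A)"

text \<open>
  The structure functions \<open>s\<^sub>k\<close>, \<open>k \<ge> 1\<close>, are given by a single function on lists,
  whose restriction to lists of length \<open>k\<close> is \<open>s\<^sub>k\<close>.  Its value on the empty list is irrelevant.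
\<close>

definition measurable_structure :: "'y measure \<Rightarrow> ('y list \<Rightarrow> 's::topological_space) \<Rightarrow> bool" where
  "measurable_structure MY s \<longleftrightarrow>
     (\<forall>k\<ge>1. (\<lambda>y. s (map y [0..<k])) \<in> measurable (Pi\<^sub>M {..<k} (\<lambda>_. MY)) borel)"

definition structure_law ::
  "('y list \<Rightarrow> 's::topological_space) \<Rightarrow> 'y measure \<Rightarrow> nat \<Rightarrow> 's measure" where
  "structure_law s \<nu> k = distr (Pi\<^sub>M {..<k} (\<lambda>_. \<nu>)) borel (\<lambda>y. s (map y [0..<k]))"

definition converges_in_distribution ::
  "(nat \<Rightarrow> 's::topological_space measure) \<Rightarrow> 's measure \<Rightarrow> bool" where
  "converges_in_distribution \<mu>s \<mu> \<longleftrightarrow>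
     (\<forall>g :: 's \<Rightarrow> real. continuous_on UNIV g \<longrightarrow> bounded (range g) \<longrightarrow>
        (\<lambda>k. \<integral>x. g x \<partial>\<mu>s k) \<longlonglongrightarrow> (\<integral>x. g x \<partial>\<mu>))"

definition expected_surrogate ::
  "('a \<Rightarrow> 's \<Rightarrow> real) \<Rightarrow> ('y list \<Rightarrow> 's) \<Rightarrow> 'y measure \<Rightarrow> nat \<Rightarrow> 'a \<Rightarrow> real" where
  "expected_surrogate \<phi> s \<nu> k \<alpha> = (\<integral>y. \<phi> \<alpha> (s (map y [0..<k])) \<partial>(Pi\<^sub>M {..<k} (\<lambda>_. \<nu>)))"

definition asymptotic_risk ::
  "nat set \<Rightarrow> (nat \<Rightarrow> real) \<Rightarrow> ('a \<Rightarrow> 's \<Rightarrow> real) \<Rightarrow> (nat \<Rightarrow> 's measure) \<Rightarrow> (nat \<Rightarrow> 'a) \<Rightarrow> real" where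
  "asymptotic_risk \<Q> p \<phi> \<mu> f = (\<Sum>\<^sub>\<infinity>q\<in>\<Q>. p q * (\<integral>x. \<phi> (f q) x \<partial>\<mu> q))"

definition order_risk ::
  "nat set \<Rightarrow> (nat \<Rightarrow> real) \<Rightarrow> ('a \<Rightarrow> 's \<Rightarrow> real) \<Rightarrow> ('y list \<Rightarrow> 's) \<Rightarrow> (nat \<Rightarrow> 'y measure) \<Rightarrow>
   nat \<Rightarrow> (nat \<Rightarrow> 'a) \<Rightarrow> real" where
  "order_risk \<Q> p \<phi> s \<kappa> k f = (\<Sum>\<^sub>\<infinity>q\<in>\<Q>. p q * expected_surrogate \<phi> s (\<kappa> q) k (f q))"

definition block :: "(nat \<Rightarrow> nat) \<Rightarrow> nat \<Rightarrow> nat \<Rightarrow> nat set" where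
  "block qs n q = {i \<in> {1..n}. qs i = q}"

text \<open>
  Index tuples \<open>i\<^sub>1 < \<dots> < i\<^sub>k\<close> in \<open>I\<close> are the increasing enumerations of the \<open>k\<close>-subsets of \<open>I\<close>.
  If \<open>I\<close> has fewer than \<open>k\<close> elements, all of its judgments are aggregated in increasing index order;
  symmetry of the structure functions is not required.
\<close>

definition block_average ::
  "('a \<Rightarrow> 's \<Rightarrow> real) \<Rightarrow> ('y list \<Rightarrow> 's) \<Rightarrow> nat \<Rightarrow> (nat \<Rightarrow> 'y) \<Rightarrow> nat set \<Rightarrow> 'a \<Rightarrow> real" where
  "block_average \<phi> s k ys I \<alpha> =
     (if k \<le> card I
      then (\<Sum>J | J \<subseteq> I \<and> card J = k. \<phi> \<alpha> (s (map ys (sorted_list_of_set J)))) / real (card I choose k)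
      else \<phi> \<alpha> (s (map ys (sorted_list_of_set I))))"

definition empirical_risk ::
  "('a \<Rightarrow> 's \<Rightarrow> real) \<Rightarrow> ('y list \<Rightarrow> 's) \<Rightarrow> nat \<Rightarrow> nat \<Rightarrow> (nat \<Rightarrow> nat) \<Rightarrow> (nat \<Rightarrow> 'y) \<Rightarrow>
   (nat \<Rightarrow> 'a) \<Rightarrow> real" where
  "empirical_risk \<phi> s k n qs ys f =
     (1 / real n) * (\<Sum>q \<in> qs ` {1..n}.
        real (card (block qs n q)) * block_average \<phi> s k ys (block qs n q) (f q))"

text \<open>
  A normed space \<open>V\<close> of functions on \<open>\<Q>\<close>.  Such functions are represented by their extension
  by zero, so that equality of representatives is equality on \<open>\<Q>\<close>.
\<close>

definition normed_function_space ::
  "nat set \<Rightarrow> (nat \<Rightarrow> 'a::real_vector) set \<Rightarrow> ((nat \<Rightarrow> 'a) \<Rightarrow> real) \<Rightarrow> bool" where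
  "normed_function_space \<Q> V nrm \<longleftrightarrow>
     (\<forall>f\<in>V. \<forall>q. q \<notin> \<Q> \<longrightarrow> f q = 0) \<and>
     (\<lambda>_. 0) \<in> V \<and>
     (\<forall>f\<in>V. \<forall>g\<in>V. (\<lambda>q. f q + g q) \<in> V) \<and>
     (\<forall>c. \<forall>f\<in>V. (\<lambda>q. c *\<^sub>R f q) \<in> V) \<and>
     (\<forall>f\<in>V. 0 \<le> nrm f \<and> (nrm f = 0 \<longleftrightarrow> f = (\<lambda>_. 0))) \<and>
     (\<forall>c. \<forall>f\<in>V. nrm (\<lambda>q. c *\<^sub>R f q) = \<bar>c\<bar> * nrm f) \<and>
     (\<forall>f\<in>V. \<forall>g\<in>V. nrm (\<lambda>q. f q + g q) \<le> nrm f + nrm g)"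

definition is_cover ::
  "(nat \<Rightarrow> 'a::real_vector) set \<Rightarrow> ((nat \<Rightarrow> 'a) \<Rightarrow> real) \<Rightarrow> real \<Rightarrow> (nat \<Rightarrow> 'a) set \<Rightarrow> nat \<Rightarrow>
   (nat \<Rightarrow> nat \<Rightarrow> 'a) \<Rightarrow> bool" where
  "is_cover V nrm \<epsilon> F N c \<longleftrightarrow>
     (\<forall>i\<in>{1..N}. c i \<in> V) \<and> (\<forall>f\<in>F. \<exists>i\<in>{1..N}. nrm (\<lambda>q. c i q - f q) \<le> \<epsilon>)"

definition covering_number ::
  "(nat \<Rightarrow> 'a::real_vector) set \<Rightarrow> ((nat \<Rightarrow> 'a) \<Rightarrow> real) \<Rightarrow> real \<Rightarrow> (nat \<Rightarrow> 'a) set \<Rightarrow> enat" where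
  "covering_number V nrm \<epsilon> F = Inf {enat N | N. \<exists>c. is_cover V nrm \<epsilon> F N c}"

definition cover_set ::
  "((nat \<Rightarrow> 'a::real_vector) \<Rightarrow> real) \<Rightarrow> real \<Rightarrow> (nat \<Rightarrow> 'a) set \<Rightarrow> (nat \<Rightarrow> 'a) \<Rightarrow> (nat \<Rightarrow> 'a) set" where
  "cover_set nrm \<epsilon> F g = {f \<in> F. nrm (\<lambda>q. g q - f q) \<le> \<epsilon>}"

definition converges_to_0_in_probability :: "'w measure \<Rightarrow> (nat \<Rightarrow> 'w \<Rightarrow> ennreal) \<Rightarrow> bool" where
  "converges_to_0_in_probability M Z \<longleftrightarrow>
     (\<forall>n. Z n \<in> borel_measurable M) \<and>
     (\<forall>\<epsilon>>0. (\<lambda>n. measure M {\<omega> \<in> space M. ennreal \<epsilon> < Z n \<omega>}) \<longlonglongrightarrow> 0)"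

end

theory Submission
  imports Defs "HOL-Combinatorics.Permutations"
begin

text \<open>
  Condition on the queries. The judgments are then independent, and Hoeffding's representation writes the
  U-statistics of all blocks with at least \<open>k\<close> members as an average, over the permutations that preserve
  the blocks, of weighted sums of independent terms supported on disjoint \<open>k\<close>-sets. No symmetry of the
  structure functions is needed since the members of a block are i.i.d.
  Jensen's inequality and Hoeffding's lemma give deviations of order \<open>exp (- n t\<^sup>2 / (k b\<^sup>2))\<close>,
  and the conditional mean, an i.i.d. average over the queries, obeys Hoeffding's inequality.
  Blocks with fewer than \<open>k\<close> members have total mass at most \<open>k m / n\<close> from the queries
  \<open>q \<le> m\<close> plus the tail mass of order \<open>m powr (- \<beta>)\<close>; the choice of \<open>m\<close> of order
  \<open>b powr (1 / \<beta>)\<close> makes \<open>b\<close> times this mass small.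
  A union bound over a finite cover gives uniformity.
\<close>

subsection \<open>Permutations preserving the blocks\<close>

text \<open>With m of order b^(1/beta), the term b k m / n becomes k b^((1+beta)/beta) / n, the very
  quantity that the first half of (II) sends to zero. The other term b m^(-beta) is then only a
  constant, as small as desired, and not a null sequence; so the proof fixes a tolerance
  \<open>e\<close> and a failure probability \<open>\<delta>\<close> and chooses all constants from
  them. The second half of (II) sees the covering number only through its logarithm and is empty
  when one element covers the class. In that case all losses of the class stay close to those of one
  fixed function from an earlier class, hence below a constant, and the first half of (II) alone
  gives the exponential rate. This is why the deviation bounds carry a range \<open>b\<close> of
  their own, which need not be \<open>B n\<close>. A bias remains, since the concentration is around
  the risk of order \<open>k n\<close>. Under (I) it is bounded query by query. Under (I') a
  function is compared with a nearly optimal member of its own cover set, and the Lipschitz bound,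
  valid for both risks, carries the estimate over.\<close>

definition fibre_perms :: "'a set \<Rightarrow> ('a \<Rightarrow> 'b) \<Rightarrow> ('a \<Rightarrow> 'a) set" where
  "fibre_perms S c = {\<pi>. \<pi> permutes S \<and> (\<forall>i. c (\<pi> i) = c i)}"

lemma finite_fibre_perms: "finite S \<Longrightarrow> finite (fibre_perms S c)"
  unfolding fibre_perms_def by (rule finite_subset[OF _ finite_permutations[of S]]) auto

lemma id_in_fibre_perms: "id \<in> fibre_perms S c"
  by (simp add: fibre_perms_def permutes_id)

lemma fibre_perms_image:
  assumes "\<pi> \<in> fibre_perms S c" "G \<subseteq> {i \<in> S. c i = q}"
  shows "\<pi> ` G \<subseteq> {i \<in> S. c i = q}" "card (\<pi> ` G) = card G"
proof -
  have p: "\<pi> permutes S" and c: "\<And>i. c (\<pi> i) = c i" using assms by (auto simp: fibre_perms_def)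
  show "\<pi> ` G \<subseteq> {i \<in> S. c i = q}" using assms(2) c p by (auto simp: permutes_in_image)
  show "card (\<pi> ` G) = card G" using p permutes_inj_on[of \<pi> S G] by (simp add: card_image)
qed

text \<open>A bijection from \<open>G\<close> to \<open>G'\<close> and one between their complements
  in the fibre exist by counting. Glued together, and extended by the identity, they give a
  permutation that moves no point out of its fibre.\<close>

lemma fibre_perms_transitive:
  assumes "finite S" and G: "G \<subseteq> {i \<in> S. c i = q}" "G' \<subseteq> {i \<in> S. c i = q}" "card G = card G'"
  shows "\<exists>\<sigma>\<in>fibre_perms S c. \<sigma> ` G = G'"
proof -
  let ?I = "{i \<in> S. c i = q}"
  have fin: "finite ?I" "finite G" "finite G'" using assms by (auto intro: finite_subset[OF _ assms(1)])
  obtain f where f: "bij_betw f G G'" using finite_same_card_bij[OF fin(2,3) G(3)] by blast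
  have "card (?I - G) = card (?I - G')" using fin G by (simp add: card_Diff_subset)
  then obtain g where g: "bij_betw g (?I - G) (?I - G')"
    using finite_same_card_bij[of "?I - G" "?I - G'"] fin by blast
  let ?h = "\<lambda>x. if x \<in> G then f x else if x \<in> ?I then g x else x"
  have "bij_betw ?h G G'" using f by (rule bij_betw_cong[THEN iffD1, rotated]) simp
  moreover have "bij_betw ?h (?I - G) (?I - G')" using g by (rule bij_betw_cong[THEN iffD1, rotated]) auto
  ultimately have "bij_betw ?h (G \<union> (?I - G)) (G' \<union> (?I - G'))" by (rule bij_betw_combine) auto
  then have bI: "bij_betw ?h ?I ?I" using G by (simp add: Un_absorb1)
  have "?h permutes ?I" by (rule bij_imp_permutes[OF bI]) (use G in auto)
  then have p: "?h permutes S" by (rule permutes_subset) auto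
  have "c (?h i) = c i" for i
  proof (cases "i \<in> ?I")
    case True then have "?h i \<in> ?I" using bI bij_betwE by blast
    with True show ?thesis by auto
  next
    case False with G show ?thesis by auto
  qed
  then have "?h \<in> fibre_perms S c" using p by (simp add: fibre_perms_def)
  moreover have "?h ` G = G'" using \<open>bij_betw ?h G G'\<close> by (simp add: bij_betw_def)
  ultimately show ?thesis by blast
qed

lemma fibre_perms_comp: "\<pi> \<in> fibre_perms S c \<Longrightarrow> \<sigma> \<in> fibre_perms S c \<Longrightarrow> \<pi> \<circ> \<sigma> \<in> fibre_perms S c"
  by (auto simp: fibre_perms_def permutes_compose)

lemma fibre_perms_inv: "\<pi> \<in> fibre_perms S c \<Longrightarrow> inv \<pi> \<in> fibre_perms S c"
  by (auto simp: fibre_perms_def permutes_inv) (metis permutes_inverses(1))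

text \<open>Double counting over pairs of a \<open>k\<close>-subset and a permutation. By
  transitivity and right translation in the group, the sum over permutations does not depend on the
  subset; for a fixed permutation, the sum over subsets is only reindexed. After division, the orbit
  mean of \<open>h\<close> at one set \<open>G\<close> is the U-statistic with kernel
  \<open>h\<close>.\<close>

lemma sum_fibre_perms:
  fixes h :: "'a set \<Rightarrow> real"
  assumes "finite S" and G: "G \<subseteq> {i \<in> S. c i = q}" "card G = k"
  shows "real (card {i \<in> S. c i = q} choose k) * (\<Sum>\<pi>\<in>fibre_perms S c. h (\<pi> ` G)) =
         real (card (fibre_perms S c)) * (\<Sum>J | J \<subseteq> {i \<in> S. c i = q} \<and> card J = k. h J)"
proof -
  let ?I = "{i \<in> S. c i = q}" and ?P = "fibre_perms S c"
  let ?K = "{J. J \<subseteq> ?I \<and> card J = k}"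
  have same: "(\<Sum>\<pi>\<in>?P. h (\<pi> ` G')) = (\<Sum>\<pi>\<in>?P. h (\<pi> ` G))" if G': "G' \<in> ?K" for G'
  proof -
    obtain \<sigma> where s: "\<sigma> \<in> ?P" "\<sigma> ` G = G'"
      using fibre_perms_transitive[OF assms(1) G(1), of G'] G' G(2) by auto
    have sp: "\<sigma> permutes S" using s by (simp add: fibre_perms_def)
    have "bij_betw (\<lambda>\<pi>. \<pi> \<circ> \<sigma>) ?P ?P"
      by (rule bij_betw_byWitness[where f'="\<lambda>\<pi>. \<pi> \<circ> inv \<sigma>"])
        (use s in \<open>auto simp: comp_assoc permutes_inv_o[OF sp] intro: fibre_perms_comp fibre_perms_inv\<close>)
    then have "(\<Sum>\<pi>\<in>?P. h ((\<pi> \<circ> \<sigma>) ` G)) = (\<Sum>\<pi>\<in>?P. h (\<pi> ` G))"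
      by (rule sum.reindex_bij_betw[where g="\<lambda>\<pi>. h (\<pi> ` G)"])
    then show ?thesis by (simp add: s(2)[symmetric] image_image comp_def)
  qed
  have inner: "(\<Sum>G'\<in>?K. h (\<pi> ` G')) = (\<Sum>J\<in>?K. h J)" if p: "\<pi> \<in> ?P" for \<pi>
  proof (rule sum.reindex_bij_betw[where g=h], rule bij_betw_byWitness[where f'="\<lambda>J. inv \<pi> ` J"])
    have pp: "\<pi> permutes S" using p by (simp add: fibre_perms_def)
    show "\<forall>a\<in>?K. inv \<pi> ` \<pi> ` a = a" "\<forall>a\<in>?K. \<pi> ` inv \<pi> ` a = a"
      by (auto simp: image_comp permutes_inv_o[OF pp])
    show "(`) \<pi> ` ?K \<subseteq> ?K" using fibre_perms_image[OF p] by auto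
    show "(`) (inv \<pi>) ` ?K \<subseteq> ?K" using fibre_perms_image[OF fibre_perms_inv[OF p]] by auto
  qed
  have "real (card ?I choose k) * (\<Sum>\<pi>\<in>?P. h (\<pi> ` G)) = (\<Sum>G'\<in>?K. \<Sum>\<pi>\<in>?P. h (\<pi> ` G'))"
    using same n_subsets[of ?I k] assms(1) by simp
  also have "\<dots> = (\<Sum>\<pi>\<in>?P. \<Sum>G'\<in>?K. h (\<pi> ` G'))" by (rule sum.swap)
  also have "\<dots> = real (card ?P) * (\<Sum>J\<in>?K. h J)" using inner by simp
  finally show ?thesis .
qed

subsection \<open>Concentration of averaged independent sums\<close>

text \<open>Families for different \<open>a\<close> may depend on each other arbitrarily. Convexity
  of exp moves the average over \<open>A\<close> outside the moment generating function, and there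
  only the independence within one family counts. The means \<open>e l\<close> and weights
  \<open>w l\<close> are common to all families, so each of them obeys the same bound
  \<open>v\<close>.\<close>

lemma (in prob_space) averaged_sum_upper_tail:
  fixes X :: "'p \<Rightarrow> 'l \<Rightarrow> 'a \<Rightarrow> real"
  assumes fin: "finite A" "A \<noteq> {}" "finite L"
    and indep: "\<And>a. a \<in> A \<Longrightarrow> indep_vars (\<lambda>_. borel) (X a) L"
    and bound: "\<And>a l \<omega>. a \<in> A \<Longrightarrow> l \<in> L \<Longrightarrow> \<omega> \<in> space M \<Longrightarrow> X a l \<omega> \<in> {0..b}"
    and mean: "\<And>a l. a \<in> A \<Longrightarrow> l \<in> L \<Longrightarrow> expectation (X a l) = e l"
    and w: "\<And>l. l \<in> L \<Longrightarrow> 0 \<le> w l"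
    and v: "(\<Sum>l\<in>L. (w l * b)\<^sup>2) \<le> v" "0 < v" and t: "0 < t"
    and T: "\<And>\<omega>. \<omega> \<in> space M \<Longrightarrow> real (card A) * T \<omega> = (\<Sum>a\<in>A. \<Sum>l\<in>L. w l * (X a l \<omega> - e l))"
  shows "prob {\<omega> \<in> space M. t \<le> T \<omega>} \<le> exp (- 2 * t\<^sup>2 / v)"
proof -
  \<comment> \<open>This is the minimiser of \<open>- c * t + c\<^sup>2 * v / 8\<close>, with
    minimal value \<open>- 2 * t\<^sup>2 / v\<close>.\<close>
  define c where "c = 4 * t / v"
  have c: "c > 0" using v t by (simp add: c_def)
  define W where "W a \<omega> = (\<Sum>l\<in>L. w l * (X a l \<omega> - e l))" for a \<omega>
  have cA: "real (card A) > 0" using fin by (simp add: card_gt_0_iff)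
  have rv: "random_variable borel (X a l)" if "a \<in> A" "l \<in> L" for a l
    using indep[OF that(1)] that(2) by (auto simp: indep_vars_def2)
  have [measurable]: "W a \<in> borel_measurable M" if "a \<in> A" for a
    unfolding W_def using rv[OF that] by measurable
  have Teq: "T \<omega> = (\<Sum>a\<in>A. (1 / real (card A)) *\<^sub>R W a \<omega>)" if "\<omega> \<in> space M" for \<omega>
    using T[OF that] cA unfolding W_def by (simp add: sum_divide_distrib[symmetric] field_simps)
  have Tm: "T \<in> borel_measurable M"
    by (subst measurable_cong[OF Teq]) auto
  have mgf: "(\<integral>\<^sup>+\<omega>. ennreal (exp (c * W a \<omega>)) \<partial>M) \<le> ennreal (exp (c\<^sup>2 * v / 8))" if a: "a \<in> A" for a
  proof -
    have "(\<integral>\<^sup>+\<omega>. ennreal (exp (c * W a \<omega>)) \<partial>M) =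
          (\<integral>\<^sup>+\<omega>. (\<Prod>l\<in>L. ennreal (exp (c * w l * (X a l \<omega> - e l)))) \<partial>M)"
      by (simp add: W_def sum_distrib_left exp_sum fin prod_ennreal mult.assoc)
    also have "\<dots> = (\<Prod>l\<in>L. \<integral>\<^sup>+\<omega>. ennreal (exp (c * w l * (X a l \<omega> - e l))) \<partial>M)"
      by (intro indep_vars_nn_integral fin indep_vars_compose2[OF indep[OF a]]) auto
    also have "\<dots> \<le> (\<Prod>l\<in>L. ennreal (exp (c\<^sup>2 * (w l * b)\<^sup>2 / 8)))"
    proof (intro prod_mono_ennreal)
      fix l assume l: "l \<in> L"
      show "(\<integral>\<^sup>+\<omega>. ennreal (exp (c * w l * (X a l \<omega> - e l))) \<partial>M) \<le> ennreal (exp (c\<^sup>2 * (w l * b)\<^sup>2 / 8))"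
      \<comment> \<open>Hoeffding's lemma is applied with the parameter \<open>c * w l\<close>,
        which has to be positive; a term of weight zero contributes the factor 1.\<close>
      proof (cases "w l = 0")
        case True then show ?thesis by (simp add: emeasure_space_1)
      next
        case False
        with w[OF l] c have cw: "c * w l > 0" by simp
        interpret X: interval_bounded_random_variable M "X a l" 0 b
          by unfold_locales (use rv[OF a l] bound[OF a l] in \<open>auto intro!: AE_I2\<close>)
        show ?thesis using X.Hoeffdings_lemma_nn_integral[OF cw] mean[OF a l] 
          by (simp add: power_mult_distrib mult.assoc)
      qed
    qed
    also have "\<dots> = ennreal (exp (c\<^sup>2 * (\<Sum>l\<in>L. (w l * b)\<^sup>2) / 8))"
      by (simp add: prod_ennreal exp_sum[symmetric] fin sum_distrib_left sum_divide_distrib)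
    also have "\<dots> \<le> ennreal (exp (c\<^sup>2 * v / 8))"
      using v by (intro ennreal_leI) (auto intro!: divide_right_mono mult_left_mono)
    finally show ?thesis .
  qed
  have conv: "exp (c * T \<omega>) \<le> (\<Sum>a\<in>A. (1 / real (card A)) * exp (c * W a \<omega>))" if "\<omega> \<in> space M" for \<omega>
    unfolding Teq[OF that]
    by (rule convex_on_sum[where C=UNIV]) (use fin cA c convex_on_exp[of c] in auto)
  have "(\<integral>\<^sup>+\<omega>. ennreal (exp (c * T \<omega>)) \<partial>M)
      \<le> (\<integral>\<^sup>+\<omega>. (\<Sum>a\<in>A. ennreal (1 / real (card A)) * ennreal (exp (c * W a \<omega>))) \<partial>M)"
    using conv by (intro nn_integral_mono) (simp add: ennreal_mult[symmetric] ennreal_leI del: ennreal_mult)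
  also have "\<dots> = (\<Sum>a\<in>A. ennreal (1 / real (card A)) * (\<integral>\<^sup>+\<omega>. ennreal (exp (c * W a \<omega>)) \<partial>M))"
    by (subst nn_integral_sum) (auto intro!: sum.cong nn_integral_cmult)
  also have "\<dots> \<le> (\<Sum>a\<in>A. ennreal (1 / real (card A)) * ennreal (exp (c\<^sup>2 * v / 8)))"
    by (intro sum_mono mult_left_mono mgf) auto
  also have "\<dots> = ennreal (exp (c\<^sup>2 * v / 8))"
    using cA by (simp add: ennreal_mult[symmetric] ennreal_of_nat_eq_real_of_nat del: ennreal_mult)
  finally have bnd: "(\<integral>\<^sup>+\<omega>. ennreal (exp (c * T \<omega>)) \<partial>M) \<le> ennreal (exp (c\<^sup>2 * v / 8))" .
  have "emeasure M {\<omega> \<in> space M. t \<le> T \<omega>} \<le> ennreal (exp (- c * t)) * (\<integral>\<^sup>+\<omega>. ennreal (exp (c * T \<omega>)) \<partial>M)"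
    using Chernoff_ineq_nn_integral_ge[OF c, of "space M" M T t] Tm by simp
  also have "\<dots> \<le> ennreal (exp (- c * t)) * ennreal (exp (c\<^sup>2 * v / 8))"
    by (intro mult_left_mono bnd) auto
  also have "\<dots> = ennreal (exp (- c * t + c\<^sup>2 * v / 8))"
    by (simp add: ennreal_mult[symmetric] exp_add[symmetric] del: ennreal_mult)
  also have "- c * t + c\<^sup>2 * v / 8 = - 2 * t\<^sup>2 / v"
    using v by (simp add: c_def field_simps power2_eq_square)
  finally show ?thesis by (simp add: emeasure_eq_measure)
qed

lemma (in prob_space) averaged_sum_deviation:
  fixes X :: "'p \<Rightarrow> 'l \<Rightarrow> 'a \<Rightarrow> real"
  assumes fin: "finite A" "A \<noteq> {}" "finite L"
    and indep: "\<And>a. a \<in> A \<Longrightarrow> indep_vars (\<lambda>_. borel) (X a) L"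
    and bound: "\<And>a l \<omega>. a \<in> A \<Longrightarrow> l \<in> L \<Longrightarrow> \<omega> \<in> space M \<Longrightarrow> X a l \<omega> \<in> {0..b}"
    and mean: "\<And>a l. a \<in> A \<Longrightarrow> l \<in> L \<Longrightarrow> expectation (X a l) = e l"
    and w: "\<And>l. l \<in> L \<Longrightarrow> 0 \<le> w l"
    and v: "(\<Sum>l\<in>L. (w l * b)\<^sup>2) \<le> v" "0 < v" and t: "0 < t"
    and T: "\<And>\<omega>. \<omega> \<in> space M \<Longrightarrow> real (card A) * T \<omega> = (\<Sum>a\<in>A. \<Sum>l\<in>L. w l * (X a l \<omega> - e l))"
    and T_measurable: "T \<in> borel_measurable M"
  shows "prob {\<omega> \<in> space M. t \<le> \<bar>T \<omega>\<bar>} \<le> 2 * exp (- 2 * t\<^sup>2 / v)"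
proof -
  note [measurable] = T_measurable
  have rv: "random_variable borel (X a l)" if "a \<in> A" "l \<in> L" for a l
    using indep[OF that(1)] that(2) by (auto simp: indep_vars_def2)
  have "{\<omega> \<in> space M. t \<le> \<bar>T \<omega>\<bar>} = {\<omega> \<in> space M. t \<le> T \<omega>} \<union> {\<omega> \<in> space M. t \<le> - T \<omega>}"
    by auto
  then have "prob {\<omega> \<in> space M. t \<le> \<bar>T \<omega>\<bar>} \<le> prob {\<omega> \<in> space M. t \<le> T \<omega>} + prob {\<omega> \<in> space M. t \<le> - T \<omega>}"
    by (simp only:) (intro measure_Un_le; measurable)
  also have "prob {\<omega> \<in> space M. t \<le> T \<omega>} \<le> exp (- 2 * t\<^sup>2 / v)"
    by (rule averaged_sum_upper_tail[OF fin indep bound mean w v t T])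
  \<comment> \<open>Reflecting \<open>X\<close> to \<open>b - X\<close> keeps the range and the
    independence and turns \<open>T\<close> into \<open>- T\<close>.\<close>
  also have "prob {\<omega> \<in> space M. t \<le> - T \<omega>} \<le> exp (- 2 * t\<^sup>2 / v)"
  proof (rule averaged_sum_upper_tail[OF fin _ _ _ w v t, of "\<lambda>a l \<omega>. b - X a l \<omega>" "\<lambda>l. b - e l"])
    show "indep_vars (\<lambda>_. borel) (\<lambda>l \<omega>. b - X a l \<omega>) L" if "a \<in> A" for a
      by (intro indep_vars_compose2[OF indep[OF that]]) auto
    show "b - X a l \<omega> \<in> {0..b}" if "a \<in> A" "l \<in> L" "\<omega> \<in> space M" for a l \<omega>
      using bound[OF that] by auto
    show "expectation (\<lambda>\<omega>. b - X a l \<omega>) = b - e l" if "a \<in> A" "l \<in> L" for a l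
    proof -
      have "integrable M (X a l)"
        by (rule integrable_const_bound[where B=b]) (use bound[OF that] rv[OF that] in \<open>auto intro!: AE_I2\<close>)
      then show ?thesis using mean[OF that] by (simp add: prob_space)
    qed
    show "real (card A) * - T \<omega> = (\<Sum>a\<in>A. \<Sum>l\<in>L. w l * (b - X a l \<omega> - (b - e l)))"
      if "\<omega> \<in> space M" for \<omega>
      using T[OF that] by (simp add: sum_negf[symmetric] algebra_simps)
  qed
  finally show ?thesis by simp
qed

section \<open>Losses of single index sets: measurability, expectation and bounds\<close>

definition structure_loss ::
  "('a \<Rightarrow> 's \<Rightarrow> real) \<Rightarrow> ('y list \<Rightarrow> 's) \<Rightarrow> 'a \<Rightarrow> (nat \<Rightarrow> 'y) \<Rightarrow> nat set \<Rightarrow> real" where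
  "structure_loss \<phi> s \<alpha> ys J = \<phi> \<alpha> (s (map ys (sorted_list_of_set J)))"

lemma map_sorted_list_of_set:
  "finite J \<Longrightarrow> map ys (sorted_list_of_set J) = map (\<lambda>i. ys (sorted_list_of_set J ! i)) [0..<card J]"
  by (rule nth_equalityI) auto

text \<open>Measurability of \<open>s\<close> is available on products indexed by
  \<open>{..<k}\<close> with \<open>k \<ge> 1\<close>, so the members of \<open>J\<close> are
  relabelled by their increasing enumeration. Nonemptiness of \<open>J\<close> keeps the empty list
  away.\<close>

lemma structure_loss_measurable:
  assumes struct: "measurable_structure MY s" and cont: "continuous_on UNIV (\<phi> \<alpha>)"
    and J: "finite J" "J \<noteq> {}" and y: "\<And>j. j \<in> J \<Longrightarrow> (\<lambda>\<omega>. y \<omega> j) \<in> measurable N MY"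
  shows "(\<lambda>\<omega>. structure_loss \<phi> s \<alpha> (y \<omega>) J) \<in> borel_measurable N"
proof -
  let ?l = "sorted_list_of_set J" and ?k = "card J"
  have k: "1 \<le> ?k" using J by (simp add: Suc_leI card_gt_0_iff)
  have inJ: "?l ! i \<in> J" if "i < ?k" for i using J that by (metis nth_mem sorted_list_of_set(1) sorted_list_of_set.length_sorted_key_list_of_set)
  have s: "(\<lambda>y. s (map y [0..<?k])) \<in> measurable (Pi\<^sub>M {..<?k} (\<lambda>_. MY)) borel"
    using struct k by (simp add: measurable_structure_def)
  have f: "(\<lambda>\<omega>. \<lambda>i\<in>{..<?k}. y \<omega> (?l ! i)) \<in> measurable N (Pi\<^sub>M {..<?k} (\<lambda>_. MY))"
    by (intro measurable_restrict y inJ) simp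
  have \<phi>: "\<phi> \<alpha> \<in> borel_measurable borel" by (rule borel_measurable_continuous_onI[OF cont])
  have "(\<lambda>\<omega>. \<phi> \<alpha> (s (map (\<lambda>i\<in>{..<?k}. y \<omega> (?l ! i)) [0..<?k]))) \<in> borel_measurable N"
    by (rule measurable_compose[OF measurable_compose[OF f s] \<phi>])
  moreover have "map (\<lambda>i\<in>{..<?k}. y \<omega> (?l ! i)) [0..<?k] = map (y \<omega>) ?l" for \<omega>
    unfolding map_sorted_list_of_set[OF J(1)] by (rule map_cong) auto
  ultimately show ?thesis by (simp add: structure_loss_def)
qed

text \<open>The increasing enumeration of \<open>J\<close> is injective, so pushing the product
  measure forward along it gives a product of \<open>card J\<close> copies of \<open>\<nu>'\<close>.
  Hence all \<open>k\<close>-subsets of one block share the same mean, which is what the averaging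
  over permutations requires.\<close>

lemma expectation_structure_loss:
  assumes struct: "measurable_structure MY s" and cont: "continuous_on UNIV (\<phi> \<alpha>)"
    and prob: "\<And>i. i \<in> I \<Longrightarrow> prob_space (\<nu> i)" "\<And>i. i \<in> I \<Longrightarrow> sets (\<nu> i) = sets MY"
    and J: "J \<subseteq> I" "finite J" "J \<noteq> {}" and const: "\<And>j. j \<in> J \<Longrightarrow> \<nu> j = \<nu>'"
  shows "(\<integral>y. structure_loss \<phi> s \<alpha> y J \<partial>Pi\<^sub>M I \<nu>) = expected_surrogate \<phi> s \<nu>' (card J) \<alpha>"
proof -
  let ?l = "sorted_list_of_set J" and ?k = "card J"
  have k: "1 \<le> ?k" using J by (simp add: Suc_leI card_gt_0_iff)
  have inJ: "?l ! i \<in> J" if "i < ?k" for i using J that by (metis nth_mem sorted_list_of_set(1) sorted_list_of_set.length_sorted_key_list_of_set)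
  obtain j where "j \<in> J" using J by blast
  then have sn: "sets \<nu>' = sets MY" using prob(2) const J by (metis subsetD)
  have eq: "(\<Pi>\<^sub>M i\<in>{..<?k}. \<nu> (?l ! i)) = Pi\<^sub>M {..<?k} (\<lambda>_. \<nu>')"
    by (rule PiM_cong) (use inJ const in auto)
  have d: "distr (Pi\<^sub>M I \<nu>) (Pi\<^sub>M {..<?k} (\<lambda>_. \<nu>')) (\<lambda>\<omega>. \<lambda>i\<in>{..<?k}. \<omega> (?l ! i)) = Pi\<^sub>M {..<?k} (\<lambda>_. \<nu>')"
    using distr_PiM_reindex[of I \<nu> "\<lambda>i. ?l ! i" "{..<?k}"] prob(1) inJ J
    unfolding eq by (force simp: inj_on_def nth_eq_iff_index_eq)
  have s: "(\<lambda>y. s (map y [0..<?k])) \<in> measurable (Pi\<^sub>M {..<?k} (\<lambda>_. \<nu>')) borel"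
    using struct k sets_PiM_cong[OF refl, of "{..<?k}" "\<lambda>_. \<nu>'" "\<lambda>_. MY"] sn
    by (simp add: measurable_structure_def cong: measurable_cong_sets)
  have \<phi>: "\<phi> \<alpha> \<in> borel_measurable borel" by (rule borel_measurable_continuous_onI[OF cont])
  have f: "(\<lambda>\<omega>. \<lambda>i\<in>{..<?k}. \<omega> (?l ! i)) \<in> measurable (Pi\<^sub>M I \<nu>) (Pi\<^sub>M {..<?k} (\<lambda>_. \<nu>'))"
    using inJ J const by (intro measurable_restrict) (metis measurable_component_singleton lessThan_iff subsetD)
  have m: "map (\<lambda>i\<in>{..<?k}. \<omega> (?l ! i)) [0..<?k] = map \<omega> ?l" for \<omega> :: "nat \<Rightarrow> 'a"
    unfolding map_sorted_list_of_set[OF J(2)] by (rule map_cong) auto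
  have "expected_surrogate \<phi> s \<nu>' ?k \<alpha> =
      (\<integral>y. \<phi> \<alpha> (s (map y [0..<?k])) \<partial>distr (Pi\<^sub>M I \<nu>) (Pi\<^sub>M {..<?k} (\<lambda>_. \<nu>')) (\<lambda>\<omega>. \<lambda>i\<in>{..<?k}. \<omega> (?l ! i)))"
    by (simp add: expected_surrogate_def d)
  also have "\<dots> = (\<integral>\<omega>. \<phi> \<alpha> (s (map (\<lambda>i\<in>{..<?k}. \<omega> (?l ! i)) [0..<?k])) \<partial>Pi\<^sub>M I \<nu>)"
    by (intro integral_distr f measurable_compose[OF s \<phi>])
  finally show ?thesis by (simp only: m structure_loss_def)
qed

lemma expected_surrogate_bounds:
  assumes "prob_space \<nu>" "\<And>x. 0 \<le> \<phi> \<alpha> x \<and> \<phi> \<alpha> x \<le> b"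
  shows "0 \<le> expected_surrogate \<phi> s \<nu> k \<alpha>" "expected_surrogate \<phi> s \<nu> k \<alpha> \<le> b"
proof -
  interpret prob_space "Pi\<^sub>M {..<k} (\<lambda>_. \<nu>)" by (intro prob_space_PiM assms)
  have b: "0 \<le> b" using assms(2) by (meson order_trans)
  show "0 \<le> expected_surrogate \<phi> s \<nu> k \<alpha>"
    unfolding expected_surrogate_def using assms by (intro integral_nonneg_AE) simp
  \<comment> \<open>If the integrand is not integrable, the integral has the default value 0, which
    is still at most \<open>b\<close>.\<close>
  show "expected_surrogate \<phi> s \<nu> k \<alpha> \<le> b"
    unfolding expected_surrogate_def using assms b
    by (cases "integrable (Pi\<^sub>M {..<k} (\<lambda>_. \<nu>)) (\<lambda>y. \<phi> \<alpha> (s (map y [0..<k])))")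
       (auto intro!: integral_le_const simp: not_integrable_integral_eq)
qed

lemma block_average_bounds:
  assumes "finite I" "\<And>x. 0 \<le> \<phi> \<alpha> x \<and> \<phi> \<alpha> x \<le> b"
  shows "0 \<le> block_average \<phi> s k ys I \<alpha>" "block_average \<phi> s k ys I \<alpha> \<le> b"
proof -
  let ?K = "{J. J \<subseteq> I \<and> card J = k}"
  have card: "card ?K = card I choose k" by (rule n_subsets[OF assms(1)])
  have "0 \<le> block_average \<phi> s k ys I \<alpha> \<and> block_average \<phi> s k ys I \<alpha> \<le> b"
  proof (cases "k \<le> card I")
    case True
    have "(\<Sum>J\<in>?K. \<phi> \<alpha> (s (map ys (sorted_list_of_set J)))) \<le> real (card ?K) * b"
      by (rule sum_bounded_above) (use assms in auto)
    moreover have "real (card I choose k) > 0" using True by simp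
    ultimately show ?thesis using True assms(2) card
      by (auto simp: block_average_def field_simps intro!: sum_nonneg divide_nonneg_nonneg)
  next
    case False then show ?thesis using assms(2) by (simp add: block_average_def)
  qed
  then show "0 \<le> block_average \<phi> s k ys I \<alpha>" "block_average \<phi> s k ys I \<alpha> \<le> b" by auto
qed

text \<open>This is the total weight in the empirical risk of the blocks with fewer than
  \<open>k\<close> members. Their terms aggregate fewer judgments, so they are not centred at the
  expectation of order \<open>k\<close> and can only be bounded.\<close>

definition sparse_fraction :: "nat \<Rightarrow> nat \<Rightarrow> (nat \<Rightarrow> nat) \<Rightarrow> real" where
  "sparse_fraction k n qs = real (card {i \<in> {1..n}. card (block qs n (qs i)) < k}) / real n"

lemma sum_over_blocks:
  fixes g :: "nat \<Rightarrow> real"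
  shows "(\<Sum>i\<in>{1..n}. g (qs i)) = (\<Sum>q\<in>qs ` {1..n}. real (card (block qs n q)) * g q)"
proof -
  have "(\<Sum>i\<in>{1..n}. g (qs i)) = (\<Sum>q\<in>qs ` {1..n}. \<Sum>i\<in>{i \<in> {1..n}. qs i = q}. g (qs i))"
    by (rule sum.image_gen) simp
  also have "\<dots> = (\<Sum>q\<in>qs ` {1..n}. real (card (block qs n q)) * g q)"
    by (rule sum.cong) (simp_all add: block_def)
  finally show ?thesis .
qed

text \<open>With the queries frozen, the judgments form a product measure. One family of disjoint
  \<open>k\<close>-sets carries weights of sum at most 1, each at most 2k/n, so the squared ranges
  add up to at most \<open>v = 2 * real k * b\<^sup>2 / real n\<close>. This gives the exponent,
  since \<open>2 * t\<^sup>2 / v\<close> equals n t^2 / (k b^2). The term with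
  \<open>sparse_fraction\<close> pays for the small blocks.\<close>

lemma empirical_risk_conditional_deviation:
  fixes \<phi> :: "'a \<Rightarrow> 's::topological_space \<Rightarrow> real"
  assumes struct: "measurable_structure MY s" and cont: "\<And>\<alpha>. continuous_on UNIV (\<phi> \<alpha>)"
    and n: "1 \<le> n" and k: "1 \<le> k" and qs: "\<And>i. i \<in> {1..n} \<Longrightarrow> qs i \<in> \<Q>"
    and \<kappa>: "\<And>q. q \<in> \<Q> \<Longrightarrow> prob_space (\<kappa> q) \<and> sets (\<kappa> q) = sets MY"
    and bound: "\<And>q x. q \<in> \<Q> \<Longrightarrow> 0 \<le> \<phi> (f q) x \<and> \<phi> (f q) x \<le> b" and b: "0 < b" and t: "0 < t"
  defines "P \<equiv> Pi\<^sub>M {1..n} (\<lambda>i. \<kappa> (qs i))"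
  shows "measure P {y \<in> space P. t + b * sparse_fraction k n qs \<le>
           \<bar>empirical_risk \<phi> s k n qs y f - (\<Sum>i\<in>{1..n}. expected_surrogate \<phi> s (\<kappa> (qs i)) k (f (qs i))) / real n\<bar>}
         \<le> 2 * exp (- (real n * t\<^sup>2 / (real k * b\<^sup>2)))"
proof -
  interpret prob_space P unfolding P_def using qs \<kappa> by (intro prob_space_PiM) auto
  define I where "I q = block qs n q" for q
  \<comment> \<open>The number of disjoint \<open>k\<close>-sets that fit into the block. The
    members left over by the division are reached through the other permutations.\<close>
  define m where "m q = card (I q) div k" for q
  define big where "big = {q \<in> qs ` {1..n}. k \<le> card (I q)}"
  define small where "small = {q \<in> qs ` {1..n}. card (I q) < k}"
  define L where "L = (SIGMA q:big. {..<m q})"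
  define G where "G l = (!) (sorted_list_of_set (I (fst l))) ` {snd l * k..<Suc (snd l) * k}" for l
  \<comment> \<open>The weight of the block in the risk is shared equally among its
    \<open>m q\<close> sets, so that averaging over permutations reproduces the block's term
    exactly.\<close>
  define w where "w l = real (card (I (fst l))) / (real n * real (m (fst l)))" for l :: "nat \<times> nat"
  define g where "g q = expected_surrogate \<phi> s (\<kappa> q) k (f q)" for q
  define U where "U y q = block_average \<phi> s k y (I q) (f q)" for y q
  define T where "T y = (\<Sum>q\<in>big. real (card (I q)) * (U y q - g q)) / real n" for y
  define A where "A = fibre_perms {1..n} qs"
  \<comment> \<open>The sets \<open>G l\<close> cut each large block into disjoint \<open>k\<close>-sets; averaging their images over \<open>A\<close>
    gives back the U-statistic, while each single image family is independent.\<close>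
  define X where "X \<pi> l y = structure_loss \<phi> s (f (fst l)) y (\<pi> ` G l)" for \<pi> l y
  define v where "v = 2 * real k * b\<^sup>2 / real n"
  have bigQ: "q \<in> \<Q>" if "q \<in> big" for q using that qs by (auto simp: big_def)
  have I_eq: "I q = {i \<in> {1..n}. qs i = q}" for q by (simp add: I_def block_def)
  have finI: "finite (I q)" for q by (simp add: I_eq)
  have m1: "1 \<le> m q" if "q \<in> big" for q
    using that k by (simp add: big_def m_def div_greater_zero_iff Suc_le_eq)
  have finL: "finite L" by (auto simp: L_def big_def)
  have bij: "bij_betw ((!) (sorted_list_of_set (I q))) {..<card (I q)} (I q)" for q
    by (rule bij_betw_nth) (auto simp: finI)
  have range: "{snd l * k..<Suc (snd l) * k} \<subseteq> {..<card (I (fst l))}" if "l \<in> L" for l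
  proof -
    have "Suc (snd l) \<le> m (fst l)" using that by (auto simp: L_def)
    then have "Suc (snd l) * k \<le> card (I (fst l))"
      unfolding m_def by (metis div_times_less_eq_dividend le_trans mult_le_mono1)
    then show ?thesis by auto
  qed
  have G_sub: "G l \<subseteq> I (fst l)" if "l \<in> L" for l
    unfolding G_def using range[OF that] bij[of "fst l"] by (auto simp: bij_betw_def)
  have G_card: "card (G l) = k" if "l \<in> L" for l
    unfolding G_def using inj_on_subset[OF bij_betw_imp_inj_on[OF bij] range[OF that]] by (simp add: card_image)
  have G_disj: "G l \<inter> G l' = {}" if l: "l \<in> L" "l' \<in> L" "l \<noteq> l'" for l l'
  proof (cases "fst l = fst l'")
    case False
    then have "I (fst l) \<inter> I (fst l') = {}" by (auto simp: I_eq)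
    then show ?thesis using G_sub[OF l(1)] G_sub[OF l(2)] by blast
  next
    case True
    have dis: "{snd l * k..<Suc (snd l) * k} \<inter> {snd l' * k..<Suc (snd l') * k} = {}"
    proof -
      have "snd l \<noteq> snd l'" using True l(3) by (simp add: prod_eq_iff)
      then consider "Suc (snd l) \<le> snd l'" | "Suc (snd l') \<le> snd l" by linarith
      then show ?thesis
      proof cases
        case 1 then have "Suc (snd l) * k \<le> snd l' * k" by (rule mult_le_mono1)
        then show ?thesis by auto
      next
        case 2 then have "Suc (snd l') * k \<le> snd l * k" by (rule mult_le_mono1)
        then show ?thesis by auto
      qed
    qed
    show ?thesis unfolding G_def True
      using inj_on_image_Int[OF bij_betw_imp_inj_on[OF bij[of "fst l'"]] range[OF l(1), unfolded True] range[OF l(2)]]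
      by (simp only: dis image_empty)
  qed
  have A: "finite A" "A \<noteq> {}" using finite_fibre_perms[of "{1..n}" qs] id_in_fibre_perms[of "{1..n}" qs] by (auto simp: A_def)
  have cA: "real (card A) > 0" using A by (simp add: card_gt_0_iff)
  have piG: "\<pi> ` G l \<subseteq> I (fst l)" "card (\<pi> ` G l) = k" if "\<pi> \<in> A" "l \<in> L" for \<pi> l
    using fibre_perms_image[of \<pi> "{1..n}" qs "G l" "fst l"] that G_sub[OF that(2)] G_card[OF that(2)]
    by (auto simp: A_def I_eq)
  have piG2: "finite (\<pi> ` G l)" "\<pi> ` G l \<noteq> {}" if "\<pi> \<in> A" "l \<in> L" for \<pi> l
    using piG(2)[OF that] k by (metis card.infinite not_one_le_zero, metis card.empty not_one_le_zero)
  have comp: "(\<lambda>y. y j) \<in> measurable (Pi\<^sub>M J (\<lambda>i. \<kappa> (qs i))) MY" if "j \<in> J" "J \<subseteq> {1..n}" for J j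
  proof -
    have "(\<lambda>y. y j) \<in> measurable (Pi\<^sub>M J (\<lambda>i. \<kappa> (qs i))) (\<kappa> (qs j))" using that by (simp add: measurable_component_singleton)
    moreover have "sets (\<kappa> (qs j)) = sets MY" using that qs \<kappa> by blast
    ultimately show ?thesis by (simp cong: measurable_cong_sets)
  qed
  \<comment> \<open>The loss reads only the coordinates in the image of \<open>G l\<close>.
    Independence of disjoint groups of coordinates therefore passes to the losses.\<close>
  have X_meas: "structure_loss \<phi> s (f (fst l)) y (\<pi> ` G l) = structure_loss \<phi> s (f (fst l)) (restrict y (\<pi> ` G l)) (\<pi> ` G l)"
    if "\<pi> \<in> A" "l \<in> L" for \<pi> l y
    unfolding structure_loss_def using piG2[OF that] by (auto intro!: arg_cong[of _ _ s] arg_cong[of _ _ "\<phi> (f (fst l))"])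
  have ind: "indep_vars (\<lambda>i. \<kappa> (qs i)) (\<lambda>i y. y i) {1..n}"
  proof (subst indep_vars_iff_distr_eq_PiM')
    show "{1..n} \<noteq> {}" using n by simp
    show "(\<lambda>y. y i) \<in> measurable P (\<kappa> (qs i))" if "i \<in> {1..n}" for i
      unfolding P_def using that by (rule measurable_component_singleton)
    have "distr P (Pi\<^sub>M {1..n} (\<lambda>i. \<kappa> (qs i))) (\<lambda>x. restrict (\<lambda>i. x i) {1..n}) = distr P P (\<lambda>x. x)"
      by (rule distr_cong) (auto simp: P_def space_PiM PiE_restrict)
    also have "\<dots> = Pi\<^sub>M {1..n} (\<lambda>i. \<kappa> (qs i))" by (simp add: P_def)
    also have "\<dots> = Pi\<^sub>M {1..n} (\<lambda>i. distr P (\<kappa> (qs i)) (\<lambda>y. y i))"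
      unfolding P_def by (rule PiM_cong) (use qs \<kappa> in \<open>auto intro!: distr_PiM_component[symmetric]\<close>)
    finally show "distr P (Pi\<^sub>M {1..n} (\<lambda>i. \<kappa> (qs i))) (\<lambda>x. \<lambda>i\<in>{1..n}. x i) =
      Pi\<^sub>M {1..n} (\<lambda>i. distr P (\<kappa> (qs i)) (\<lambda>y. y i))" .
  qed
  have indep: "indep_vars (\<lambda>_. borel) (X \<pi>) L" if p: "\<pi> \<in> A" for \<pi>
  proof -
    have inj: "inj \<pi>" using p by (auto simp: A_def fibre_perms_def permutes_inj)
    have "indep_vars (\<lambda>l. PiM (\<pi> ` G l) (\<lambda>i. \<kappa> (qs i))) (\<lambda>l y. restrict (\<lambda>i. y i) (\<pi> ` G l)) L"
    proof (rule indep_vars_restrict[OF ind])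
      show "\<pi> ` G l \<subseteq> {1..n}" if "l \<in> L" for l using piG[OF p that] by (auto simp: I_eq)
      show "disjoint_family_on (\<lambda>l. \<pi> ` G l) L"
        unfolding disjoint_family_on_def using G_disj by (metis image_Int[OF inj] image_empty)
    qed
    then have "indep_vars (\<lambda>_. borel) (\<lambda>l y. structure_loss \<phi> s (f (fst l)) (restrict y (\<pi> ` G l)) (\<pi> ` G l)) L"
    proof (rule indep_vars_compose2)
      fix l assume l: "l \<in> L"
      show "(\<lambda>y. structure_loss \<phi> s (f (fst l)) y (\<pi> ` G l)) \<in> borel_measurable (PiM (\<pi> ` G l) (\<lambda>i. \<kappa> (qs i)))"
        using piG[OF p l] by (intro structure_loss_measurable[OF struct cont piG2[OF p l]] comp) (auto simp: I_eq)
    qed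
    then show ?thesis
      by (rule indep_vars_cong[THEN iffD1, rotated 3]) (auto simp: X_def X_meas[OF p, symmetric] fun_eq_iff)
  qed
  have Xb: "X \<pi> l y \<in> {0..b}" if "l \<in> L" for \<pi> l y
    using bound[of "fst l"] bigQ[of "fst l"] that by (auto simp: X_def structure_loss_def L_def)
  have mean: "expectation (X \<pi> l) = g (fst l)" if "\<pi> \<in> A" "l \<in> L" for \<pi> l
    unfolding X_def g_def P_def piG(2)[OF that, symmetric]
    by (rule expectation_structure_loss[OF struct cont]) 
      (use piG2[OF that] piG(1)[OF that] qs \<kappa> in \<open>auto simp: I_eq\<close>)
  have w0: "0 \<le> w l" for l by (simp add: w_def)
  have sumw: "(\<Sum>l\<in>L. w l) \<le> 1"
  proof -
    have "(\<Sum>l\<in>L. w l) = (\<Sum>q\<in>big. \<Sum>j<m q. w (q, j))"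
      unfolding L_def by (subst sum.Sigma) (auto simp: big_def)
    also have "\<dots> = (\<Sum>q\<in>big. real (card (I q)) / real n)"
      by (rule sum.cong) (auto simp: w_def field_simps dest: m1)
    also have "\<dots> \<le> (\<Sum>q\<in>qs ` {1..n}. real (card (I q)) / real n)"
      by (rule sum_mono2) (auto simp: big_def)
    also have "\<dots> = 1" using sum_over_blocks[of "\<lambda>_. 1" qs n] n
      by (simp add: I_def sum_divide_distrib[symmetric])
    finally show ?thesis .
  qed
  \<comment> \<open>The block has fewer than (m+1)k members, and m + 1 is at most 2m because
    \<open>m \<ge> 1\<close>; rounding down thus costs a factor 2.\<close>
  have wle: "w l \<le> 2 * real k / real n" if l: "l \<in> L" for l
  proof -
    let ?q = "fst l"
    have m: "1 \<le> m ?q" using m1 l by (auto simp: L_def)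
    have "card (I ?q) < Suc (m ?q) * k" unfolding m_def using k dividend_less_div_times[of k "card (I ?q)"] by simp
    also have "\<dots> \<le> (2 * m ?q) * k" using m by (intro mult_le_mono1) simp
    finally have "real (card (I ?q)) \<le> 2 * real (m ?q) * real k" by (metis less_imp_le of_nat_le_iff of_nat_mult of_nat_numeral)
    then show ?thesis using m n by (simp add: w_def field_simps)
  qed
  \<comment> \<open>A sum of squares is at most the largest weight times the total weight.\<close>
  have v: "(\<Sum>l\<in>L. (w l * b)\<^sup>2) \<le> v"
  proof -
    have "(\<Sum>l\<in>L. (w l * b)\<^sup>2) \<le> (\<Sum>l\<in>L. (2 * real k / real n * b\<^sup>2) * w l)"
    proof (rule sum_mono)
      fix l assume "l \<in> L"
      then have "w l * w l \<le> 2 * real k / real n * w l" by (intro mult_right_mono wle w0)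
      then have "(w l * w l) * b\<^sup>2 \<le> 2 * real k / real n * w l * b\<^sup>2" by (rule mult_right_mono) simp
      then show "(w l * b)\<^sup>2 \<le> (2 * real k / real n * b\<^sup>2) * w l" by (simp add: power2_eq_square mult_ac)
    qed
    also have "\<dots> = (2 * real k / real n * b\<^sup>2) * (\<Sum>l\<in>L. w l)" by (simp add: sum_distrib_left)
    also have "\<dots> \<le> (2 * real k / real n * b\<^sup>2) * 1" by (intro mult_left_mono sumw) simp
    finally show ?thesis by (simp add: v_def)
  qed
  have vpos: "0 < v" using n k b by (simp add: v_def)
  have U_eq: "(\<Sum>\<pi>\<in>A. X \<pi> l y) = real (card A) * U y (fst l)" if l: "l \<in> L" for l y
  proof -
    let ?q = "fst l"
    have kq: "k \<le> card (I ?q)" using l by (auto simp: L_def big_def)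
    have "real (card (I ?q) choose k) * (\<Sum>\<pi>\<in>A. X \<pi> l y) =
      real (card A) * (\<Sum>J | J \<subseteq> I ?q \<and> card J = k. structure_loss \<phi> s (f ?q) y J)"
      unfolding X_def A_def I_eq
      by (rule sum_fibre_perms[where h="structure_loss \<phi> s (f ?q) y"]) (use G_sub[OF l] G_card[OF l] in \<open>auto simp: I_eq\<close>)
    moreover have "real (card (I ?q) choose k) > 0" using kq by simp
    ultimately show ?thesis using kq by (simp add: U_def block_average_def structure_loss_def field_simps)
  qed
  have T: "real (card A) * T y = (\<Sum>\<pi>\<in>A. \<Sum>l\<in>L. w l * (X \<pi> l y - g (fst l)))" for y
  proof -
    have "(\<Sum>\<pi>\<in>A. \<Sum>l\<in>L. w l * (X \<pi> l y - g (fst l))) = (\<Sum>l\<in>L. w l * (\<Sum>\<pi>\<in>A. X \<pi> l y - g (fst l)))"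
      by (subst sum.swap) (simp add: sum_distrib_left)
    also have "\<dots> = (\<Sum>l\<in>L. real (card A) * (w l * (U y (fst l) - g (fst l))))"
      by (rule sum.cong) (auto simp: sum_subtractf U_eq algebra_simps)
    also have "\<dots> = real (card A) * (\<Sum>l\<in>L. w l * (U y (fst l) - g (fst l)))"
      by (simp add: sum_distrib_left)
    also have "(\<Sum>l\<in>L. w l * (U y (fst l) - g (fst l))) = (\<Sum>q\<in>big. \<Sum>j<m q. w (q, j) * (U y q - g q))"
      unfolding L_def by (subst sum.Sigma) (auto simp: big_def intro!: sum.cong)
    also have "\<dots> = (\<Sum>q\<in>big. real (card (I q)) * (U y q - g q) / real n)"
    proof (rule sum.cong[OF refl])
      fix q assume "q \<in> big"
      then have "real (m q) \<noteq> 0" using m1[of q] by simp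
      then show "(\<Sum>j<m q. w (q, j) * (U y q - g q)) = real (card (I q)) * (U y q - g q) / real n"
        by (simp add: w_def)
    qed
    finally show ?thesis by (simp add: T_def sum_divide_distrib)
  qed
  have T_measurable: "T \<in> borel_measurable P"
  proof -
    have "(\<lambda>y. structure_loss \<phi> s (f q) y J) \<in> borel_measurable P" if "J \<subseteq> I q" "card J = k" for q J
      unfolding P_def using that k finI[of q]
      by (intro structure_loss_measurable[OF struct cont] comp) (auto simp: I_eq intro: finite_subset)
    then have "(\<lambda>y. U y q) \<in> borel_measurable P" if "q \<in> big" for q
      using that by (auto simp: U_def block_average_def big_def structure_loss_def intro!: borel_measurable_divide borel_measurable_sum)
    then show ?thesis unfolding T_def by (intro borel_measurable_divide borel_measurable_sum borel_measurable_times borel_measurable_diff) auto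
  qed
  have dev: "prob {y \<in> space P. t \<le> \<bar>T y\<bar>} \<le> 2 * exp (- 2 * t\<^sup>2 / v)"
    by (rule averaged_sum_deviation[OF A finL indep Xb mean w0 v vpos t T T_measurable])
  \<comment> \<open>For a small block both \<open>U y q\<close> and \<open>g q\<close> lie in
    \<open>{0..b}\<close>, so no concentration is used there; the block costs at most
    \<open>b\<close> times its weight.\<close>
  have split: "\<bar>empirical_risk \<phi> s k n qs y f - (\<Sum>i\<in>{1..n}. g (qs i)) / real n\<bar> \<le> \<bar>T y\<bar> + b * sparse_fraction k n qs" for y
  proof -
    have dis: "qs ` {1..n} = big \<union> small" "big \<inter> small = {}" "finite big" "finite small" by (auto simp: big_def small_def)
    have "empirical_risk \<phi> s k n qs y f - (\<Sum>i\<in>{1..n}. g (qs i)) / real n =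
        (\<Sum>q\<in>qs ` {1..n}. real (card (I q)) * (U y q - g q)) / real n"
      unfolding empirical_risk_def sum_over_blocks U_def I_def
      by (simp add: right_diff_distrib sum_subtractf diff_divide_distrib)
    also have "\<dots> = T y + (\<Sum>q\<in>small. real (card (I q)) * (U y q - g q)) / real n"
      unfolding T_def dis(1) by (simp add: sum.union_disjoint[OF dis(3,4,2)] add_divide_distrib)
    finally have e: "empirical_risk \<phi> s k n qs y f - (\<Sum>i\<in>{1..n}. g (qs i)) / real n =
       T y + (\<Sum>q\<in>small. real (card (I q)) * (U y q - g q)) / real n" .
    have "\<bar>\<Sum>q\<in>small. real (card (I q)) * (U y q - g q)\<bar> \<le> (\<Sum>q\<in>small. real (card (I q)) * b)"
    proof (rule order_trans[OF sum_abs], rule sum_mono)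
      fix q assume "q \<in> small"
      then have q: "q \<in> \<Q>" using qs by (auto simp: small_def)
      have "\<bar>U y q - g q\<bar> \<le> b"
        using block_average_bounds[of "I q" \<phi> "f q" b s k y, OF finI bound[OF q]]
          expected_surrogate_bounds[of "\<kappa> q" \<phi> "f q" b s k, OF _ bound[OF q]] \<kappa>[OF q]
        by (auto simp: U_def g_def abs_le_iff)
      then show "\<bar>real (card (I q)) * (U y q - g q)\<bar> \<le> real (card (I q)) * b"
        by (simp add: abs_mult mult_left_mono)
    qed
    also have "\<dots> = (\<Sum>q\<in>qs ` {1..n}. if card (I q) < k then real (card (I q)) * b else 0)"
      unfolding small_def by (rule sum.inter_filter) simp
    also have "\<dots> = b * (\<Sum>q\<in>qs ` {1..n}. real (card (I q)) * (if card (I q) < k then 1 else 0))"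
      unfolding sum_distrib_left by (rule sum.cong) auto
    also have "\<dots> = b * (\<Sum>i\<in>{1..n}. if card (I (qs i)) < k then 1 else 0)"
      using sum_over_blocks[of "\<lambda>q. if card (I q) < k then 1 else 0" qs n] unfolding I_def by (simp only:)
    also have "\<dots> = b * sparse_fraction k n qs * real n"
      using n by (simp add: sparse_fraction_def I_def sum.If_cases Int_def)
    finally have "\<bar>(\<Sum>q\<in>small. real (card (I q)) * (U y q - g q)) / real n\<bar> \<le> b * sparse_fraction k n qs"
      using n by (simp add: field_simps)
    then show ?thesis unfolding e by linarith
  qed
  have "prob {y \<in> space P. t + b * sparse_fraction k n qs \<le>
           \<bar>empirical_risk \<phi> s k n qs y f - (\<Sum>i\<in>{1..n}. g (qs i)) / real n\<bar>} \<le> prob {y \<in> space P. t \<le> \<bar>T y\<bar>}"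
  proof (rule finite_measure_mono)
    show "{y \<in> space P. t \<le> \<bar>T y\<bar>} \<in> events" using T_measurable by measurable
    show "{y \<in> space P. t + b * sparse_fraction k n qs \<le>
           \<bar>empirical_risk \<phi> s k n qs y f - (\<Sum>i\<in>{1..n}. g (qs i)) / real n\<bar>} \<subseteq> {y \<in> space P. t \<le> \<bar>T y\<bar>}"
      using split by (smt (verit) mem_Collect_eq subsetI)
  qed
  also note dev
  also have "- 2 * t\<^sup>2 / v = - (real n * t\<^sup>2 / (real k * b\<^sup>2))"
    using n by (simp add: v_def)
  finally show ?thesis by (simp add: g_def)
qed

subsection \<open>Conditioning on the queries\<close>

lemma block_average_cong:
  assumes "finite I" "\<And>i. i \<in> I \<Longrightarrow> ys i = ys' i"
  shows "block_average \<phi> s k ys I \<alpha> = block_average \<phi> s k ys' I \<alpha>"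
proof -
  have *: "map ys (sorted_list_of_set J) = map ys' (sorted_list_of_set J)" if "J \<subseteq> I" for J
    using assms that finite_subset[OF that] by (intro map_cong) auto
  have "(\<Sum>J | J \<subseteq> I \<and> card J = k. \<phi> \<alpha> (s (map ys (sorted_list_of_set J)))) =
      (\<Sum>J | J \<subseteq> I \<and> card J = k. \<phi> \<alpha> (s (map ys' (sorted_list_of_set J))))"
    by (intro sum.cong refl) (simp add: *)
  with *[OF subset_refl] show ?thesis unfolding block_average_def by (simp only:)
qed

lemma block_cong: "(\<And>i. i \<in> {1..n} \<Longrightarrow> qs i = qs' i) \<Longrightarrow> block qs n q = block qs' n q"
  by (auto simp: block_def)

text \<open>Lets the sample be replaced by its restriction to \<open>{1..n}\<close>, a point of a
  product space on which the conditional law can be stated.\<close>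

lemma empirical_risk_cong:
  assumes "\<And>i. i \<in> {1..n} \<Longrightarrow> qs i = qs' i" "\<And>i. i \<in> {1..n} \<Longrightarrow> ys i = ys' i"
  shows "empirical_risk \<phi> s k n qs ys f = empirical_risk \<phi> s k n qs' ys' f"
proof -
  have "block_average \<phi> s k ys (block qs' n q) (f q) = block_average \<phi> s k ys' (block qs' n q) (f q)" for q
    by (rule block_average_cong) (use assms in \<open>auto simp: block_def\<close>)
  moreover have "qs ` {1..n} = qs' ` {1..n}" using assms by (intro image_cong) auto
  ultimately show ?thesis
    unfolding empirical_risk_def using block_cong[of n qs qs', OF assms(1)] by simp
qed

lemma sparse_fraction_cong:
  assumes "\<And>i. i \<in> {1..n} \<Longrightarrow> qs i = qs' i"
  shows "sparse_fraction k n qs = sparse_fraction k n qs'"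
proof -
  have "{i \<in> {1..n}. card (block qs n (qs i)) < k} = {i \<in> {1..n}. card (block qs' n (qs' i)) < k}"
    using assms block_cong[of n qs qs', OF assms] by auto
  then show ?thesis by (simp add: sparse_fraction_def)
qed

lemma empirical_risk_measurable:
  fixes \<phi> :: "'a \<Rightarrow> 's::topological_space \<Rightarrow> real"
  assumes struct: "measurable_structure MY s" and cont: "\<And>\<alpha>. continuous_on UNIV (\<phi> \<alpha>)" and k: "1 \<le> k"
    and y: "\<And>j. j \<in> {1..n} \<Longrightarrow> (\<lambda>\<omega>. y \<omega> j) \<in> measurable N MY"
  shows "(\<lambda>\<omega>. empirical_risk \<phi> s k n qs (y \<omega>) f) \<in> borel_measurable N"
proof -
  have fin: "finite (block qs n q)" for q by (simp add: block_def)
  have sub: "block qs n q \<subseteq> {1..n}" for q by (auto simp: block_def)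
  have sl: "(\<lambda>\<omega>. \<phi> (f q) (s (map (y \<omega>) (sorted_list_of_set J)))) \<in> borel_measurable N"
    if "J \<subseteq> block qs n q" "J \<noteq> {}" for q J
  proof -
    have "(\<lambda>\<omega>. y \<omega> j) \<in> measurable N MY" if "j \<in> J" for j
      using y sub \<open>J \<subseteq> block qs n q\<close> that by blast
    then show ?thesis
      using structure_loss_measurable[where \<phi>=\<phi> and \<alpha>="f q" and y=y and N=N, OF struct cont finite_subset[OF that(1) fin] that(2)]
      by (simp add: structure_loss_def)
  qed
  have "(\<lambda>\<omega>. block_average \<phi> s k (y \<omega>) (block qs n q) (f q)) \<in> borel_measurable N" if "q \<in> qs ` {1..n}" for q
  proof (cases "k \<le> card (block qs n q)")
    case True
    have "J \<noteq> {}" if "card J = k" for J :: "nat set" using that k by auto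
    then show ?thesis using True sl by (auto simp: block_average_def intro!: borel_measurable_divide borel_measurable_sum)
  next
    case False
    \<comment> \<open>Only queries that occur are summed, so the fallback never evaluates
      \<open>s\<close> on the empty list.\<close>
    have "block qs n q \<noteq> {}" using that by (auto simp: block_def)
    then show ?thesis using False sl[of "block qs n q" q] by (simp add: block_average_def)
  qed
  then show ?thesis unfolding empirical_risk_def
    by (intro borel_measurable_times borel_measurable_sum) auto
qed

locale query_sample = prob_space M
  for M :: "'w measure" and \<Q> :: "nat set" and MY :: "'y measure" and p :: "nat \<Rightarrow> real"
    and \<kappa> :: "nat \<Rightarrow> 'y measure" and Q :: "nat \<Rightarrow> 'w \<Rightarrow> nat" and Y :: "nat \<Rightarrow> 'w \<Rightarrow> 'y" +
  assumes data: "iid_query_judgments M \<Q> MY p \<kappa> Q Y"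
begin

lemma indep: "indep_vars (\<lambda>_. count_space \<Q> \<Otimes>\<^sub>M MY) (\<lambda>i \<omega>. (Q i \<omega>, Y i \<omega>)) {1..}"
  using data by (simp add: iid_query_judgments_def)

lemma kernel: "q \<in> \<Q> \<Longrightarrow> prob_space (\<kappa> q) \<and> sets (\<kappa> q) = sets MY"
  using data by (simp add: iid_query_judgments_def)

lemma joint_law: "1 \<le> i \<Longrightarrow> q \<in> \<Q> \<Longrightarrow> A \<in> sets MY \<Longrightarrow>
    prob {\<omega> \<in> space M. Q i \<omega> = q \<and> Y i \<omega> \<in> A} = p q * measure (\<kappa> q) A"
  using data by (simp add: iid_query_judgments_def)

lemma pair_measurable: "1 \<le> i \<Longrightarrow> (\<lambda>\<omega>. (Q i \<omega>, Y i \<omega>)) \<in> measurable M (count_space \<Q> \<Otimes>\<^sub>M MY)"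
  using indep by (simp add: indep_vars_def2)

lemma Q_measurable: "1 \<le> i \<Longrightarrow> Q i \<in> measurable M (count_space \<Q>)"
  using measurable_compose[OF pair_measurable measurable_fst] by (simp add: comp_def)

lemma Y_measurable: "1 \<le> i \<Longrightarrow> Y i \<in> measurable M MY"
  using measurable_compose[OF pair_measurable measurable_snd] by (simp add: comp_def)

lemma Q_in: "1 \<le> i \<Longrightarrow> \<omega> \<in> space M \<Longrightarrow> Q i \<omega> \<in> \<Q>"
  using measurable_space[OF Q_measurable] by simp

lemma prob_Q: "1 \<le> i \<Longrightarrow> q \<in> \<Q> \<Longrightarrow> prob {\<omega> \<in> space M. Q i \<omega> = q} = p q"
proof -
  assume i: "1 \<le> i" and q: "q \<in> \<Q>"
  have "{\<omega> \<in> space M. Q i \<omega> = q \<and> Y i \<omega> \<in> space MY} = {\<omega> \<in> space M. Q i \<omega> = q}"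
    using measurable_space[OF Y_measurable[OF i]] by auto
  moreover have "measure (\<kappa> q) (space MY) = 1"
    using kernel[OF q] sets_eq_imp_space_eq[of "\<kappa> q" MY] prob_space.prob_space[of "\<kappa> q"] by simp
  ultimately show ?thesis using joint_law[OF i q sets.top] by simp
qed

lemma p_nonneg: "q \<in> \<Q> \<Longrightarrow> 0 \<le> p q"
  using prob_Q[of 1 q] by (metis measure_nonneg order_refl)

text \<open>Restricted to \<open>{1..n}\<close>, the query vector lives in the countable set
  \<open>PiE {1..n} (\<lambda>_. \<Q>)\<close>. Conditioning on it then amounts to splitting the
  sample space into countably many events.\<close>

abbreviation queries :: "nat \<Rightarrow> 'w \<Rightarrow> nat \<Rightarrow> nat" where
  "queries n \<omega> \<equiv> (\<lambda>i\<in>{1..n}. Q i \<omega>)"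

abbreviation judgments :: "nat \<Rightarrow> 'w \<Rightarrow> nat \<Rightarrow> 'y" where
  "judgments n \<omega> \<equiv> (\<lambda>i\<in>{1..n}. Y i \<omega>)"

lemma judgments_measurable: "judgments n \<in> measurable M (Pi\<^sub>M {1..n} (\<lambda>_. MY))"
  by (intro measurable_restrict Y_measurable) auto

lemma queries_measurable: "queries n \<in> measurable M (count_space (PiE {1..n} (\<lambda>_. \<Q>)))"
proof (subst measurable_count_space_eq_countable, goal_cases)
  case 1
  show "countable (PiE {1..n} (\<lambda>_. \<Q>))" by (intro countable_PiE) auto
next
  case 2
  show ?case
  proof (intro conjI ballI funcsetI)
  show "queries n \<omega> \<in> PiE {1..n} (\<lambda>_. \<Q>)" if "\<omega> \<in> space M" for \<omega> using Q_in that by auto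
  fix qs assume qs: "qs \<in> PiE {1..n} (\<lambda>_. \<Q>)"
  have eq: "queries n -` {qs} \<inter> space M = {\<omega> \<in> space M. \<forall>i\<in>{1..n}. Q i \<omega> = qs i}"
    using qs by (auto simp: fun_eq_iff PiE_def extensional_def restrict_def) 
  have "{\<omega> \<in> space M. Q i \<omega> = qs i} \<in> sets M" if "i \<in> {1..n}" for i
  proof -
    have "Q i -` {qs i} \<inter> space M \<in> sets M" by (rule measurable_sets[OF Q_measurable]) (use that qs in auto)
    then show ?thesis by (simp add: vimage_def Int_def conj_commute)
  qed
  then show "queries n -` {qs} \<inter> space M \<in> sets M"
    unfolding eq by (intro sets.sets_Collect_finite_All) auto
  qed
qed

text \<open>Elementary form of the statement that, given the queries, the judgments are independent
  with laws \<open>\<kappa> (qs i)\<close>. It is written as a product, without division, so query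
  vectors of probability zero are covered. On rectangles it is the independence of the pairs
  together with their joint law; rectangles determine finite measures on the product.\<close>

lemma conditional_law:
  assumes n: "1 \<le> n" and qs: "\<And>i. i \<in> {1..n} \<Longrightarrow> qs i \<in> \<Q>" and A: "A \<in> sets (Pi\<^sub>M {1..n} (\<lambda>_. MY))"
  shows "emeasure M {\<omega> \<in> space M. (\<forall>i\<in>{1..n}. Q i \<omega> = qs i) \<and> judgments n \<omega> \<in> A} =
    ennreal (\<Prod>i\<in>{1..n}. p (qs i)) * emeasure (Pi\<^sub>M {1..n} (\<lambda>i. \<kappa> (qs i))) A"
proof -
  define E where "E = {\<omega> \<in> space M. \<forall>i\<in>{1..n}. Q i \<omega> = qs i}"
  \<comment> \<open>The law of the judgments under \<open>M\<close> restricted to the event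
    \<open>E\<close>; the restriction is written as a density.\<close>
  define N1 where "N1 = distr (density M (indicator E)) (Pi\<^sub>M {1..n} (\<lambda>_. MY)) (judgments n)"
  define N2 where "N2 = scale_measure (ennreal (\<Prod>i\<in>{1..n}. p (qs i))) (Pi\<^sub>M {1..n} (\<lambda>i. \<kappa> (qs i)))"
  have Ei: "{\<omega> \<in> space M. Q i \<omega> = qs i} \<in> sets M" if "i \<in> {1..n}" for i
  proof -
    have "Q i -` {qs i} \<inter> space M \<in> sets M" by (rule measurable_sets[OF Q_measurable]) (use that qs in auto)
    then show ?thesis by (simp add: vimage_def Int_def conj_commute)
  qed
  have E: "E \<in> sets M" unfolding E_def using Ei by (intro sets.sets_Collect_finite_All) auto
  have sk: "sets (Pi\<^sub>M {1..n} (\<lambda>i. \<kappa> (qs i))) = sets (Pi\<^sub>M {1..n} (\<lambda>_. MY))"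
    by (rule sets_PiM_cong) (use qs kernel in auto)
  have N1: "emeasure N1 B = emeasure M {\<omega> \<in> space M. (\<forall>i\<in>{1..n}. Q i \<omega> = qs i) \<and> judgments n \<omega> \<in> B}"
    if B: "B \<in> sets (Pi\<^sub>M {1..n} (\<lambda>_. MY))" for B
  proof -
    have "judgments n -` B \<inter> space M \<in> sets M" by (rule measurable_sets[OF judgments_measurable B])
    then have "emeasure N1 B = emeasure M (E \<inter> (judgments n -` B \<inter> space M))"
      unfolding N1_def using E B judgments_measurable[of n]
      by (simp add: emeasure_distr emeasure_restricted)
    also have "E \<inter> (judgments n -` B \<inter> space M) = {\<omega> \<in> space M. (\<forall>i\<in>{1..n}. Q i \<omega> = qs i) \<and> judgments n \<omega> \<in> B}"
      by (auto simp: E_def)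
    finally show ?thesis .
  qed
  \<comment> \<open>The product locales require a probability measure at every index. Outside
    \<open>{1..n}\<close> the kernel of \<open>qs 1\<close> serves as a default, a legitimate query
    since \<open>n \<ge> 1\<close>.\<close>
  define \<kappa>' where "\<kappa>' i = \<kappa> (if i \<in> {1..n} then qs i else qs 1)" for i
  have \<kappa>': "prob_space (\<kappa>' i)" for i using qs kernel n by (auto simp: \<kappa>'_def)
  interpret P: product_prob_space \<kappa>' "{1..n}"
    by (rule product_prob_spaceI) (rule \<kappa>')
  interpret P: finite_product_prob_space \<kappa>' "{1..n}" by unfold_locales auto
  have P: "Pi\<^sub>M {1..n} (\<lambda>i. \<kappa> (qs i)) = Pi\<^sub>M {1..n} \<kappa>'"
    by (rule PiM_cong) (auto simp: \<kappa>'_def)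
  have "N1 = N2"
  proof (rule measure_eqI_PiM_finite[where A="\<lambda>_. space (Pi\<^sub>M {1..n} (\<lambda>_. MY))"])
    show "finite {1..n}" by simp
    show "sets N1 = sets (Pi\<^sub>M {1..n} (\<lambda>_. MY))" by (simp add: N1_def)
    show "sets N2 = sets (Pi\<^sub>M {1..n} (\<lambda>_. MY))" by (simp only: N2_def sets_scale_measure sk)
    show "range (\<lambda>_::nat. space (Pi\<^sub>M {1..n} (\<lambda>_. MY))) \<subseteq> prod_algebra {1..n} (\<lambda>_. MY)"
      by (auto simp: space_PiM intro!: prod_algebraI_finite)
    show "(\<Union>i::nat. space (Pi\<^sub>M {1..n} (\<lambda>_. MY))) = space (Pi\<^sub>M {1..n} (\<lambda>_. MY))" by simp
    show "N1 (space (Pi\<^sub>M {1..n} (\<lambda>_. MY))) \<noteq> \<infinity>" by (subst N1) auto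
    fix B assume B: "\<And>i. i \<in> {1..n} \<Longrightarrow> B i \<in> sets MY"
    have BM: "Pi\<^sub>E {1..n} B \<in> sets (Pi\<^sub>M {1..n} (\<lambda>_. MY))" using B by (intro sets_PiM_I_finite) auto
    have "{\<omega> \<in> space M. (\<forall>i\<in>{1..n}. Q i \<omega> = qs i) \<and> judgments n \<omega> \<in> Pi\<^sub>E {1..n} B} =
      (\<Inter>i\<in>{1..n}. (\<lambda>\<omega>. (Q i \<omega>, Y i \<omega>)) -` ({qs i} \<times> B i) \<inter> space M)"
      using n by (auto simp: PiE_iff)
    then have "emeasure N1 (Pi\<^sub>E {1..n} B) = ennreal (prob (\<Inter>i\<in>{1..n}. (\<lambda>\<omega>. (Q i \<omega>, Y i \<omega>)) -` ({qs i} \<times> B i) \<inter> space M))"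
      by (simp only: N1[OF BM] emeasure_eq_measure)
    also have "prob (\<Inter>i\<in>{1..n}. (\<lambda>\<omega>. (Q i \<omega>, Y i \<omega>)) -` ({qs i} \<times> B i) \<inter> space M) =
        (\<Prod>i\<in>{1..n}. prob ((\<lambda>\<omega>. (Q i \<omega>, Y i \<omega>)) -` ({qs i} \<times> B i) \<inter> space M))"
      using n B qs by (intro indep_varsD[OF indep]) (auto intro!: pair_measureI)
    also have "\<dots> = (\<Prod>i\<in>{1..n}. p (qs i) * measure (\<kappa> (qs i)) (B i))"
    proof (rule prod.cong[OF refl])
      fix i assume i: "i \<in> {1..n}"
      have "(\<lambda>\<omega>. (Q i \<omega>, Y i \<omega>)) -` ({qs i} \<times> B i) \<inter> space M = {\<omega> \<in> space M. Q i \<omega> = qs i \<and> Y i \<omega> \<in> B i}" by auto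
      then show "prob ((\<lambda>\<omega>. (Q i \<omega>, Y i \<omega>)) -` ({qs i} \<times> B i) \<inter> space M) = p (qs i) * measure (\<kappa> (qs i)) (B i)"
        using joint_law[of i "qs i" "B i"] i qs[OF i] B[OF i] by simp
    qed
    also have "\<dots> = (\<Prod>i\<in>{1..n}. p (qs i)) * (\<Prod>i\<in>{1..n}. measure (\<kappa>' i) (B i))"
      by (simp add: prod.distrib \<kappa>'_def)
    also have "(\<Prod>i\<in>{1..n}. measure (\<kappa>' i) (B i)) = measure (Pi\<^sub>M {1..n} \<kappa>') (Pi\<^sub>E {1..n} B)"
      using B qs kernel by (intro P.prob_times[symmetric]) (auto simp: \<kappa>'_def)
    also have "ennreal ((\<Prod>i\<in>{1..n}. p (qs i)) * \<dots>) = emeasure N2 (Pi\<^sub>E {1..n} B)"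
    proof -
      have "0 \<le> (\<Prod>i\<in>{1..n}. p (qs i))" using qs p_nonneg by (intro prod_nonneg) auto
      then show ?thesis
        by (simp only: N2_def P emeasure_scale_measure P.P.emeasure_eq_measure ennreal_mult measure_nonneg)
    qed
    finally show "emeasure N1 (Pi\<^sub>E {1..n} B) = emeasure N2 (Pi\<^sub>E {1..n} B)" .
  qed
  then show ?thesis using N1[OF A] by (simp add: N2_def)
qed

text \<open>A bound that holds conditionally on every query vector, with the same
  \<open>\<delta>\<close>, holds unconditionally: the estimates \<open>\<delta>\<close> times the
  probability of \<open>E qs\<close> are summed over countably many disjoint events. The predicate
  \<open>R\<close> may involve the queries too, so thresholds that depend on them are
  allowed.\<close>

lemma prob_le_conditional:
  assumes n: "1 \<le> n" and \<delta>: "0 \<le> \<delta>"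
    and meas: "\<And>qs. qs \<in> PiE {1..n} (\<lambda>_. \<Q>) \<Longrightarrow> {y \<in> space (Pi\<^sub>M {1..n} (\<lambda>_. MY)). R qs y} \<in> sets (Pi\<^sub>M {1..n} (\<lambda>_. MY))"
    and le: "\<And>qs. qs \<in> PiE {1..n} (\<lambda>_. \<Q>) \<Longrightarrow> 
      measure (Pi\<^sub>M {1..n} (\<lambda>i. \<kappa> (qs i))) {y \<in> space (Pi\<^sub>M {1..n} (\<lambda>i. \<kappa> (qs i))). R qs y} \<le> \<delta>"
  shows "prob {\<omega> \<in> space M. R (queries n \<omega>) (judgments n \<omega>)} \<le> \<delta>"
    and "{\<omega> \<in> space M. R (queries n \<omega>) (judgments n \<omega>)} \<in> sets M"
proof -
  let ?S = "PiE {1..n} (\<lambda>_. \<Q>)" and ?MY = "Pi\<^sub>M {1..n} (\<lambda>_. MY)"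
  define X where "X qs = {\<omega> \<in> space M. (\<forall>i\<in>{1..n}. Q i \<omega> = qs i) \<and> judgments n \<omega> \<in> {y \<in> space ?MY. R qs y}}" for qs
  define E where "E qs = {\<omega> \<in> space M. (\<forall>i\<in>{1..n}. Q i \<omega> = qs i) \<and> judgments n \<omega> \<in> space ?MY}" for qs
  have cS: "countable ?S" by (intro countable_PiE) auto
  have qsE: "(\<forall>i\<in>{1..n}. Q i \<omega> = qs i) \<longleftrightarrow> queries n \<omega> = qs" if "qs \<in> ?S" for qs \<omega>
    using that by (auto simp: fun_eq_iff PiE_def extensional_def restrict_def)
  have Em: "{\<omega> \<in> space M. (\<forall>i\<in>{1..n}. Q i \<omega> = qs i) \<and> judgments n \<omega> \<in> A} \<in> sets M" if "qs \<in> ?S" "A \<in> sets ?MY" for qs A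
  proof -
    have "queries n -` {qs} \<inter> space M \<in> sets M" using queries_measurable that by (auto intro: measurable_sets)
    moreover have "judgments n -` A \<inter> space M \<in> sets M" using judgments_measurable that by (auto intro: measurable_sets)
    moreover have "{\<omega> \<in> space M. (\<forall>i\<in>{1..n}. Q i \<omega> = qs i) \<and> judgments n \<omega> \<in> A} = (queries n -` {qs} \<inter> space M) \<inter> (judgments n -` A \<inter> space M)"
      unfolding qsE[OF that(1)] by auto
    ultimately show ?thesis by auto
  qed
  have Xm: "X qs \<in> sets M" "E qs \<in> sets M" if "qs \<in> ?S" for qs
    unfolding X_def E_def by (rule Em[OF that meas[OF that]], rule Em[OF that sets.top])
  have sp: "judgments n \<omega> \<in> space ?MY" "queries n \<omega> \<in> ?S" if "\<omega> \<in> space M" for \<omega>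
    using measurable_space[OF judgments_measurable that] Q_in that by auto
  have eq: "{\<omega> \<in> space M. R (queries n \<omega>) (judgments n \<omega>)} = (\<Union>qs\<in>?S. X qs)"
    using sp qsE by (auto simp: X_def) 
  show sets: "{\<omega> \<in> space M. R (queries n \<omega>) (judgments n \<omega>)} \<in> sets M"
    unfolding eq using Xm cS by (intro sets.countable_UN') auto
  have dj: "disjoint_family_on X ?S" "disjoint_family_on E ?S"
    using qsE by (auto simp: disjoint_family_on_def X_def E_def)
  have XE: "emeasure M (X qs) \<le> ennreal \<delta> * emeasure M (E qs)" if qs: "qs \<in> ?S" for qs
  proof -
    let ?P = "Pi\<^sub>M {1..n} (\<lambda>i. \<kappa> (qs i))"
    have qsQ: "qs i \<in> \<Q>" if "i \<in> {1..n}" for i using qs that by auto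
    interpret P: prob_space ?P using qsQ kernel by (intro prob_space_PiM) auto
    have sk: "sets ?P = sets ?MY"
      by (rule sets_PiM_cong) (use qsQ kernel in auto)
    note spk = sets_eq_imp_space_eq[OF sk]
    have "emeasure M (X qs) = ennreal (\<Prod>i\<in>{1..n}. p (qs i)) * emeasure ?P {y \<in> space ?MY. R qs y}"
      unfolding X_def by (rule conditional_law[OF n qsQ meas[OF qs]])
    also have "\<dots> \<le> ennreal (\<Prod>i\<in>{1..n}. p (qs i)) * ennreal \<delta>"
      using le[OF qs] unfolding spk by (intro mult_left_mono) (simp_all only: P.emeasure_eq_measure ennreal_leI zero_le)
    also have "ennreal (\<Prod>i\<in>{1..n}. p (qs i)) = emeasure M (E qs)"
      unfolding E_def using conditional_law[OF n qsQ sets.top] P.emeasure_space_1[unfolded spk] by (simp only: mult_1_right)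
    finally show ?thesis by (simp add: mult.commute)
  qed
  have "emeasure M (\<Union>qs\<in>?S. X qs) = (\<integral>\<^sup>+qs. emeasure M (X qs) \<partial>count_space ?S)"
    by (rule emeasure_UN_countable[OF Xm(1) cS dj(1)])
  also have "\<dots> \<le> (\<integral>\<^sup>+qs. ennreal \<delta> * emeasure M (E qs) \<partial>count_space ?S)"
    using XE by (intro nn_integral_mono) auto
  also have "\<dots> = ennreal \<delta> * emeasure M (\<Union>qs\<in>?S. E qs)"
    by (subst emeasure_UN_countable[OF Xm(2) cS dj(2)]) (auto intro!: nn_integral_cmult)
  also have "\<dots> \<le> ennreal \<delta> * 1" by (intro mult_left_mono emeasure_le_1) auto
  finally show "prob {\<omega> \<in> space M. R (queries n \<omega>) (judgments n \<omega>)} \<le> \<delta>"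
    unfolding eq using \<delta> by (simp add: emeasure_eq_measure)
qed

end

section \<open>Tail sums of a power law\<close>

lemma powr_neg_le_telescope:
  fixes \<beta> :: real
  assumes "\<beta> > 0" "2 \<le> q"
  shows "real q powr (- \<beta> - 1) \<le> (real (q - 1) powr (- \<beta>) - real q powr (- \<beta>)) / \<beta>"
proof -
  have r: "real q - real (q - 1) = 1" using assms by (simp add: of_nat_diff)
  have "real (q - 1) < real q" using assms by simp
  \<comment> \<open>Since \<open>2 \<le> q\<close>, the interval stays away from 0. At
    \<open>q = 1\<close> the convention that \<open>0 powr (- \<beta>)\<close> is 0 would make the
    claim false.\<close>
  moreover have "((\<lambda>x. x powr (- \<beta>)) has_real_derivative (- \<beta> * x powr (- \<beta> - 1))) (at x)"
    if "real (q - 1) \<le> x" for x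
    using that assms by (auto intro!: derivative_eq_intros)
  ultimately obtain z where z: "real (q - 1) < z" "z < real q"
    and e: "real q powr (- \<beta>) - real (q - 1) powr (- \<beta>) = (real q - real (q - 1)) * (- \<beta> * z powr (- \<beta> - 1))"
    using MVT2[of "real (q - 1)" "real q" "\<lambda>x. x powr (- \<beta>)" "\<lambda>x. - \<beta> * x powr (- \<beta> - 1)"] by blast
  have "real q powr (- \<beta> - 1) \<le> z powr (- \<beta> - 1)"
    using z assms by (intro powr_mono2') auto
  then have "\<beta> * real q powr (- \<beta> - 1) \<le> \<beta> * z powr (- \<beta> - 1)"
    using assms by (intro mult_left_mono) auto
  then have "\<beta> * real q powr (- \<beta> - 1) \<le> real (q - 1) powr (- \<beta>) - real q powr (- \<beta>)"
    using e unfolding r by linarith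
  then show ?thesis using assms by (simp add: field_simps)
qed

text \<open>Any finite \<open>A\<close> above \<open>m\<close> lies in an interval on which the
  bounds telescope. Finite sets suffice because an infinite sum of nonnegative terms is controlled
  by its finite partial sums.\<close>

lemma sum_powr_neg_tail:
  fixes \<beta> :: real
  assumes "\<beta> > 0" "1 \<le> m" "finite A" "\<And>q. q \<in> A \<Longrightarrow> m < q"
  shows "(\<Sum>q\<in>A. real q powr (- \<beta> - 1)) \<le> real m powr (- \<beta>) / \<beta>"
proof -
  obtain l where l: "\<And>q. q \<in> A \<Longrightarrow> q \<le> m + l"
    using finite_nat_set_iff_bounded_le[of A] assms(3) by (metis trans_le_add2)
  have tel: "(\<Sum>q\<in>{m<..m + l}. real q powr (- \<beta> - 1)) \<le> (real m powr (- \<beta>) - real (m + l) powr (- \<beta>)) / \<beta>" for l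
  proof (induction l)
    case (Suc l)
    have "{m<..m + Suc l} = insert (m + Suc l) {m<..m + l}" by auto
    then have "(\<Sum>q\<in>{m<..m + Suc l}. real q powr (- \<beta> - 1)) = real (m + Suc l) powr (- \<beta> - 1) + (\<Sum>q\<in>{m<..m + l}. real q powr (- \<beta> - 1))"
      by simp
    also have "\<dots> \<le> (real (m + l) powr (- \<beta>) - real (m + Suc l) powr (- \<beta>)) / \<beta> + (real m powr (- \<beta>) - real (m + l) powr (- \<beta>)) / \<beta>"
      using powr_neg_le_telescope[OF assms(1), of "m + Suc l"] assms(2) Suc.IH by (intro add_mono) auto
    finally show ?case by (simp add: diff_divide_distrib)
  qed simp
  have "(\<Sum>q\<in>A. real q powr (- \<beta> - 1)) \<le> (\<Sum>q\<in>{m<..m + l}. real q powr (- \<beta> - 1))"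
    by (rule sum_mono2) (use assms l in auto)
  also note tel[of l]
  also have "(real m powr (- \<beta>) - real (m + l) powr (- \<beta>)) / \<beta> \<le> real m powr (- \<beta>) / \<beta>"
    using assms(1) by (intro divide_right_mono) auto
  finally show ?thesis .
qed

section \<open>Unconditional deviations: judgments, query averages and rare queries\<close>

context query_sample
begin

lemma empirical_risk_restrict:
  "empirical_risk \<phi> s k n (queries n \<omega>) (judgments n \<omega>) f = empirical_risk \<phi> s k n (\<lambda>i. Q i \<omega>) (\<lambda>i. Y i \<omega>) f"
  by (rule empirical_risk_cong) auto

lemma sample_empirical_risk_measurable:
  fixes \<phi> :: "'a \<Rightarrow> 's::topological_space \<Rightarrow> real"
  assumes struct: "measurable_structure MY s" and cont: "\<And>\<alpha>. continuous_on UNIV (\<phi> \<alpha>)" and k: "1 \<le> k"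
  shows "(\<lambda>\<omega>. empirical_risk \<phi> s k n (\<lambda>i. Q i \<omega>) (\<lambda>i. Y i \<omega>) f) \<in> borel_measurable M"
proof -
  have "(\<lambda>\<omega>. empirical_risk \<phi> s k n (queries n \<omega>) (judgments n \<omega>) f) \<in> borel_measurable M"
  proof (rule measurable_compose_countable'[OF _ queries_measurable])
    show "(\<lambda>\<omega>. empirical_risk \<phi> s k n qs (judgments n \<omega>) f) \<in> borel_measurable M" for qs
      by (rule empirical_risk_measurable[OF struct cont k]) (auto intro: Y_measurable)
    show "countable (PiE {1..n} (\<lambda>_. \<Q>))" by (intro countable_PiE) auto
  qed
  then show ?thesis by (simp only: empirical_risk_restrict)
qed

text \<open>The random term with \<open>sparse_fraction\<close> is part of the threshold, so the
  conditional bound is the same for all query vectors and survives averaging over them.\<close>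

lemma empirical_risk_deviation:
  fixes \<phi> :: "'a \<Rightarrow> 's::topological_space \<Rightarrow> real"
  assumes struct: "measurable_structure MY s" and cont: "\<And>\<alpha>. continuous_on UNIV (\<phi> \<alpha>)"
    and n: "1 \<le> n" and k: "1 \<le> k"
    and bound: "\<And>q x. q \<in> \<Q> \<Longrightarrow> 0 \<le> \<phi> (f q) x \<and> \<phi> (f q) x \<le> b" and b: "0 < b" and t: "0 < t"
  defines "dev \<omega> \<equiv> \<bar>empirical_risk \<phi> s k n (\<lambda>i. Q i \<omega>) (\<lambda>i. Y i \<omega>) f
    - (\<Sum>i\<in>{1..n}. expected_surrogate \<phi> s (\<kappa> (Q i \<omega>)) k (f (Q i \<omega>))) / real n\<bar>"
  shows "prob {\<omega> \<in> space M. t + b * sparse_fraction k n (\<lambda>i. Q i \<omega>) \<le> dev \<omega>}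
         \<le> 2 * exp (- (real n * t\<^sup>2 / (real k * b\<^sup>2)))"
    and "{\<omega> \<in> space M. t + b * sparse_fraction k n (\<lambda>i. Q i \<omega>) \<le> dev \<omega>} \<in> sets M"
proof -
  define R where "R qs y \<longleftrightarrow> t + b * sparse_fraction k n qs \<le>
    \<bar>empirical_risk \<phi> s k n qs y f - (\<Sum>i\<in>{1..n}. expected_surrogate \<phi> s (\<kappa> (qs i)) k (f (qs i))) / real n\<bar>" for qs y
  have R: "R (queries n \<omega>) (judgments n \<omega>) \<longleftrightarrow> t + b * sparse_fraction k n (\<lambda>i. Q i \<omega>) \<le> dev \<omega>" for \<omega>
  proof -
    have "sparse_fraction k n (queries n \<omega>) = sparse_fraction k n (\<lambda>i. Q i \<omega>)"
      by (rule sparse_fraction_cong) simp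
    then show ?thesis unfolding R_def dev_def empirical_risk_restrict by simp
  qed
  have meas: "{y \<in> space (Pi\<^sub>M {1..n} (\<lambda>_. MY)). R qs y} \<in> sets (Pi\<^sub>M {1..n} (\<lambda>_. MY))" for qs
  proof -
    have "(\<lambda>y. empirical_risk \<phi> s k n qs y f) \<in> borel_measurable (Pi\<^sub>M {1..n} (\<lambda>_. MY))"
      by (rule empirical_risk_measurable[OF struct cont k]) (auto intro: measurable_component_singleton)
    then show ?thesis unfolding R_def by measurable
  qed
  have le: "measure (Pi\<^sub>M {1..n} (\<lambda>i. \<kappa> (qs i))) {y \<in> space (Pi\<^sub>M {1..n} (\<lambda>i. \<kappa> (qs i))). R qs y}
      \<le> 2 * exp (- (real n * t\<^sup>2 / (real k * b\<^sup>2)))" if "qs \<in> PiE {1..n} (\<lambda>_. \<Q>)" for qs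
    unfolding R_def
    by (rule empirical_risk_conditional_deviation[where \<phi>=\<phi> and f=f and s=s and qs=qs and \<Q>=\<Q> and \<kappa>=\<kappa>,
        OF struct cont n k _ kernel bound b t]) (use that in auto)
  note * = prob_le_conditional[of n "2 * exp (- (real n * t\<^sup>2 / (real k * b\<^sup>2)))" R, OF n _ meas le]
  show "prob {\<omega> \<in> space M. t + b * sparse_fraction k n (\<lambda>i. Q i \<omega>) \<le> dev \<omega>}
         \<le> 2 * exp (- (real n * t\<^sup>2 / (real k * b\<^sup>2)))"
    using *(1) by (simp only: R) simp
  show "{\<omega> \<in> space M. t + b * sparse_fraction k n (\<lambda>i. Q i \<omega>) \<le> dev \<omega>} \<in> sets M"
    using *(2) by (simp only: R) simp
qed

lemma function_Q_measurable: "1 \<le> i \<Longrightarrow> (\<lambda>\<omega>. g (Q i \<omega>)) \<in> borel_measurable M"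
  for g :: "nat \<Rightarrow> real"
  by (rule measurable_compose[OF Q_measurable]) simp_all

lemma distr_Q: "1 \<le> i \<Longrightarrow> distr M (count_space \<Q>) (Q i) = density (count_space \<Q>) (\<lambda>q. ennreal (p q))"
proof (rule measure_eqI_countable)
  assume i: "1 \<le> i"
  show "countable \<Q>" by simp
  fix q assume q: "q \<in> \<Q>"
  have "Q i -` {q} \<inter> space M = {\<omega> \<in> space M. Q i \<omega> = q}" by auto
  then show "emeasure (distr M (count_space \<Q>) (Q i)) {q} = emeasure (density (count_space \<Q>) (\<lambda>q. ennreal (p q))) {q}"
    using q prob_Q[OF i q] Q_measurable[OF i]
    by (simp add: emeasure_distr emeasure_density emeasure_eq_measure)
qed auto

text \<open>Identifies the sums over queries in the risks with expectations over one sampled query.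
  Boundedness of \<open>g\<close> provides integrability and hence summability of the
  series.\<close>

lemma expectation_Q:
  fixes g :: "nat \<Rightarrow> real"
  assumes i: "1 \<le> i" and g: "\<And>q. q \<in> \<Q> \<Longrightarrow> \<bar>g q\<bar> \<le> b"
  shows "expectation (\<lambda>\<omega>. g (Q i \<omega>)) = (\<Sum>\<^sub>\<infinity>q\<in>\<Q>. p q * g q)"
    and "(\<lambda>q. p q * g q) summable_on \<Q>"
    and "integrable M (\<lambda>\<omega>. g (Q i \<omega>))"
proof -
  show int: "integrable M (\<lambda>\<omega>. g (Q i \<omega>))"
    by (rule integrable_const_bound[where B=b]) (use g Q_in i function_Q_measurable in \<open>auto intro!: AE_I2\<close>)
  then have "integrable (distr M (count_space \<Q>) (Q i)) g"
    using Q_measurable[OF i] by (subst integrable_distr_eq) auto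
  then have "integrable (count_space \<Q>) (\<lambda>q. p q *\<^sub>R g q)"
    unfolding distr_Q[OF i] by (subst (asm) integrable_density) (auto simp: p_nonneg AE_count_space)
  then have as: "Infinite_Set_Sum.abs_summable_on (\<lambda>q. p q * g q) \<Q>" by (simp add: Infinite_Set_Sum.abs_summable_on_def)
  show "(\<lambda>q. p q * g q) summable_on \<Q>"
    using as abs_summable_equivalent abs_summable_summable by blast
  have "expectation (\<lambda>\<omega>. g (Q i \<omega>)) = (\<integral>q. g q \<partial>distr M (count_space \<Q>) (Q i))"
    using Q_measurable[OF i] by (intro integral_distr[symmetric]) auto
  also have "\<dots> = (\<integral>q. p q *\<^sub>R g q \<partial>count_space \<Q>)"
    unfolding distr_Q[OF i] by (intro integral_density) (auto simp: p_nonneg AE_count_space)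
  also have "\<dots> = infsetsum (\<lambda>q. p q * g q) \<Q>" by (simp add: infsetsum_def)
  finally show "expectation (\<lambda>\<omega>. g (Q i \<omega>)) = (\<Sum>\<^sub>\<infinity>q\<in>\<Q>. p q * g q)"
    by (simp add: infsetsum_infsum[OF as])
qed

lemma query_average_deviation:
  fixes g :: "nat \<Rightarrow> real"
  assumes n: "1 \<le> n" and g: "\<And>q. q \<in> \<Q> \<Longrightarrow> g q \<in> {0..b}" and b: "0 < b" and t: "0 < t"
  shows "prob {\<omega> \<in> space M. t \<le> \<bar>(\<Sum>i\<in>{1..n}. g (Q i \<omega>)) / real n - (\<Sum>\<^sub>\<infinity>q\<in>\<Q>. p q * g q)\<bar>}
      \<le> 2 * exp (- (2 * real n * t\<^sup>2 / b\<^sup>2))"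
proof -
  have ind: "indep_vars (\<lambda>_. borel) (\<lambda>i \<omega>. g (fst (Q i \<omega>, Y i \<omega>))) {1..n}"
    by (rule indep_vars_compose2[OF indep_vars_subset[OF indep]]) (auto intro: measurable_compose[OF measurable_fst])
  have E: "expectation (\<lambda>\<omega>. g (Q i \<omega>)) = (\<Sum>\<^sub>\<infinity>q\<in>\<Q>. p q * g q)" if "1 \<le> i" for i
    using g by (intro expectation_Q[OF that, of g b]) fastforce
  define \<mu> where "\<mu> = (\<Sum>i\<in>{1..n}. expectation (\<lambda>\<omega>. g (Q i \<omega>)))"
  interpret H: Hoeffding_ineq M "{1..n}" "\<lambda>i \<omega>. g (Q i \<omega>)" "\<lambda>_. 0" "\<lambda>_. b" \<mu>
    by unfold_locales (use ind g Q_in in \<open>auto simp: \<mu>_def intro!: AE_I2\<close>)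
  have \<mu>: "\<mu> = real n * (\<Sum>\<^sub>\<infinity>q\<in>\<Q>. p q * g q)" by (simp add: \<mu>_def E)
  have "prob {\<omega> \<in> space M. real n * t \<le> \<bar>(\<Sum>i\<in>{1..n}. g (Q i \<omega>)) - \<mu>\<bar>} \<le> 2 * exp (- 2 * (real n * t)\<^sup>2 / (\<Sum>i\<in>{1..n}. (b - 0)\<^sup>2))"
    by (rule H.Hoeffding_ineq_abs_ge) (use n b t in auto)
  also have "- 2 * (real n * t)\<^sup>2 / (\<Sum>i\<in>{1..n}. (b - 0)\<^sup>2) = - (2 * real n * t\<^sup>2 / b\<^sup>2)"
    using n by (simp add: power2_eq_square)
  finally have *: "prob {\<omega> \<in> space M. real n * t \<le> \<bar>(\<Sum>i\<in>{1..n}. g (Q i \<omega>)) - \<mu>\<bar>} \<le> 2 * exp (- (2 * real n * t\<^sup>2 / b\<^sup>2))" .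
  have "real n * t \<le> \<bar>(\<Sum>i\<in>{1..n}. g (Q i \<omega>)) - \<mu>\<bar> \<longleftrightarrow> t \<le> \<bar>(\<Sum>i\<in>{1..n}. g (Q i \<omega>)) / real n - (\<Sum>\<^sub>\<infinity>q\<in>\<Q>. p q * g q)\<bar>" for \<omega>
  proof -
    have "(\<Sum>i\<in>{1..n}. g (Q i \<omega>)) - \<mu> = real n * ((\<Sum>i\<in>{1..n}. g (Q i \<omega>)) / real n - (\<Sum>\<^sub>\<infinity>q\<in>\<Q>. p q * g q))"
      using n by (simp add: \<mu> right_diff_distrib)
    then show ?thesis using n by (simp only: abs_mult) simp
  qed
  then show ?thesis using * by (simp only:)
qed

lemma expected_large_query:
  assumes \<beta>: "0 < \<beta>" "0 \<le> K" and decay: "\<And>q. q \<in> \<Q> \<Longrightarrow> p q \<le> K * real q powr (- \<beta> - 1)"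
    and m: "1 \<le> m" and i: "1 \<le> i"
  shows "expectation (\<lambda>\<omega>. if m < Q i \<omega> then 1 else 0) \<le> K * real m powr (- \<beta>) / \<beta>"
proof -
  note E = expectation_Q[OF i, of "\<lambda>q. if m < q then 1 else 0" 1]
  have "expectation (\<lambda>\<omega>. if m < Q i \<omega> then 1 else 0) = (\<Sum>\<^sub>\<infinity>q\<in>\<Q>. p q * (if m < q then 1 else 0))"
    using E(1) by simp
  also have "\<dots> \<le> K * real m powr (- \<beta>) / \<beta>"
  proof (rule infsum_le_finite_sums)
    show "(\<lambda>q. p q * (if m < q then 1 else 0)) summable_on \<Q>" using E(2) by simp
    fix A assume A: "finite A" "A \<subseteq> \<Q>"
    have "(\<Sum>q\<in>A. p q * (if m < q then 1 else 0)) = (\<Sum>q\<in>{q \<in> A. m < q}. p q)"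
      by (subst sum.inter_filter[OF A(1)]) (auto intro!: sum.cong)
    also have "\<dots> \<le> (\<Sum>q\<in>{q \<in> A. m < q}. K * real q powr (- \<beta> - 1))"
      using decay A by (intro sum_mono) auto
    also have "\<dots> = K * (\<Sum>q\<in>{q \<in> A. m < q}. real q powr (- \<beta> - 1))" by (simp add: sum_distrib_left)
    also have "\<dots> \<le> K * (real m powr (- \<beta>) / \<beta>)"
      using A \<beta> m by (intro mult_left_mono sum_powr_neg_tail) auto
    finally show "(\<Sum>q\<in>A. p q * (if m < q then 1 else 0)) \<le> K * real m powr (- \<beta>) / \<beta>" by simp
  qed
  finally show ?thesis .
qed

text \<open>Counting for each outcome separately: a point in a sparse block either has a query above
  \<open>m\<close>, or belongs to one of at most \<open>m\<close> blocks with fewer than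
  \<open>k\<close> points each. That queries start at 1 leaves just \<open>m\<close> values up to
  \<open>m\<close>.\<close>

lemma sparse_fraction_le:
  assumes n: "1 \<le> n" and \<omega>: "\<omega> \<in> space M" and pos: "\<Q> \<subseteq> {1..}"
  shows "sparse_fraction k n (\<lambda>i. Q i \<omega>) \<le> real k * real m / real n + (\<Sum>i\<in>{1..n}. if m < Q i \<omega> then 1 else 0) / real n"
proof -
  let ?b = "block (\<lambda>i. Q i \<omega>) n"
  have "{i \<in> {1..n}. card (?b (Q i \<omega>)) < k} \<subseteq> (\<Union>q\<in>{q \<in> {1..m}. card (?b q) < k}. ?b q) \<union> {i \<in> {1..n}. m < Q i \<omega>}"
    using Q_in[OF _ \<omega>] pos by (fastforce simp: block_def not_less)
  then have "card {i \<in> {1..n}. card (?b (Q i \<omega>)) < k} \<le> card ((\<Union>q\<in>{q \<in> {1..m}. card (?b q) < k}. ?b q) \<union> {i \<in> {1..n}. m < Q i \<omega>})"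
    by (intro card_mono) (auto simp: block_def)
  also have "\<dots> \<le> card (\<Union>q\<in>{q \<in> {1..m}. card (?b q) < k}. ?b q) + card {i \<in> {1..n}. m < Q i \<omega>}"
    by (rule card_Un_le)
  also have "card (\<Union>q\<in>{q \<in> {1..m}. card (?b q) < k}. ?b q) \<le> (\<Sum>q\<in>{q \<in> {1..m}. card (?b q) < k}. card (?b q))"
    by (rule card_UN_le) simp
  also have "\<dots> \<le> (\<Sum>q\<in>{q \<in> {1..m}. card (?b q) < k}. k)" by (intro sum_mono) auto
  also have "\<dots> \<le> (\<Sum>q\<in>{1..m}. k)" by (rule sum_mono2) auto
  also have "\<dots> = k * m" by simp
  finally have c: "card {i \<in> {1..n}. card (?b (Q i \<omega>)) < k} \<le> k * m + card {i \<in> {1..n}. m < Q i \<omega>}" by simp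
  have "real (card {i \<in> {1..n}. m < Q i \<omega>}) = (\<Sum>i\<in>{1..n}. if m < Q i \<omega> then 1 else 0)"
    by (simp add: sum.If_cases Int_def)
  then have "real (card {i \<in> {1..n}. card (?b (Q i \<omega>)) < k}) \<le> real k * real m + (\<Sum>i\<in>{1..n}. if m < Q i \<omega> then 1 else 0)"
    using of_nat_mono[OF c, where 'a=real] by (simp only: of_nat_add of_nat_mult)
  then show ?thesis unfolding sparse_fraction_def add_divide_distrib[symmetric]
    by (intro divide_right_mono) auto
qed

text \<open>Markov's inequality is strong enough: the event does not involve the scoring function,
  so it is counted once and not once per cover element, and its probability is made small through
  \<open>m\<close>.\<close>

lemma many_large_queries:
  assumes \<beta>: "0 < \<beta>" "0 \<le> K" and decay: "\<And>q. q \<in> \<Q> \<Longrightarrow> p q \<le> K * real q powr (- \<beta> - 1)"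
    and m: "1 \<le> m" and n: "1 \<le> n" and a: "0 < a"
  shows "prob {\<omega> \<in> space M. a \<le> (\<Sum>i\<in>{1..n}. if m < Q i \<omega> then 1 else 0) / real n} \<le> K * real m powr (- \<beta>) / (\<beta> * a)"
    and "{\<omega> \<in> space M. a \<le> (\<Sum>i\<in>{1..n}. if m < Q i \<omega> then 1 else 0) / real n} \<in> sets M"
proof -
  let ?X = "\<lambda>\<omega>. (\<Sum>i\<in>{1..n}. if m < Q i \<omega> then 1 else 0) / real n"
  have int: "integrable M (\<lambda>\<omega>. if m < Q i \<omega> then 1 else 0 :: real)" if "1 \<le> i" for i
    using expectation_Q(3)[OF that, of "\<lambda>q. if m < q then 1 else 0" 1] by simp
  have iX: "integrable M ?X" using int by (intro integrable_divide integrable_sum) auto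
  have "expectation ?X = (\<Sum>i\<in>{1..n}. expectation (\<lambda>\<omega>. if m < Q i \<omega> then 1 else 0)) / real n"
    by (simp only: integral_divide_zero, subst Bochner_Integration.integral_sum) (use int in auto)
  also have "\<dots> \<le> (\<Sum>i\<in>{1..n}. K * real m powr (- \<beta>) / \<beta>) / real n"
    using expected_large_query[OF \<beta> decay m] by (intro divide_right_mono sum_mono) auto
  also have "\<dots> = K * real m powr (- \<beta>) / \<beta>" using n by simp
  finally have E: "expectation ?X \<le> K * real m powr (- \<beta>) / \<beta>" .
  have "prob {\<omega> \<in> space M. a \<le> ?X \<omega>} \<le> expectation ?X / a"
    by (rule integral_Markov_inequality_measure[OF iX, of "space M"]) (use a in \<open>auto intro!: AE_I2 sum_nonneg divide_nonneg_nonneg\<close>)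
  also have "\<dots> \<le> K * real m powr (- \<beta>) / \<beta> / a" using E a by (intro divide_right_mono) auto
  finally show "prob {\<omega> \<in> space M. a \<le> ?X \<omega>} \<le> K * real m powr (- \<beta>) / (\<beta> * a)" by simp
  show "{\<omega> \<in> space M. a \<le> ?X \<omega>} \<in> sets M" using borel_measurable_integrable[OF iX] by measurable
qed

end

subsection \<open>Covers and the uniform deviation bound\<close>

lemma normed_function_spaceD:
  assumes "normed_function_space \<Q> V nrm" "f \<in> V"
  shows "g \<in> V \<Longrightarrow> (\<lambda>q. f q + g q) \<in> V" "(\<lambda>q. c *\<^sub>R f q) \<in> V"
    and "nrm (\<lambda>q. c *\<^sub>R f q) = \<bar>c\<bar> * nrm f" "g \<in> V \<Longrightarrow> nrm (\<lambda>q. f q + g q) \<le> nrm f + nrm g"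
  using assms by (auto simp: normed_function_space_def)

lemma function_space_diff:
  assumes "normed_function_space \<Q> V nrm" "f \<in> V" "g \<in> V"
  shows "(\<lambda>q. f q - g q) \<in> V"
  using normed_function_spaceD(1)[OF assms(1,2) normed_function_spaceD(2)[OF assms(1,3), of "-1"]] by simp

lemma nrm_triangle:
  assumes "normed_function_space \<Q> V nrm" "f \<in> V" "g \<in> V" "h \<in> V"
  shows "nrm (\<lambda>q. f q - h q) \<le> nrm (\<lambda>q. f q - g q) + nrm (\<lambda>q. g q - h q)"
  using normed_function_spaceD(4)[OF assms(1) function_space_diff[OF assms(1,2,3)] function_space_diff[OF assms(1,3,4)]]
  by simp

lemma nrm_minus_commute:
  assumes "normed_function_space \<Q> V nrm" "f \<in> V" "g \<in> V"
  shows "nrm (\<lambda>q. f q - g q) = nrm (\<lambda>q. g q - f q)"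
  using normed_function_spaceD(3)[OF assms(1) function_space_diff[OF assms(1,3,2)], of "-1"] by simp

lemma covering_number_attained:
  assumes "covering_number V nrm \<epsilon> F < \<infinity>"
  shows "\<exists>c. is_cover V nrm \<epsilon> F (the_enat (covering_number V nrm \<epsilon> F)) c"
proof -
  let ?S = "{enat N | N. \<exists>c. is_cover V nrm \<epsilon> F N c}"
  have ne: "?S \<noteq> {}"
  proof
    assume "?S = {}"
    with assms show False unfolding covering_number_def by (simp only: Inf_empty top_enat_def)
  qed
  then have "Inf ?S \<in> ?S" unfolding Inf_enat_def by (simp only: if_False) (meson LeastI_ex ex_in_conv)
  then show ?thesis unfolding covering_number_def by auto
qed

text \<open>Cover centres may lie outside the class, where no Lipschitz bound is available.\<close>

lemma internal_cover:
  assumes V: "normed_function_space \<Q> V nrm" "F \<subseteq> V" and fin: "covering_number V nrm \<epsilon> F < \<infinity>"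
  shows "\<exists>C\<subseteq>F. finite C \<and> card C \<le> the_enat (covering_number V nrm \<epsilon> F) \<and>
    (\<forall>f\<in>F. \<exists>g\<in>C. nrm (\<lambda>q. f q - g q) \<le> 2 * \<epsilon>)"
proof -
  define N where "N = the_enat (covering_number V nrm \<epsilon> F)"
  obtain c where c: "is_cover V nrm \<epsilon> F N c" using covering_number_attained[OF fin] by (auto simp: N_def)
  define h where "h i = (SOME f. f \<in> F \<and> nrm (\<lambda>q. c i q - f q) \<le> \<epsilon>)" for i
  \<comment> \<open>Centres whose ball misses \<open>F\<close> are dropped. Every other centre is
    replaced by a member of \<open>F\<close> in its ball, which doubles the radius.\<close>
  define J where "J = {i \<in> {1..N}. \<exists>f. f \<in> F \<and> nrm (\<lambda>q. c i q - f q) \<le> \<epsilon>}"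
  have h: "h i \<in> F" "nrm (\<lambda>q. c i q - h i q) \<le> \<epsilon>" if "i \<in> J" for i
    using someI_ex[of "\<lambda>f. f \<in> F \<and> nrm (\<lambda>q. c i q - f q) \<le> \<epsilon>"] that by (auto simp: J_def h_def)
  have "finite J" "card J \<le> N" using card_mono[of "{1..N}" J] by (simp_all add: J_def subset_iff)
  then have "finite (h ` J)" "card (h ` J) \<le> N" using card_image_le[of J h] by auto
  moreover have "\<exists>g\<in>h ` J. nrm (\<lambda>q. f q - g q) \<le> 2 * \<epsilon>" if f: "f \<in> F" for f
  proof -
    obtain i where i: "i \<in> {1..N}" "nrm (\<lambda>q. c i q - f q) \<le> \<epsilon>" using c f by (auto simp: is_cover_def)
    then have iJ: "i \<in> J" using f by (auto simp: J_def)
    have ciV: "c i \<in> V" using c i by (auto simp: is_cover_def)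
    have "f \<in> V" "h i \<in> V" using h(1)[OF iJ] f V by auto
    then have "nrm (\<lambda>q. f q - h i q) \<le> nrm (\<lambda>q. f q - c i q) + nrm (\<lambda>q. c i q - h i q)"
      using nrm_triangle[OF V(1) _ ciV] by blast
    also have "nrm (\<lambda>q. f q - c i q) = nrm (\<lambda>q. c i q - f q)"
      using nrm_minus_commute[OF V(1) _ ciV] \<open>f \<in> V\<close> by blast
    finally show ?thesis using i(2) h(2)[OF iJ] iJ by (intro bexI[of _ "h i"]) auto
  qed
  ultimately show ?thesis using h(1) unfolding N_def by (intro exI[of _ "h ` J"]) auto
qed

text \<open>The class may be uncountable, and a supremum over it need not be measurable.
  Approximation uniform in the outcome makes it equal to the supremum over the countable set
  \<open>D\<close>.\<close>

lemma SUP_measurable_of_dense: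
  fixes X :: "'f \<Rightarrow> 'w \<Rightarrow> real"
  assumes X: "\<And>f. f \<in> F \<Longrightarrow> X f \<in> borel_measurable M" and D: "countable D" "D \<subseteq> F"
    and dense: "\<And>f \<delta>. f \<in> F \<Longrightarrow> 0 < \<delta> \<Longrightarrow> \<exists>g\<in>D. \<forall>\<omega>\<in>space M. \<bar>X f \<omega> - X g \<omega>\<bar> \<le> \<delta>"
  shows "(\<lambda>\<omega>. SUP f\<in>F. ennreal \<bar>X f \<omega>\<bar>) \<in> borel_measurable M"
proof -
  have "(SUP f\<in>F. ennreal \<bar>X f \<omega>\<bar>) = (SUP f\<in>D. ennreal \<bar>X f \<omega>\<bar>)" if \<omega>: "\<omega> \<in> space M" for \<omega>
  proof (rule antisym)
    show "(SUP f\<in>D. ennreal \<bar>X f \<omega>\<bar>) \<le> (SUP f\<in>F. ennreal \<bar>X f \<omega>\<bar>)" by (rule SUP_subset_mono[OF D(2)]) simp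
    show "(SUP f\<in>F. ennreal \<bar>X f \<omega>\<bar>) \<le> (SUP f\<in>D. ennreal \<bar>X f \<omega>\<bar>)"
    proof (rule SUP_least, rule ennreal_le_epsilon)
      fix f e assume f: "f \<in> F" and e: "0 < (e :: real)"
      obtain g where g: "g \<in> D" "\<bar>X f \<omega> - X g \<omega>\<bar> \<le> e" using dense[OF f e] \<omega> by blast
      have "ennreal \<bar>X f \<omega>\<bar> \<le> ennreal (\<bar>X g \<omega>\<bar> + e)" using g(2) by (intro ennreal_leI) linarith
      also have "\<dots> = ennreal \<bar>X g \<omega>\<bar> + ennreal e" using e by (intro ennreal_plus) auto
      also have "\<dots> \<le> (SUP f\<in>D. ennreal \<bar>X f \<omega>\<bar>) + ennreal e" using g(1) by (intro add_right_mono SUP_upper)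
      finally show "ennreal \<bar>X f \<omega>\<bar> \<le> (SUP f\<in>D. ennreal \<bar>X f \<omega>\<bar>) + ennreal e" .
    qed
  qed
  moreover have "(\<lambda>\<omega>. SUP f\<in>D. ennreal \<bar>X f \<omega>\<bar>) \<in> borel_measurable M"
    using X D by (intro borel_measurable_SUP) auto
  ultimately show ?thesis by (subst measurable_cong) auto
qed

lemma (in prob_space) expectation_diff_le:
  assumes "u \<in> borel_measurable M" "v \<in> borel_measurable M"
    and "\<And>x. x \<in> space M \<Longrightarrow> \<bar>u x\<bar> \<le> b" "\<And>x. x \<in> space M \<Longrightarrow> \<bar>v x\<bar> \<le> b"
    and d: "\<And>x. x \<in> space M \<Longrightarrow> \<bar>u x - v x\<bar> \<le> d"
  shows "\<bar>expectation u - expectation v\<bar> \<le> (d::real)"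
proof -
  have int: "integrable M u" "integrable M v"
    by (rule integrable_const_bound[where B=b]; use assms in \<open>auto intro!: AE_I2\<close>)+
  have "\<bar>expectation (\<lambda>x. u x - v x)\<bar> \<le> expectation (\<lambda>x. \<bar>u x - v x\<bar>)" by (rule integral_abs_bound)
  also have "\<dots> \<le> d" using int d by (intro integral_le_const) (auto intro!: AE_I2)
  finally show ?thesis using int by simp
qed

lemma expected_surrogate_diff_le:
  fixes \<phi> :: "'a \<Rightarrow> 's::topological_space \<Rightarrow> real"
  assumes struct: "measurable_structure MY s" and cont: "\<And>\<alpha>. continuous_on UNIV (\<phi> \<alpha>)"
    and \<nu>: "prob_space \<nu>" "sets \<nu> = sets MY" and k: "1 \<le> k"
    and b: "\<And>x. 0 \<le> \<phi> \<alpha> x \<and> \<phi> \<alpha> x \<le> b" "\<And>x. 0 \<le> \<phi> \<alpha>' x \<and> \<phi> \<alpha>' x \<le> b"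
    and d: "\<And>x. \<bar>\<phi> \<alpha> x - \<phi> \<alpha>' x\<bar> \<le> d"
  shows "\<bar>expected_surrogate \<phi> s \<nu> k \<alpha> - expected_surrogate \<phi> s \<nu> k \<alpha>'\<bar> \<le> d"
proof -
  interpret prob_space "Pi\<^sub>M {..<k} (\<lambda>_. \<nu>)" by (intro prob_space_PiM \<nu>)
  have s: "(\<lambda>y. s (map y [0..<k])) \<in> measurable (Pi\<^sub>M {..<k} (\<lambda>_. \<nu>)) borel"
    using struct k sets_PiM_cong[OF refl, of "{..<k}" "\<lambda>_. \<nu>" "\<lambda>_. MY"] \<nu>(2)
    by (simp add: measurable_structure_def cong: measurable_cong_sets)
  have m: "(\<lambda>y. \<phi> \<gamma> (s (map y [0..<k]))) \<in> borel_measurable (Pi\<^sub>M {..<k} (\<lambda>_. \<nu>))" for \<gamma>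
    by (rule measurable_compose[OF s borel_measurable_continuous_onI[OF cont]])
  show ?thesis unfolding expected_surrogate_def
    by (rule expectation_diff_le[where b=b, OF m m]) (use b d in \<open>auto simp: abs_le_iff intro: order_trans\<close>)
qed

lemma block_average_diff_le:
  assumes "finite I" and d: "\<And>x. \<bar>\<phi> \<alpha> x - \<phi> \<alpha>' x\<bar> \<le> d"
  shows "\<bar>block_average \<phi> s k ys I \<alpha> - block_average \<phi> s k ys I \<alpha>'\<bar> \<le> d"
proof (cases "k \<le> card I")
  case True
  let ?K = "{J. J \<subseteq> I \<and> card J = k}"
  have c: "real (card I choose k) > 0" "card ?K = card I choose k"
    using True n_subsets[OF assms(1)] by auto
  have "\<bar>\<Sum>J\<in>?K. \<phi> \<alpha> (s (map ys (sorted_list_of_set J))) - \<phi> \<alpha>' (s (map ys (sorted_list_of_set J)))\<bar> \<le> (\<Sum>J\<in>?K. d)"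
    by (rule order_trans[OF sum_abs], rule sum_mono) (rule d)
  then have "\<bar>(\<Sum>J\<in>?K. \<phi> \<alpha> (s (map ys (sorted_list_of_set J)))) - (\<Sum>J\<in>?K. \<phi> \<alpha>' (s (map ys (sorted_list_of_set J))))\<bar> \<le> d * real (card I choose k)"
    using c(2) by (simp add: sum_subtractf mult.commute)
  then show ?thesis using True c(1)
    by (simp add: block_average_def diff_divide_distrib[symmetric] abs_divide pos_divide_le_eq)
next
  case False then show ?thesis using d by (simp add: block_average_def)
qed

lemma empirical_risk_diff_le:
  assumes n: "1 \<le> n" and d: "\<And>q x. q \<in> qs ` {1..n} \<Longrightarrow> \<bar>\<phi> (f q) x - \<phi> (g q) x\<bar> \<le> d"
  shows "\<bar>empirical_risk \<phi> s k n qs ys f - empirical_risk \<phi> s k n qs ys g\<bar> \<le> d"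
proof -
  let ?c = "\<lambda>q. real (card (block qs n q))" and ?a = "\<lambda>h q. block_average \<phi> s k ys (block qs n q) (h q)"
  have "\<bar>\<Sum>q\<in>qs ` {1..n}. ?c q * ?a f q - ?c q * ?a g q\<bar> \<le> (\<Sum>q\<in>qs ` {1..n}. ?c q * d)"
  proof (rule order_trans[OF sum_abs], rule sum_mono)
    fix q assume q: "q \<in> qs ` {1..n}"
    have "\<bar>?a f q - ?a g q\<bar> \<le> d" by (rule block_average_diff_le) (use d[OF q] in \<open>auto simp: block_def\<close>)
    then have "?c q * \<bar>?a f q - ?a g q\<bar> \<le> ?c q * d" by (intro mult_left_mono) auto
    then show "\<bar>?c q * ?a f q - ?c q * ?a g q\<bar> \<le> ?c q * d" by (simp add: right_diff_distrib[symmetric] abs_mult)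
  qed
  also have "\<dots> = real n * d" using sum_over_blocks[of "\<lambda>_. d" qs n] by simp
  finally have "\<bar>(\<Sum>q\<in>qs ` {1..n}. ?c q * ?a f q) - (\<Sum>q\<in>qs ` {1..n}. ?c q * ?a g q)\<bar> \<le> real n * d"
    by (simp add: sum_subtractf)
  moreover have "empirical_risk \<phi> s k n qs ys f - empirical_risk \<phi> s k n qs ys g = ((\<Sum>q\<in>qs ` {1..n}. ?c q * ?a f q) - (\<Sum>q\<in>qs ` {1..n}. ?c q * ?a g q)) / real n"
    by (simp add: empirical_risk_def diff_divide_distrib)
  ultimately show ?thesis using n by (simp add: abs_divide pos_divide_le_eq mult.commute)
qed

context query_sample
begin

text \<open>Read as expectations over the first query, both sums are averages with total weight 1,
  so a bound on the difference for each query passes to them unchanged.\<close>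

lemma mixture_diff_le:
  fixes u v :: "nat \<Rightarrow> real"
  assumes "\<And>q. q \<in> \<Q> \<Longrightarrow> \<bar>u q\<bar> \<le> b" "\<And>q. q \<in> \<Q> \<Longrightarrow> \<bar>v q\<bar> \<le> b" "\<And>q. q \<in> \<Q> \<Longrightarrow> \<bar>u q - v q\<bar> \<le> d"
  shows "\<bar>(\<Sum>\<^sub>\<infinity>q\<in>\<Q>. p q * u q) - (\<Sum>\<^sub>\<infinity>q\<in>\<Q>. p q * v q)\<bar> \<le> d"
proof -
  have "\<bar>expectation (\<lambda>\<omega>. u (Q 1 \<omega>)) - expectation (\<lambda>\<omega>. v (Q 1 \<omega>))\<bar> \<le> d"
    by (rule expectation_diff_le[where b=b]) (use assms Q_in function_Q_measurable in auto)
  then show ?thesis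
    using expectation_Q(1)[of 1 u b] expectation_Q(1)[of 1 v b] assms(1,2) by simp
qed

text \<open>For the cover element \<open>h\<close> near \<open>f\<close>, the total 4e splits as e/2
  for replacing \<open>f\<close> by \<open>h\<close> in the empirical risk, e for the judgments
  given the queries, e for the small blocks, e for the average over the queries, and e/2 for
  returning from \<open>h\<close> to \<open>f\<close> in the risk of order \<open>k\<close>. The
  factor 4 in the probability comes from two two-sided bounds per cover element. The conclusion
  speaks of an exceptional event, so it does not depend on measurability of the supremum.\<close>

lemma uniform_deviation:
  fixes \<phi> :: "'a \<Rightarrow> 's::topological_space \<Rightarrow> real"
  assumes pos: "\<Q> \<subseteq> {1..}" and struct: "measurable_structure MY s" and cont: "\<And>\<alpha>. continuous_on UNIV (\<phi> \<alpha>)"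
    and n: "1 \<le> n" and k: "1 \<le> k"
    and bound: "\<And>f q x. f \<in> F \<Longrightarrow> q \<in> \<Q> \<Longrightarrow> 0 \<le> \<phi> (f q) x \<and> \<phi> (f q) x \<le> b" and b: "0 < b" and e: "0 < e"
    and C: "C \<subseteq> F" "finite C" "card C \<le> N"
    and cover: "\<And>f. f \<in> F \<Longrightarrow> \<exists>g\<in>C. \<forall>q\<in>\<Q>. \<forall>x. \<bar>\<phi> (f q) x - \<phi> (g q) x\<bar> \<le> e / 2"
    and \<beta>: "0 < \<beta>" "0 \<le> K" and decay: "\<And>q. q \<in> \<Q> \<Longrightarrow> p q \<le> K * real q powr (- \<beta> - 1)"
    and m: "1 \<le> m" "b * (real k * real m / real n) \<le> e / 2"
  shows "\<exists>E\<in>sets M. prob E \<le> 4 * real N * exp (- (real n * e\<^sup>2 / (real k * b\<^sup>2))) + 2 * K * b * real m powr (- \<beta>) / (\<beta> * e) \<and>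
    (\<forall>\<omega>\<in>space M - E. \<forall>f\<in>F. \<bar>empirical_risk \<phi> s k n (\<lambda>i. Q i \<omega>) (\<lambda>i. Y i \<omega>) f - order_risk \<Q> p \<phi> s \<kappa> k f\<bar> \<le> 4 * e)"
proof -
  define g where "g f q = expected_surrogate \<phi> s (\<kappa> q) k (f q)" for f q
  define emp where "emp f \<omega> = empirical_risk \<phi> s k n (\<lambda>i. Q i \<omega>) (\<lambda>i. Y i \<omega>) f" for f \<omega>
  define avg where "avg f \<omega> = (\<Sum>i\<in>{1..n}. g f (Q i \<omega>)) / real n" for f \<omega>
  define S where "S \<omega> = (\<Sum>i\<in>{1..n}. if m < Q i \<omega> then 1 else 0 :: real) / real n" for \<omega>
  define A where "A f = {\<omega> \<in> space M. e + b * sparse_fraction k n (\<lambda>i. Q i \<omega>) \<le> \<bar>emp f \<omega> - avg f \<omega>\<bar>}" for f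
  define A' where "A' f = {\<omega> \<in> space M. e \<le> \<bar>avg f \<omega> - order_risk \<Q> p \<phi> s \<kappa> k f\<bar>}" for f
  \<comment> \<open>Off this event \<open>b\<close> times the share of rare queries is below e/2;
    the other half of the allowance for small blocks comes from the assumption on
    \<open>m\<close>.\<close>
  define H where "H = {\<omega> \<in> space M. e / (2 * b) \<le> S \<omega>}"
  define r where "r = exp (- (real n * e\<^sup>2 / (real k * b\<^sup>2)))"
  have g: "g f q \<in> {0..b}" if "f \<in> F" "q \<in> \<Q>" for f q
    using expected_surrogate_bounds[of "\<kappa> q" \<phi> "f q" b s k, OF _ bound[OF that]] kernel[OF that(2)] by (auto simp: g_def)
  have A: "prob (A f) \<le> 2 * r" "A f \<in> sets M" if "f \<in> F" for f
    unfolding A_def emp_def avg_def g_def r_def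
    by (rule empirical_risk_deviation[where f=f and \<phi>=\<phi>, OF struct cont n k bound[OF that] b e]; assumption)+
  have avg_m: "avg f \<in> borel_measurable M" for f
    unfolding avg_def by (intro borel_measurable_divide borel_measurable_sum function_Q_measurable) auto
  have A': "prob (A' f) \<le> 2 * r" "A' f \<in> sets M" if f: "f \<in> F" for f
  proof -
    have "prob (A' f) \<le> 2 * exp (- (2 * real n * e\<^sup>2 / b\<^sup>2))"
      unfolding A'_def avg_def order_risk_def g_def[symmetric]
      by (rule query_average_deviation[OF n g[OF f] b e])
    \<comment> \<open>The query average concentrates faster; its rate is weakened to that of the
      judgments, using \<open>k \<ge> 1\<close>, so that one quantity \<open>r\<close> serves both
      events.\<close>
    also have "\<dots> \<le> 2 * r"
    proof -
      have "real n * e\<^sup>2 / (real k * b\<^sup>2) \<le> real n * e\<^sup>2 / (1 * b\<^sup>2)"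
        using k b by (intro divide_left_mono mult_right_mono) auto
      also have "\<dots> \<le> 2 * real n * e\<^sup>2 / b\<^sup>2" by (simp only: mult_1, intro divide_right_mono) auto
      finally show ?thesis by (simp add: r_def)
    qed
    finally show "prob (A' f) \<le> 2 * r" .
    show "A' f \<in> sets M" unfolding A'_def using avg_m by measurable
  qed
  have H: "prob H \<le> 2 * K * b * real m powr (- \<beta>) / (\<beta> * e)" "H \<in> sets M"
  proof -
    have "prob H \<le> K * real m powr (- \<beta>) / (\<beta> * (e / (2 * b)))"
      unfolding H_def S_def using b e by (intro many_large_queries[OF \<beta> decay m(1) n]) auto
    also have "\<dots> = 2 * K * b * real m powr (- \<beta>) / (\<beta> * e)" using b e \<beta> by (simp add: field_simps)
    finally show "prob H \<le> 2 * K * b * real m powr (- \<beta>) / (\<beta> * e)" .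
    show "H \<in> sets M" unfolding H_def S_def using b e by (intro many_large_queries[OF \<beta> decay m(1) n]) auto
  qed
  have CF: "f \<in> F" if "f \<in> C" for f using C that by auto
  have B: "prob (\<Union>f\<in>C. A f \<union> A' f) \<le> 4 * real N * r"
  proof -
    have "prob (\<Union>f\<in>C. A f \<union> A' f) \<le> (\<Sum>f\<in>C. prob (A f \<union> A' f))"
      using A(2)[OF CF] A'(2)[OF CF] by (intro finite_measure_subadditive_finite C) auto
    also have "\<dots> \<le> (\<Sum>f\<in>C. 4 * r)"
    proof (rule sum_mono)
      fix f assume "f \<in> C"
      note f = CF[OF this]
      show "prob (A f \<union> A' f) \<le> 4 * r"
        using measure_Un_le[OF A(2)[OF f] A'(2)[OF f]] A(1)[OF f] A'(1)[OF f] by linarith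
    qed
    also have "\<dots> \<le> 4 * real N * r" using C(3) by (simp add: r_def)
    finally show ?thesis .
  qed
  define E where "E = (\<Union>f\<in>C. A f \<union> A' f) \<union> H"
  have Em: "E \<in> sets M" unfolding E_def using A(2)[OF CF] A'(2)[OF CF] H(2) C(2) by (intro sets.Un sets.finite_UN) auto
  have "prob E \<le> prob (\<Union>f\<in>C. A f \<union> A' f) + prob H"
    unfolding E_def using A(2)[OF CF] A'(2)[OF CF] H(2) C(2) by (intro measure_Un_le sets.finite_UN) auto
  then have Ep: "prob E \<le> 4 * real N * r + 2 * K * b * real m powr (- \<beta>) / (\<beta> * e)" using B H(1) by linarith
  have "\<bar>emp f \<omega> - order_risk \<Q> p \<phi> s \<kappa> k f\<bar> \<le> 4 * e" if \<omega>: "\<omega> \<in> space M - E" and f: "f \<in> F" for \<omega> f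
  proof -
    obtain h where h: "h \<in> C" and d: "\<And>q x. q \<in> \<Q> \<Longrightarrow> \<bar>\<phi> (f q) x - \<phi> (h q) x\<bar> \<le> e / 2" using cover[OF f] by blast
    note hF = CF[OF h]
    have 1: "\<bar>emp f \<omega> - emp h \<omega>\<bar> \<le> e / 2"
      unfolding emp_def using \<omega> by (intro empirical_risk_diff_le[OF n] d) (auto intro: Q_in)
    have 2: "\<bar>order_risk \<Q> p \<phi> s \<kappa> k f - order_risk \<Q> p \<phi> s \<kappa> k h\<bar> \<le> e / 2"
      unfolding order_risk_def
    proof (rule mixture_diff_le[where b=b])
      show "\<bar>expected_surrogate \<phi> s (\<kappa> q) k (f q)\<bar> \<le> b" "\<bar>expected_surrogate \<phi> s (\<kappa> q) k (h q)\<bar> \<le> b"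
        if "q \<in> \<Q>" for q using g[OF f that] g[OF hF that] by (auto simp: g_def)
      show "\<bar>expected_surrogate \<phi> s (\<kappa> q) k (f q) - expected_surrogate \<phi> s (\<kappa> q) k (h q)\<bar> \<le> e / 2" if "q \<in> \<Q>" for q
        using kernel[OF that] by (intro expected_surrogate_diff_le[OF struct cont _ _ k bound[OF f that] bound[OF hF that] d[OF that]]) auto
    qed
    have 3: "\<bar>emp h \<omega> - avg h \<omega>\<bar> < e + b * sparse_fraction k n (\<lambda>i. Q i \<omega>)"
      and 4: "\<bar>avg h \<omega> - order_risk \<Q> p \<phi> s \<kappa> k h\<bar> < e" and 5: "S \<omega> < e / (2 * b)"
      using \<omega> h by (auto simp: E_def A_def A'_def H_def)
    have "sparse_fraction k n (\<lambda>i. Q i \<omega>) \<le> real k * real m / real n + S \<omega>"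
      unfolding S_def using \<omega> by (intro sparse_fraction_le[OF n _ pos]) auto
    then have "b * sparse_fraction k n (\<lambda>i. Q i \<omega>) \<le> b * (real k * real m / real n + S \<omega>)" using b by (intro mult_left_mono) auto
    also have "\<dots> \<le> e / 2 + b * S \<omega>" using m(2) by (simp add: distrib_left)
    also have "b * S \<omega> \<le> e / 2" using 5 b by (simp add: field_simps)
    finally show ?thesis using 1 2 3 4 by linarith
  qed
  then show ?thesis using Em Ep by (auto simp: r_def emp_def)
qed

end

subsection \<open>Consistency\<close>

lemma block_average_abs_le:
  assumes "finite I" "\<And>x. 0 \<le> \<phi> \<alpha> x \<and> \<phi> \<alpha> x \<le> b"
  shows "\<bar>block_average \<phi> s k ys I \<alpha>\<bar> \<le> b"
  using block_average_bounds[where \<phi>=\<phi> and \<alpha>=\<alpha> and b=b and I=I and s=s and k=k and ys=ys] assms by simp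

lemma empirical_risk_abs_le:
  assumes n: "1 \<le> n" and b: "\<And>q x. q \<in> qs ` {1..n} \<Longrightarrow> 0 \<le> \<phi> (f q) x \<and> \<phi> (f q) x \<le> b"
  shows "\<bar>empirical_risk \<phi> s k n qs ys f\<bar> \<le> b"
proof -
  let ?c = "\<lambda>q. real (card (block qs n q))" and ?a = "\<lambda>q. block_average \<phi> s k ys (block qs n q) (f q)"
  have "\<bar>\<Sum>q\<in>qs ` {1..n}. ?c q * ?a q\<bar> \<le> (\<Sum>q\<in>qs ` {1..n}. ?c q * b)"
  proof (rule order_trans[OF sum_abs], rule sum_mono)
    fix q assume q: "q \<in> qs ` {1..n}"
    have "\<bar>?a q\<bar> \<le> b" by (rule block_average_abs_le) (use b[OF q] in \<open>auto simp: block_def\<close>)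
    then show "\<bar>?c q * ?a q\<bar> \<le> ?c q * b" by (simp add: abs_mult mult_left_mono)
  qed
  also have "\<dots> = real n * b" using sum_over_blocks[of "\<lambda>_. b" qs n] by simp
  finally show ?thesis using n by (simp add: empirical_risk_def abs_mult abs_divide pos_divide_le_eq mult.commute)
qed

text \<open>The level is (A b)^(1/beta) rounded up, which makes the tail at most 1/(A b).
  Multiplying it by \<open>b\<close> produces the exponent (1+beta)/beta of the growth
  condition.\<close>

lemma truncation_level:
  fixes \<beta> A b e :: real
  assumes "0 < \<beta>" "0 < A" "0 < e" "e \<le> b"
  shows "\<exists>m::nat. 1 \<le> m \<and> real m powr (- \<beta>) \<le> 1 / (A * b) \<and>
    b * real m \<le> b powr ((1 + \<beta>) / \<beta>) * (A powr (1 / \<beta>) + e powr (- 1 / \<beta>))"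
proof -
  define r where "r = (A * b) powr (1 / \<beta>)"
  have b: "0 < b" and r: "0 < r" using assms by (auto simp: r_def)
  define m where "m = nat \<lceil>r\<rceil>"
  have rm: "r \<le> real m" unfolding m_def by linarith
  have mr: "real m \<le> r + 1" unfolding m_def using r by linarith
  have "1 \<le> m" using r rm by (cases m) auto
  moreover have "real m powr (- \<beta>) \<le> 1 / (A * b)"
  proof -
    have "real m powr (- \<beta>) \<le> r powr (- \<beta>)" using r rm assms by (intro powr_mono2') auto
    also have "\<dots> = (A * b) powr (-1)" using assms by (simp add: r_def powr_powr)
    also have "\<dots> = 1 / (A * b)" using assms b by (simp add: powr_minus_divide)
    finally show ?thesis .
  qed
  moreover have "b * real m \<le> b powr ((1 + \<beta>) / \<beta>) * (A powr (1 / \<beta>) + e powr (- 1 / \<beta>))"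
  proof -
    have p: "b powr ((1 + \<beta>) / \<beta>) = b * b powr (1 / \<beta>)"
      using assms b by (simp add: add_divide_distrib powr_add)
    have "e powr (1 / \<beta>) \<le> b powr (1 / \<beta>)" using assms by (intro powr_mono2) auto
    \<comment> \<open>Rounding up adds at most 1, and \<open>e \<le> b\<close> lets this 1 be
      absorbed into a multiple of \<open>b powr (1 / \<beta>)\<close>.\<close>
    then have "1 \<le> b powr (1 / \<beta>) * e powr (- 1 / \<beta>)"
      using assms by (simp add: powr_minus_divide field_simps)
    moreover have "r = b powr (1 / \<beta>) * A powr (1 / \<beta>)" using assms b by (simp add: r_def powr_mult)
    ultimately have "real m \<le> b powr (1 / \<beta>) * (A powr (1 / \<beta>) + e powr (- 1 / \<beta>))"
      using mr by (simp add: distrib_left)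
    then have "b * real m \<le> b * (b powr (1 / \<beta>) * (A powr (1 / \<beta>) + e powr (- 1 / \<beta>)))"
      using b by (intro mult_left_mono) auto
    then show ?thesis by (simp add: p mult.assoc)
  qed
  ultimately show ?thesis by blast
qed

text \<open>Squaring the assumption and using \<open>k \<le> k\<^sup>2\<close> shows that the
  exponent is at least (J+1) log N. One log N cancels the factor N of the union bound and leaves
  N^(-J), at most 2^(-J) because \<open>N \<ge> 2\<close>. The parameter \<open>J\<close> is free
  and sets the final probability.\<close>

lemma entropy_bound:
  fixes J B e :: real
  assumes N: "2 \<le> N" and k: "1 \<le> k" and n: "1 \<le> n" and B: "0 < B" and J: "0 \<le> J" and e: "0 < e"
    and le: "real k * B * sqrt (ln (real N)) \<le> e / sqrt (J + 1) * sqrt (real n)"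
  shows "real N * exp (- (real n * e\<^sup>2 / (real k * B\<^sup>2))) \<le> exp (- (J * ln 2))"
proof -
  have lnN: "ln 2 \<le> ln (real N)" using N by simp
  then have l0: "0 \<le> ln (real N)" using ln_gt_zero[of "2::real"] by linarith
  have "(real k * B * sqrt (ln (real N)))\<^sup>2 \<le> (e / sqrt (J + 1) * sqrt (real n))\<^sup>2"
    by (rule power_mono[OF le]) (use B l0 in auto)
  then have "(real k)\<^sup>2 * B\<^sup>2 * ln (real N) \<le> e\<^sup>2 / (J + 1) * real n"
    using l0 J by (simp add: power_mult_distrib power_divide)
  then have "(J + 1) * ln (real N) \<le> real n * e\<^sup>2 / ((real k)\<^sup>2 * B\<^sup>2)"
    using J k B by (simp add: field_simps)
  also have "\<dots> \<le> real n * e\<^sup>2 / (real k * B\<^sup>2)"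
    using k B by (intro divide_left_mono mult_right_mono) (auto simp: power2_eq_square)
  finally have "real N * exp (- (real n * e\<^sup>2 / (real k * B\<^sup>2))) \<le> real N * exp (- ((J + 1) * ln (real N)))"
    by (intro mult_left_mono) auto
  also have "\<dots> = exp (ln (real N)) * exp (- ((J + 1) * ln (real N)))" using N by simp
  also have "\<dots> = exp (- (J * ln (real N)))" by (simp add: exp_add[symmetric] algebra_simps)
  also have "\<dots> \<le> exp (- (J * ln 2))" using lnN J by (simp add: mult_left_mono)
  finally show ?thesis .
qed

text \<open>The map \<open>\<phi> \<alpha>\<close> is continuous and bounded, hence a test function
  for convergence in distribution. The change of variables is made for \<open>j \<ge> 1\<close>,
  where \<open>s\<close> is measurable, and the limit ignores \<open>j = 0\<close>.\<close>

lemma limit_expected_surrogate: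
  fixes \<phi> :: "'a \<Rightarrow> 's::topological_space \<Rightarrow> real"
  assumes struct: "measurable_structure MY s" and cont: "continuous_on UNIV (\<phi> \<alpha>)"
    and sets: "sets \<nu> = sets MY" and lim: "converges_in_distribution (structure_law s \<nu>) \<mu>"
    and b: "\<And>x. 0 \<le> \<phi> \<alpha> x \<and> \<phi> \<alpha> x \<le> b"
  shows "(\<lambda>j. expected_surrogate \<phi> s \<nu> j \<alpha>) \<longlonglongrightarrow> (\<integral>x. \<phi> \<alpha> x \<partial>\<mu>)"
proof -
  have "bounded (range (\<phi> \<alpha>))" by (rule boundedI[of _ b]) (use b in auto)
  then have l: "(\<lambda>j. \<integral>x. \<phi> \<alpha> x \<partial>structure_law s \<nu> j) \<longlonglongrightarrow> (\<integral>x. \<phi> \<alpha> x \<partial>\<mu>)"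
    using lim cont by (simp add: converges_in_distribution_def)
  have "(\<integral>x. \<phi> \<alpha> x \<partial>structure_law s \<nu> j) = expected_surrogate \<phi> s \<nu> j \<alpha>" if j: "1 \<le> j" for j
  proof -
    have "(\<lambda>y. s (map y [0..<j])) \<in> measurable (Pi\<^sub>M {..<j} (\<lambda>_. \<nu>)) borel"
      using struct j sets_PiM_cong[OF refl, of "{..<j}" "\<lambda>_. \<nu>" "\<lambda>_. MY"] sets
      by (simp add: measurable_structure_def cong: measurable_cong_sets)
    then show ?thesis unfolding structure_law_def expected_surrogate_def
      by (intro integral_distr borel_measurable_continuous_onI cont)
  qed
  then have "\<forall>\<^sub>F j in sequentially. (\<integral>x. \<phi> \<alpha> x \<partial>structure_law s \<nu> j) = expected_surrogate \<phi> s \<nu> j \<alpha>"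
    by (auto simp: eventually_sequentially)
  then show ?thesis using l by (rule tendsto_cong[THEN iffD1])
qed

theorem theorem4:
  fixes M :: "'w measure" and MY :: "'y measure"
    and \<Q> :: "nat set" and p :: "nat \<Rightarrow> real" and \<kappa> :: "nat \<Rightarrow> 'y measure"
    and Q :: "nat \<Rightarrow> 'w \<Rightarrow> nat" and Y :: "nat \<Rightarrow> 'w \<Rightarrow> 'y"
    and s :: "'y list \<Rightarrow> 's::topological_space" and \<mu> :: "nat \<Rightarrow> 's measure"
    and \<phi> :: "real ^ 'm \<Rightarrow> 's \<Rightarrow> real"
    and V :: "(nat \<Rightarrow> real ^ 'm) set" and nrm :: "(nat \<Rightarrow> real ^ 'm) \<Rightarrow> real"
    and F :: "nat \<Rightarrow> (nat \<Rightarrow> real ^ 'm) set"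
    and k :: "nat \<Rightarrow> nat" and B L :: "nat \<Rightarrow> real" and \<beta> K\<^sub>1 :: real
  assumes queries: "\<Q> \<subseteq> {1..}"
    and data: "iid_query_judgments M \<Q> MY p \<kappa> Q Y"
    and p_nonincreasing: "\<And>q q'. q \<in> \<Q> \<Longrightarrow> q' \<in> \<Q> \<Longrightarrow> q \<le> q' \<Longrightarrow> p q' \<le> p q"
    and struct: "measurable_structure MY s"
    and limit_law: "\<And>q. q \<in> \<Q> \<Longrightarrow> prob_space (\<mu> q) \<and> sets (\<mu> q) = sets borel"
    and struct_limit:
      "\<And>q. q \<in> \<Q> \<Longrightarrow> converges_in_distribution (structure_law s (\<kappa> q)) (\<mu> q)"
    and surrogate_nonneg: "\<And>\<alpha> x. 0 \<le> \<phi> \<alpha> x"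
    and surrogate_cont: "\<And>\<alpha>. continuous_on UNIV (\<phi> \<alpha>)"
    and function_space: "normed_function_space \<Q> V nrm"
    and classes: "\<And>n. 1 \<le> n \<Longrightarrow> F n \<subseteq> V"
    and classes_mono: "mono_on {1..} F"
    and orders: "\<And>n. 1 \<le> n \<Longrightarrow> 1 \<le> k n"
    and D: "\<beta> > 0" "K\<^sub>1 > 0" "\<And>q. q \<in> \<Q> \<Longrightarrow> p q \<le> K\<^sub>1 * real q powr (- \<beta> - 1)"
    and L_pos: "\<And>n. 1 \<le> n \<Longrightarrow> 0 < L n"
    and E_bound: "\<And>n x f q. 1 \<le> n \<Longrightarrow> f \<in> F n \<Longrightarrow> q \<in> \<Q> \<Longrightarrow> 0 \<le> \<phi> (f q) x \<and> \<phi> (f q) x \<le> B n"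
    and E_lipschitz: "\<And>n x f\<^sub>1 f\<^sub>2 q. 1 \<le> n \<Longrightarrow> f\<^sub>1 \<in> F n \<Longrightarrow> f\<^sub>2 \<in> F n \<Longrightarrow> q \<in> \<Q> \<Longrightarrow>
        \<bar>\<phi> (f\<^sub>1 q) x - \<phi> (f\<^sub>2 q) x\<bar> \<le> L n * nrm (\<lambda>r. f\<^sub>1 r - f\<^sub>2 r)"
    and F_covering: "\<And>n \<epsilon>. 1 \<le> n \<Longrightarrow> \<epsilon> > 0 \<Longrightarrow> covering_number V nrm \<epsilon> (F n) < \<infinity>"
    and I_or_I':
      "(\<exists>\<rho>>0. \<exists>C.
          (\<forall>q\<in>\<Q>. \<forall>n\<ge>1. \<forall>j\<ge>1. \<forall>f\<in>F n.
             \<bar>expected_surrogate \<phi> s (\<kappa> q) j (f q) - lim (\<lambda>j'. expected_surrogate \<phi> s (\<kappa> q) j' (f q))\<bar>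
               \<le> C * B n * real j powr (- \<rho>)) \<and>
          B \<in> o(\<lambda>n. real (k n) powr \<rho>))
       \<or>
       (\<exists>\<epsilon> N c.
          (\<forall>n\<ge>1. 0 \<le> \<epsilon> n \<and> covering_number V nrm (\<epsilon> n) (F n) = enat (N n) \<and>
             is_cover V nrm (\<epsilon> n) (F n) (N n) (c n)) \<and>
          (\<lambda>n. (SUP i\<in>{1..N n}. INF f\<in>cover_set nrm (\<epsilon> n) (F n) (c n i).
                   ennreal \<bar>asymptotic_risk \<Q> p \<phi> \<mu> f - order_risk \<Q> p \<phi> s \<kappa> (k n) f\<bar>)
                + ennreal (2 * L n * \<epsilon> n)) \<longlonglongrightarrow> 0)"
    and II_bias: "(\<lambda>n. real (k n) * B n powr ((1 + \<beta>) / \<beta>)) \<in> o(\<lambda>n. real n)"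
    and II_entropy: "\<And>\<epsilon>. \<epsilon> > 0 \<Longrightarrow>
        (\<lambda>n. real (k n) * B n * sqrt (ln (real (the_enat (covering_number V nrm (\<epsilon> / (4 * L n)) (F n))))))
          \<in> o(\<lambda>n. sqrt (real n))"
  shows "converges_to_0_in_probability M
           (\<lambda>n \<omega>. SUP f\<in>F n. ennreal \<bar>empirical_risk \<phi> s (k n) n (\<lambda>i. Q i \<omega>) (\<lambda>i. Y i \<omega>) f
                                       - asymptotic_risk \<Q> p \<phi> \<mu> f\<bar>)"
proof -
  interpret prob_space M using data by (simp add: iid_query_judgments_def)
  interpret query_sample M \<Q> MY p \<kappa> Q Y by unfold_locales (rule data)
  define emp where "emp n f \<omega> = empirical_risk \<phi> s (k n) n (\<lambda>i. Q i \<omega>) (\<lambda>i. Y i \<omega>) f" for n f \<omega>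
  define R where "R f = asymptotic_risk \<Q> p \<phi> \<mu> f" for f
  define Rk where "Rk j f = order_risk \<Q> p \<phi> s \<kappa> j f" for j f
  define Z where "Z n \<omega> = (SUP f\<in>F n. ennreal \<bar>emp n f \<omega> - R f\<bar>)" for n \<omega>

  obtain q0 where q0: "q0 \<in> \<Q>" using Q_in[of 1] not_empty by blast
  have es_bound: "\<bar>expected_surrogate \<phi> s (\<kappa> q) j (f q)\<bar> \<le> B n" if "1 \<le> n" "f \<in> F n" "q \<in> \<Q>" for n f q j
    using expected_surrogate_bounds[of "\<kappa> q" \<phi> "f q" "B n" s j, OF _ E_bound[OF that]] kernel[OF that(3)] by auto
  \<comment> \<open>Estimates for the limiting laws, here and in \<open>R_diff\<close>, are obtained
    from those at finite order by letting the order tend to infinity.\<close>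
  have lim_bound: "\<bar>\<integral>x. \<phi> (f q) x \<partial>\<mu> q\<bar> \<le> B n" if f: "1 \<le> n" "f \<in> F n" "q \<in> \<Q>" for n f q
  proof (rule LIMSEQ_le_const2)
    show "(\<lambda>j. \<bar>expected_surrogate \<phi> s (\<kappa> q) j (f q)\<bar>) \<longlonglongrightarrow> \<bar>\<integral>x. \<phi> (f q) x \<partial>\<mu> q\<bar>"
      using kernel[OF f(3)] E_bound[OF f]
      by (intro tendsto_rabs limit_expected_surrogate[OF struct surrogate_cont _ struct_limit[OF f(3)]]) auto
    show "\<exists>j0. \<forall>j\<ge>j0. \<bar>expected_surrogate \<phi> s (\<kappa> q) j (f q)\<bar> \<le> B n" using es_bound[OF f] by blast
  qed
  have es_diff: "\<bar>expected_surrogate \<phi> s (\<kappa> q) j (f q) - expected_surrogate \<phi> s (\<kappa> q) j (g q)\<bar> \<le> L n * nrm (\<lambda>r. f r - g r)"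
    if "1 \<le> n" "f \<in> F n" "g \<in> F n" "q \<in> \<Q>" "1 \<le> j" for n f g q j
    using kernel[OF that(4)] E_bound[OF that(1,2,4)] E_bound[OF that(1,3,4)] E_lipschitz[OF that(1-4)]
    by (intro expected_surrogate_diff_le[where b="B n" and \<phi>=\<phi>, OF struct surrogate_cont _ _ that(5)]) auto
  have R_diff: "\<bar>R f - R g\<bar> \<le> L n * nrm (\<lambda>r. f r - g r)" if f: "1 \<le> n" "f \<in> F n" "g \<in> F n" for n f g
    unfolding R_def asymptotic_risk_def
  proof (rule mixture_diff_le[where b="B n"])
    fix q assume q: "q \<in> \<Q>"
    show "\<bar>\<integral>x. \<phi> (f q) x \<partial>\<mu> q\<bar> \<le> B n" "\<bar>\<integral>x. \<phi> (g q) x \<partial>\<mu> q\<bar> \<le> B n" using lim_bound f q by auto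
    have "(\<lambda>j. \<bar>expected_surrogate \<phi> s (\<kappa> q) j (f q) - expected_surrogate \<phi> s (\<kappa> q) j (g q)\<bar>) \<longlonglongrightarrow>
        \<bar>(\<integral>x. \<phi> (f q) x \<partial>\<mu> q) - (\<integral>x. \<phi> (g q) x \<partial>\<mu> q)\<bar>"
      using kernel[OF q] E_bound[OF f(1,2) q] E_bound[OF f(1,3) q]
      by (intro tendsto_rabs tendsto_diff limit_expected_surrogate[OF struct surrogate_cont _ struct_limit[OF q]]) auto
    then show "\<bar>(\<integral>x. \<phi> (f q) x \<partial>\<mu> q) - (\<integral>x. \<phi> (g q) x \<partial>\<mu> q)\<bar> \<le> L n * nrm (\<lambda>r. f r - g r)"
      by (rule LIMSEQ_le_const2) (use es_diff[OF f q] in blast)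
  qed
  have Rk_diff: "\<bar>Rk j f - Rk j g\<bar> \<le> L n * nrm (\<lambda>r. f r - g r)" if f: "1 \<le> n" "f \<in> F n" "g \<in> F n" "1 \<le> j" for n f g j
    unfolding Rk_def order_risk_def
    by (rule mixture_diff_le[where b="B n"]) (use es_bound es_diff f in auto)
  have emp_diff: "\<bar>emp n f \<omega> - emp n g \<omega>\<bar> \<le> L n * nrm (\<lambda>r. f r - g r)"
    if "1 \<le> n" "f \<in> F n" "g \<in> F n" "\<omega> \<in> space M" for n f g \<omega>
    unfolding emp_def by (rule empirical_risk_diff_le[OF that(1)]) (use that Q_in E_lipschitz in auto)

  \<comment> \<open>Both alternatives (I) and (I') enter the proof only through this uniform
    bound.\<close>
  have bias: "\<forall>\<^sub>F n in sequentially. \<forall>f\<in>F n. \<bar>Rk (k n) f - R f\<bar> \<le> e" if e: "0 < e" for e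
    using I_or_I'
  proof (elim disjE exE conjE)
    fix \<rho> C :: real
    assume \<rho>: "0 < \<rho>" and rate: "\<forall>q\<in>\<Q>. \<forall>n\<ge>1. \<forall>j\<ge>1. \<forall>f\<in>F n.
             \<bar>expected_surrogate \<phi> s (\<kappa> q) j (f q) - lim (\<lambda>j'. expected_surrogate \<phi> s (\<kappa> q) j' (f q))\<bar>
               \<le> C * B n * real j powr (- \<rho>)"
      and o: "B \<in> o(\<lambda>n. real (k n) powr \<rho>)"
    \<comment> \<open>The constant \<open>C\<close> may be zero or negative; dividing by
      \<open>\<bar>C\<bar> + 1\<close> covers all cases.\<close>
    have "\<forall>\<^sub>F n in sequentially. norm (B n) \<le> e / (\<bar>C\<bar> + 1) * norm (real (k n) powr \<rho>)"
      using e by (intro landau_o.smallD[OF o]) auto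
    then show "\<forall>\<^sub>F n in sequentially. \<forall>f\<in>F n. \<bar>Rk (k n) f - R f\<bar> \<le> e"
      using eventually_ge_at_top[of 1]
    proof eventually_elim
      case (elim n)
      have kn: "0 < real (k n) powr \<rho>" using orders[OF elim(2)] by simp
      have "\<bar>C\<bar> * \<bar>B n\<bar> \<le> \<bar>C\<bar> * (e / (\<bar>C\<bar> + 1) * real (k n) powr \<rho>)"
        using elim(1) kn by (intro mult_left_mono) auto
      also have "\<dots> = (\<bar>C\<bar> / (\<bar>C\<bar> + 1)) * (e * real (k n) powr \<rho>)" by simp
      also have "\<dots> \<le> 1 * (e * real (k n) powr \<rho>)" using e kn by (intro mult_right_mono) (auto simp: divide_le_eq)
      finally have "\<bar>C\<bar> * \<bar>B n\<bar> / real (k n) powr \<rho> \<le> e" using kn by (simp add: pos_divide_le_eq)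
      moreover have "C * B n / real (k n) powr \<rho> \<le> \<bar>C\<bar> * \<bar>B n\<bar> / real (k n) powr \<rho>"
        using kn by (intro divide_right_mono) (auto simp: abs_mult[symmetric])
      ultimately have small: "C * B n * real (k n) powr (- \<rho>) \<le> e"
        by (simp add: powr_minus_divide)
      show ?case
      proof
        fix f assume f: "f \<in> F n"
        show "\<bar>Rk (k n) f - R f\<bar> \<le> e"
          unfolding Rk_def R_def order_risk_def asymptotic_risk_def
        proof (rule mixture_diff_le[where b="B n"])
          fix q assume q: "q \<in> \<Q>"
          show "\<bar>expected_surrogate \<phi> s (\<kappa> q) (k n) (f q)\<bar> \<le> B n" "\<bar>\<integral>x. \<phi> (f q) x \<partial>\<mu> q\<bar> \<le> B n"
            using es_bound lim_bound elim(2) f q by auto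
          have "lim (\<lambda>j'. expected_surrogate \<phi> s (\<kappa> q) j' (f q)) = (\<integral>x. \<phi> (f q) x \<partial>\<mu> q)"
            using kernel[OF q] E_bound[OF elim(2) f q]
            by (intro limI limit_expected_surrogate[OF struct surrogate_cont _ struct_limit[OF q]]) auto
          then show "\<bar>expected_surrogate \<phi> s (\<kappa> q) (k n) (f q) - (\<integral>x. \<phi> (f q) x \<partial>\<mu> q)\<bar> \<le> e"
            using rate[rule_format, OF q elim(2) orders[OF elim(2)] f] small by simp
        qed
      qed
    qed
  next
    fix \<epsilon> N c
    assume cov: "\<forall>n\<ge>1. 0 \<le> \<epsilon> n \<and> covering_number V nrm (\<epsilon> n) (F n) = enat (N n) \<and>
             is_cover V nrm (\<epsilon> n) (F n) (N n) (c n)"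
      and lim: "(\<lambda>n. (SUP i\<in>{1..N n}. INF f\<in>cover_set nrm (\<epsilon> n) (F n) (c n i).
                   ennreal \<bar>asymptotic_risk \<Q> p \<phi> \<mu> f - order_risk \<Q> p \<phi> s \<kappa> (k n) f\<bar>)
                + ennreal (2 * L n * \<epsilon> n)) \<longlonglongrightarrow> 0"
    define T where "T n = (SUP i\<in>{1..N n}. INF f\<in>cover_set nrm (\<epsilon> n) (F n) (c n i). ennreal \<bar>R f - Rk (k n) f\<bar>)" for n
    \<comment> \<open>Three thirds: the bias at a good member \<open>g\<close> of the cover set of
      \<open>f\<close>, and the Lipschitz cost of passing between \<open>f\<close> and
      \<open>g\<close> once for \<open>R\<close> and once for \<open>Rk\<close>. As \<open>f\<close>
      and \<open>g\<close> are within twice the radius, each cost is at most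
      \<open>2 * L n * \<epsilon> n\<close>.\<close>
    have "\<forall>\<^sub>F n in sequentially. T n + ennreal (2 * L n * \<epsilon> n) < ennreal (e / 3)"
      using order_tendstoD(2)[OF lim, of "ennreal (e / 3)"] e by (simp add: T_def R_def Rk_def)
    then show "\<forall>\<^sub>F n in sequentially. \<forall>f\<in>F n. \<bar>Rk (k n) f - R f\<bar> \<le> e"
      using eventually_ge_at_top[of 1]
    proof eventually_elim
      case (elim n)
      have "0 \<le> 2 * L n * \<epsilon> n" using L_pos[OF elim(2)] cov elim(2) by simp
      moreover have "ennreal (2 * L n * \<epsilon> n) < ennreal (e / 3)"
        by (rule order.strict_trans1[OF _ elim(1)]) (simp add: add_increasing)
      ultimately have le: "2 * L n * \<epsilon> n \<le> e / 3" by (simp add: ennreal_less_iff)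
      have Tn: "T n < ennreal (e / 3)"
        by (rule order.strict_trans1[OF _ elim(1)]) (simp add: add_increasing2)
      show ?case
      proof
        fix f assume f: "f \<in> F n"
        have "is_cover V nrm (\<epsilon> n) (F n) (N n) (c n)" using cov elim(2) by blast
        then obtain i where i: "i \<in> {1..N n}" "nrm (\<lambda>q. c n i q - f q) \<le> \<epsilon> n" "c n i \<in> V"
          using f unfolding is_cover_def by blast
        have "(INF f\<in>cover_set nrm (\<epsilon> n) (F n) (c n i). ennreal \<bar>R f - Rk (k n) f\<bar>) \<le> T n"
          unfolding T_def using i(1) by (rule SUP_upper)
        \<comment> \<open>An empty cover set would have infinite infimum, so finiteness also
          guarantees that a suitable \<open>g\<close> exists.\<close>
        then have "(INF f\<in>cover_set nrm (\<epsilon> n) (F n) (c n i). ennreal \<bar>R f - Rk (k n) f\<bar>) < ennreal (e / 3)"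
          using Tn by (rule order.strict_trans1)
        then obtain g where g: "g \<in> cover_set nrm (\<epsilon> n) (F n) (c n i)" "ennreal \<bar>R g - Rk (k n) g\<bar> < ennreal (e / 3)"
          unfolding INF_less_iff by blast
        then have gF: "g \<in> F n" and gc: "nrm (\<lambda>q. c n i q - g q) \<le> \<epsilon> n" by (auto simp: cover_set_def)
        have V: "f \<in> V" "g \<in> V" using f gF classes[OF elim(2)] by auto
        have "nrm (\<lambda>q. f q - g q) \<le> nrm (\<lambda>q. f q - c n i q) + nrm (\<lambda>q. c n i q - g q)"
          by (rule nrm_triangle[OF function_space V(1) i(3) V(2)])
        also have "nrm (\<lambda>q. f q - c n i q) = nrm (\<lambda>q. c n i q - f q)"
          by (rule nrm_minus_commute[OF function_space V(1) i(3)])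
        finally have "nrm (\<lambda>q. f q - g q) \<le> 2 * \<epsilon> n" using i(2) gc by simp
        then have "L n * nrm (\<lambda>q. f q - g q) \<le> L n * (2 * \<epsilon> n)"
          using L_pos[OF elim(2)] by (intro mult_left_mono) auto
        then have Ln: "L n * nrm (\<lambda>q. f q - g q) \<le> e / 3"
          using le by (simp only: mult.left_commute[of "L n" 2] mult.assoc)
        have "\<bar>R g - Rk (k n) g\<bar> < e / 3" using g(2) by (simp add: ennreal_less_iff)
        then show "\<bar>Rk (k n) f - R f\<bar> \<le> e"
          using R_diff[OF elim(2) f gF] Rk_diff[OF elim(2) f gF orders[OF elim(2)]] Ln by linarith
      qed
    qed
  qed

  \<comment> \<open>The radius is that of the entropy condition. Moving the centres into the class
    doubles it, and the Lipschitz constant turns 2 e / (4 L) into e/2.\<close>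
  have cover: "\<exists>C\<subseteq>F n. finite C \<and> card C \<le> the_enat (covering_number V nrm (e / (4 * L n)) (F n)) \<and>
      (\<forall>f\<in>F n. \<exists>g\<in>C. L n * nrm (\<lambda>r. f r - g r) \<le> e / 2)" if n: "1 \<le> n" and e: "0 < e" for n e
  proof -
    have "e / (4 * L n) > 0" using e L_pos[OF n] by simp
    from internal_cover[OF function_space classes[OF n] F_covering[OF n this]] obtain C where
      C: "C \<subseteq> F n" "finite C" "card C \<le> the_enat (covering_number V nrm (e / (4 * L n)) (F n))"
      and c: "\<forall>f\<in>F n. \<exists>g\<in>C. nrm (\<lambda>q. f q - g q) \<le> 2 * (e / (4 * L n))" by blast
    have L: "L n * x \<le> e / 2" if "x \<le> 2 * (e / (4 * L n))" for x
      using mult_left_mono[OF that, of "L n"] L_pos[OF n] by simp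
    have "\<forall>f\<in>F n. \<exists>g\<in>C. L n * nrm (\<lambda>r. f r - g r) \<le> e / 2"
    proof
      fix f assume "f \<in> F n"
      then obtain g where "g \<in> C" "nrm (\<lambda>q. f q - g q) \<le> 2 * (e / (4 * L n))" by (rule bexE[OF bspec[OF c]])
      then show "\<exists>g\<in>C. L n * nrm (\<lambda>r. f r - g r) \<le> e / 2" using L by (intro bexI[of _ g])
    qed
    with C show ?thesis by (intro exI[of _ C] conjI)
  qed

  have Z_measurable: "Z n \<in> borel_measurable M" for n
  proof (cases "n = 0")
    case True
    \<comment> \<open>The notion of convergence asks for measurability at \<open>n = 0\<close> as
      well. The sample is then empty and the empirical risk vanishes, so \<open>Z 0\<close> is
      constant.\<close>
    have "Z n = (\<lambda>_. SUP f\<in>F 0. ennreal \<bar>R f\<bar>)"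
      by (rule ext) (simp add: True Z_def emp_def empirical_risk_def)
    then show ?thesis by simp
  next
    case False
    then have n: "1 \<le> n" by simp
    obtain C where C: "\<And>e. 0 < e \<Longrightarrow> C e \<subseteq> F n \<and> finite (C e) \<and> (\<forall>f\<in>F n. \<exists>g\<in>C e. L n * nrm (\<lambda>r. f r - g r) \<le> e / 2)"
      using cover[OF n] by metis
    \<comment> \<open>The union of finite internal covers at the scales 1/(j+1) is countable, and
      the Lipschitz bounds for both risks make it dense in the required uniform sense.\<close>
    show ?thesis unfolding Z_def
    proof (rule SUP_measurable_of_dense[where D="\<Union>j. C (1 / real (Suc j))"])
      show "(\<lambda>\<omega>. emp n f \<omega> - R f) \<in> borel_measurable M" for f
        unfolding emp_def
        by (intro borel_measurable_diff sample_empirical_risk_measurable[OF struct surrogate_cont orders[OF n]]) auto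
      have "countable (C (1 / real (Suc j)))" for j using C[of "1 / real (Suc j)"] by (simp add: countable_finite)
      then show "countable (\<Union>j. C (1 / real (Suc j)))" by (intro countable_UN) auto
      show "(\<Union>j. C (1 / real (Suc j))) \<subseteq> F n"
      proof (rule UN_least)
        show "C (1 / real (Suc j)) \<subseteq> F n" for j using C[of "1 / real (Suc j)"] by simp
      qed
      fix f \<delta> assume f: "f \<in> F n" and \<delta>: "0 < (\<delta> :: real)"
      obtain j where j: "1 / real (Suc j) < \<delta>" using reals_Archimedean[OF \<delta>] by (auto simp: inverse_eq_divide)
      obtain g where g: "g \<in> C (1 / real (Suc j))" "L n * nrm (\<lambda>r. f r - g r) \<le> 1 / real (Suc j) / 2"
        using C[of "1 / real (Suc j)"] f by auto
      have gF: "g \<in> F n" using g(1) C[of "1 / real (Suc j)"] by auto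
      have "L n * nrm (\<lambda>r. f r - g r) \<le> \<delta> / 2"
        by (rule order_trans[OF g(2) divide_right_mono]) (use j in auto)
      then have "\<bar>emp n f \<omega> - R f - (emp n g \<omega> - R g)\<bar> \<le> \<delta>" if "\<omega> \<in> space M" for \<omega>
        using emp_diff[OF n f gF that] R_diff[OF n f gF] by linarith
      then show "\<exists>g\<in>\<Union>j. C (1 / real (Suc j)). \<forall>\<omega>\<in>space M. \<bar>emp n f \<omega> - R f - (emp n g \<omega> - R g)\<bar> \<le> \<delta>"
        using g(1) by blast
    qed
  qed

  \<comment> \<open>The 5e consists of 4e from the deviation bound and e from the bias.\<close>
  have main: "\<forall>\<^sub>F n in sequentially. prob {\<omega> \<in> space M. ennreal (5 * e) < Z n \<omega>} \<le> \<delta>"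
    if e: "0 < e" and \<delta>: "0 < \<delta>" for e \<delta>
  proof (cases "\<exists>n0\<ge>1. F n0 \<noteq> {}")
    case False
    have "\<forall>\<^sub>F n in sequentially. 1 \<le> n" by (rule eventually_ge_at_top)
    then show ?thesis
    proof eventually_elim
      case (elim n)
      then have "Z n \<omega> = 0" for \<omega> using False by (simp add: Z_def bot_ennreal)
      then show ?case using \<delta> by simp
    qed
  next
    case True
    then obtain n0 f0 where n0: "1 \<le> n0" and f0: "f0 \<in> F n0" by blast
    \<comment> \<open>By monotonicity \<open>f0\<close> lies in all later classes; \<open>c1\<close>
      bounds every loss within \<open>e\<close> of one of its losses. The value \<open>l\<close>
      satisfies \<open>exp (- l) \<le> \<delta> / 8\<close>, so the factor 4 of the union bound
      yields \<open>\<delta> / 2\<close>, and \<open>J\<close> translates \<open>l\<close> to base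
      2. The constant \<open>A\<close> makes the rare-query term at most
      \<open>\<delta> / 2\<close>.\<close>
    define c1 where "c1 = B n0 + e"
    define l where "l = \<bar>ln (8 / \<delta>)\<bar>"
    define J where "J = l / ln 2"
    define A where "A = 4 * K\<^sub>1 / (\<beta> * e * \<delta>)"
    define \<gamma> where "\<gamma> = (1 + \<beta>) / \<beta>"
    define N where "N n = the_enat (covering_number V nrm (e / (4 * L n)) (F n))" for n
    have J: "0 \<le> J" and l: "0 \<le> l" by (simp_all add: J_def l_def)
    have Apos: "0 < A" using D e \<delta> by (simp add: A_def)
    have exp_l: "exp (- l) \<le> \<delta> / 8"
    proof -
      have "exp (- l) \<le> exp (- ln (8 / \<delta>))" unfolding l_def by simp
      also have "\<dots> = \<delta> / 8" using \<delta> by (simp add: exp_minus)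
      finally show ?thesis .
    qed
    have "0 \<le> B n0" using E_bound[OF n0 f0 q0] by (meson order_trans)
    then have c1: "e \<le> c1" "0 < c1" using e by (auto simp: c1_def)
    \<comment> \<open>Both constants are used with the first half of (II): \<open>?c\<close> makes
      the mass of small blocks with queries up to \<open>m\<close> cost at most e/2, and
      \<open>?c'\<close> provides the exponential rate when the covering number is 1.\<close>
    let ?c = "e / 2 / (A powr (1 / \<beta>) + e powr (- 1 / \<beta>))"
    let ?c' = "e powr \<gamma> * e\<^sup>2 / (c1\<^sup>2 * (l + 1))"
    have "0 < A powr (1 / \<beta>) + e powr (- 1 / \<beta>)" using Apos e by (simp add: add_pos_pos)
    then have cpos: "0 < ?c" "0 < ?c'" using e c1 l by (auto intro!: divide_pos_pos mult_pos_pos)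
    have ev1: "\<forall>\<^sub>F n in sequentially. norm (real (k n) * B n powr \<gamma>) \<le> ?c * norm (real n)"
      using II_bias cpos(1) unfolding \<gamma>_def by (rule landau_o.smallD)
    have ev2: "\<forall>\<^sub>F n in sequentially. norm (real (k n) * B n powr \<gamma>) \<le> ?c' * norm (real n)"
      using II_bias cpos(2) unfolding \<gamma>_def by (rule landau_o.smallD)
    have ev3: "\<forall>\<^sub>F n in sequentially. norm (real (k n) * B n * sqrt (ln (real (N n)))) \<le> e / sqrt (J + 1) * norm (sqrt (real n))"
      unfolding N_def by (rule landau_o.smallD[OF II_entropy[OF e]]) (use e J in simp)
    show ?thesis
      using bias[OF e] ev1 ev2 ev3 eventually_ge_at_top[of n0]
    proof eventually_elim
      case (elim n)
      note bias_n = elim(1)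
      have n: "1 \<le> n" using elim(5) n0 by simp
      note kn = orders[OF n]
      have "F n0 \<subseteq> F n" using classes_mono n0 n elim(5) by (auto simp: mono_on_def)
      then have f0n: "f0 \<in> F n" using f0 by auto
      have Zle: "Z n \<omega> \<le> ennreal (5 * e)" if "\<And>f. f \<in> F n \<Longrightarrow> \<bar>emp n f \<omega> - Rk (k n) f\<bar> \<le> 4 * e" for \<omega>
        unfolding Z_def
      proof (rule SUP_least, rule ennreal_leI)
        fix f assume "f \<in> F n"
        then show "\<bar>emp n f \<omega> - R f\<bar> \<le> 5 * e" using that[of f] bias_n[rule_format, of f] by linarith
      qed
      show ?case
      \<comment> \<open>For \<open>B n \<le> e\<close> both risks lie between \<open>- e\<close> and
        \<open>e\<close>, so the bad event is empty. Otherwise \<open>B n\<close> is bounded below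
        by \<open>e\<close>, as the choice of \<open>m\<close> requires.\<close>
      proof (cases "B n \<le> e")
        case True
        have "Z n \<omega> \<le> ennreal (5 * e)" if \<omega>: "\<omega> \<in> space M" for \<omega>
        proof (rule Zle)
          fix f assume f: "f \<in> F n"
          have "\<bar>emp n f \<omega>\<bar> \<le> B n" unfolding emp_def
            by (rule empirical_risk_abs_le[OF n]) (use E_bound[OF n f] Q_in \<omega> in auto)
          \<comment> \<open>Comparison with the zero mixture turns the difference bound into a bound
            on \<open>Rk\<close> itself.\<close>
          moreover have "\<bar>Rk (k n) f - (\<Sum>\<^sub>\<infinity>q\<in>\<Q>. p q * 0)\<bar> \<le> B n" unfolding Rk_def order_risk_def
            by (rule mixture_diff_le[where b="B n"]) (use es_bound[OF n f] in \<open>auto intro: order_trans[OF abs_ge_zero]\<close>)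
          ultimately show "\<bar>emp n f \<omega> - Rk (k n) f\<bar> \<le> 4 * e" using True e by simp
        qed
        then have none: "{\<omega> \<in> space M. ennreal (5 * e) < Z n \<omega>} = {}" by (auto simp: not_less)
        show ?thesis unfolding none using \<delta> by simp
      next
        case False
        then have Bn: "e < B n" by simp
        obtain C where *: "C \<subseteq> F n \<and> finite C \<and> card C \<le> N n \<and> (\<forall>f\<in>F n. \<exists>g\<in>C. L n * nrm (\<lambda>r. f r - g r) \<le> e / 2)"
          using cover[OF n e] unfolding N_def by (rule exE)
        then have C: "C \<subseteq> F n" "finite C" "card C \<le> N n" by simp_all
        have Cc: "\<exists>g\<in>C. L n * nrm (\<lambda>r. f r - g r) \<le> e / 2" if "f \<in> F n" for f
          using *[THEN conjunct2, THEN conjunct2, THEN conjunct2] that by (rule bspec)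
        have cov: "\<exists>g\<in>C. \<forall>q\<in>\<Q>. \<forall>x. \<bar>\<phi> (f q) x - \<phi> (g q) x\<bar> \<le> e / 2" if f: "f \<in> F n" for f
        proof -
          obtain g where g: "g \<in> C" "L n * nrm (\<lambda>r. f r - g r) \<le> e / 2" by (rule bexE[OF Cc[OF f]])
          have gF: "g \<in> F n" using g(1) C(1) by blast
          have "\<bar>\<phi> (f q) x - \<phi> (g q) x\<bar> \<le> e / 2" if "q \<in> \<Q>" for q x
            using E_lipschitz[OF n f gF that, of x] g(2) by linarith
          then show ?thesis using g(1) by blast
        qed
        have Cne: "1 \<le> card C" using Cc[OF f0n] C(2) by (auto simp: Suc_le_eq card_gt_0_iff)
        \<comment> \<open>If one element covers \<open>F n\<close>, then \<open>ln (N n) = 0\<close> and the entropy condition is void; but then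
          all losses are within \<open>e\<close> of those of \<open>f0\<close>, so the constant \<open>c1\<close> replaces \<open>B n\<close>.\<close>
        define b where "b = (if 2 \<le> N n then B n else min (B n) c1)"
        have eb: "e \<le> b" and bB: "b \<le> B n" using Bn c1 by (auto simp: b_def)
        have b0: "0 < b" using eb e by simp
        have bound: "0 \<le> \<phi> (f q) x \<and> \<phi> (f q) x \<le> b" if f: "f \<in> F n" and q: "q \<in> \<Q>" for f q x
        proof (cases "2 \<le> N n")
          case True then show ?thesis using E_bound[OF n f q] by (simp add: b_def)
        next
          case False
          then have "card C = 1" using Cne C(3) by simp
          then obtain g where g: "C = {g}" by (auto simp: card_1_singleton_iff)
          have "\<bar>\<phi> (f q) x - \<phi> (g q) x\<bar> \<le> e / 2" "\<bar>\<phi> (f0 q) x - \<phi> (g q) x\<bar> \<le> e / 2"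
            using cov[OF f] cov[OF f0n] q g by auto
          then have "\<phi> (f q) x \<le> c1" using E_bound[OF n0 f0 q, of x] unfolding c1_def by linarith
          then show ?thesis using E_bound[OF n f q] False by (simp add: b_def)
        qed
        have kb: "real (k n) * b powr \<gamma> \<le> real (k n) * B n powr \<gamma>"
          using bB b0 D(1) by (intro mult_left_mono powr_mono2) (auto simp: \<gamma>_def)
        obtain m where m: "1 \<le> m" "real m powr (- \<beta>) \<le> 1 / (A * b)"
          and bm: "b * real m \<le> b powr \<gamma> * (A powr (1 / \<beta>) + e powr (- 1 / \<beta>))"
          using truncation_level[OF D(1) Apos e eb] unfolding \<gamma>_def by blast
        have sparse: "b * (real (k n) * real m / real n) \<le> e / 2"
        proof -
          let ?a = "A powr (1 / \<beta>) + e powr (- 1 / \<beta>)"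
          have a: "0 < ?a" using Apos e by (simp add: add_pos_pos)
          have "real (k n) * b powr \<gamma> \<le> ?c * real n" using kb elim(2) by simp
          then have "real (k n) * b powr \<gamma> * ?a \<le> e / 2 * real n"
            using a by (simp add: field_simps)
          moreover have "real (k n) * (b * real m) \<le> real (k n) * (b powr \<gamma> * ?a)"
            using bm by (intro mult_left_mono) auto
          ultimately have "b * (real (k n) * real m) \<le> e / 2 * real n" by (simp add: mult_ac)
          then show ?thesis using n by (simp add: pos_divide_le_eq)
        qed
        have t1: "2 * K\<^sub>1 * b * real m powr (- \<beta>) / (\<beta> * e) \<le> \<delta> / 2"
        proof -
          have "2 * K\<^sub>1 * b * real m powr (- \<beta>) / (\<beta> * e) \<le> 2 * K\<^sub>1 * b * (1 / (A * b)) / (\<beta> * e)"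
            using m(2) D e b0 by (intro divide_right_mono mult_left_mono) auto
          also have "\<dots> = \<delta> / 2" using D e b0 \<delta> by (simp add: A_def field_simps)
          finally show ?thesis .
        qed
        have t2: "4 * real (N n) * exp (- (real n * e\<^sup>2 / (real (k n) * b\<^sup>2))) \<le> \<delta> / 2"
        proof (cases "2 \<le> N n")
          case True
          have "real (k n) * B n * sqrt (ln (real (N n))) \<le> e / sqrt (J + 1) * sqrt (real n)"
            using elim(4) by (simp add: abs_le_iff)
          then have "real (N n) * exp (- (real n * e\<^sup>2 / (real (k n) * (B n)\<^sup>2))) \<le> exp (- (J * ln 2))"
            by (rule entropy_bound[OF True kn n less_trans[OF e Bn] J e])
          also have "J * ln 2 = l" by (simp add: J_def)
          also note exp_l
          finally show ?thesis using True by (simp add: b_def)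
        next
          case False
          then have N1: "real (N n) \<le> 1" and bc1: "b \<le> c1" by (auto simp: b_def)
          \<comment> \<open>Because \<open>e \<le> b\<close>, the first half of (II) bounds
            \<open>k n\<close> itself by a small multiple of \<open>n\<close>. With
            \<open>b \<le> c1\<close> fixed, this makes the exponent at least
            \<open>l + 1\<close>.\<close>
          have "real (k n) * e powr \<gamma> \<le> real (k n) * b powr \<gamma>"
            using eb e D(1) by (intro mult_left_mono powr_mono2) (auto simp: \<gamma>_def)
          also have "\<dots> \<le> ?c' * real n" using kb elim(3) by simp
          finally have "real (k n) * e powr \<gamma> \<le> (real n * e\<^sup>2 / (c1\<^sup>2 * (l + 1))) * e powr \<gamma>" by (simp add: mult_ac)
          then have "real (k n) \<le> real n * e\<^sup>2 / (c1\<^sup>2 * (l + 1))"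
            by (rule mult_right_le_imp_le) (use e in simp)
          moreover have "0 < c1\<^sup>2 * (l + 1)" using c1 l by (intro mult_pos_pos) auto
          ultimately have "(l + 1) * (real (k n) * c1\<^sup>2) \<le> real n * e\<^sup>2"
            by (simp only: pos_le_divide_eq mult_ac)
          moreover have "(l + 1) * (real (k n) * b\<^sup>2) \<le> (l + 1) * (real (k n) * c1\<^sup>2)"
            using bc1 b0 l by (intro mult_left_mono power_mono) auto
          ultimately have "l + 1 \<le> real n * e\<^sup>2 / (real (k n) * b\<^sup>2)" using kn b0 by (simp add: pos_le_divide_eq)
          then have "exp (- (real n * e\<^sup>2 / (real (k n) * b\<^sup>2))) \<le> exp (- l)" by simp
          then have "real (N n) * exp (- (real n * e\<^sup>2 / (real (k n) * b\<^sup>2))) \<le> 1 * exp (- l)"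
            using N1 by (intro mult_mono) auto
          then show ?thesis using exp_l by simp
        qed
        have "\<exists>E\<in>sets M. prob E \<le> 4 * real (N n) * exp (- (real n * e\<^sup>2 / (real (k n) * b\<^sup>2))) + 2 * K\<^sub>1 * b * real m powr (- \<beta>) / (\<beta> * e) \<and>
            (\<forall>\<omega>\<in>space M - E. \<forall>f\<in>F n. \<bar>emp n f \<omega> - Rk (k n) f\<bar> \<le> 4 * e)"
          unfolding emp_def Rk_def
          by (rule uniform_deviation[OF queries struct surrogate_cont n kn _ b0 e C _ D(1) less_imp_le[OF D(2)] D(3) m(1) sparse])
            (erule (1) bound, erule cov)
        then obtain E where EM: "E \<in> sets M" and E: "prob E \<le> 4 * real (N n) * exp (- (real n * e\<^sup>2 / (real (k n) * b\<^sup>2))) + 2 * K\<^sub>1 * b * real m powr (- \<beta>) / (\<beta> * e) \<and>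
            (\<forall>\<omega>\<in>space M - E. \<forall>f\<in>F n. \<bar>emp n f \<omega> - Rk (k n) f\<bar> \<le> 4 * e)"
          by (rule bexE)
        have good: "\<bar>emp n f \<omega> - Rk (k n) f\<bar> \<le> 4 * e" if "\<omega> \<in> space M - E" "f \<in> F n" for \<omega> f
          using E[THEN conjunct2, rule_format, OF that] .
        have "{\<omega> \<in> space M. ennreal (5 * e) < Z n \<omega>} \<subseteq> E"
        proof
          fix \<omega> assume "\<omega> \<in> {\<omega> \<in> space M. ennreal (5 * e) < Z n \<omega>}"
          then have "\<omega> \<in> space M" "\<not> Z n \<omega> \<le> ennreal (5 * e)" by (auto simp: not_le)
          then show "\<omega> \<in> E" using Zle[of \<omega>] good[of \<omega>] EM by blast
        qed
        then have "prob {\<omega> \<in> space M. ennreal (5 * e) < Z n \<omega>} \<le> prob E" by (rule finite_measure_mono[OF _ EM])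
        then show ?thesis using E[THEN conjunct1] t1 t2 by linarith
      qed
    qed
  qed
  have "(\<lambda>n. prob {\<omega> \<in> space M. ennreal \<epsilon> < Z n \<omega>}) \<longlonglongrightarrow> 0" if \<epsilon>: "0 < \<epsilon>" for \<epsilon>
  proof (rule order_tendstoI)
    fix a :: real assume "a < 0"
    then show "\<forall>\<^sub>F n in sequentially. a < prob {\<omega> \<in> space M. ennreal \<epsilon> < Z n \<omega>}"
      by (intro always_eventually allI) (meson less_le_trans measure_nonneg)
  next
    fix a :: real assume a: "0 < a"
    then have "\<forall>\<^sub>F n in sequentially. prob {\<omega> \<in> space M. ennreal (5 * (\<epsilon> / 5)) < Z n \<omega>} \<le> a / 2"
      using \<epsilon> by (intro main) auto
    then show "\<forall>\<^sub>F n in sequentially. prob {\<omega> \<in> space M. ennreal \<epsilon> < Z n \<omega>} < a"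
      by eventually_elim (use a in auto)
  qed
  then show ?thesis
    unfolding converges_to_0_in_probability_def Z_def[symmetric] emp_def[symmetric] R_def[symmetric]
    using Z_measurable by simp
qed

end
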